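(* Let $r\ge 2$ be an integer and let $J> J_{uniq}(r)=\operatorname{arctanh}\frac{1}{2r-1}$. Then the free boundary Ising state $\mu^{\mathrm{FB}}=\mu_0$ on $\mathbb{F}_r$ with interaction strength $J$ and zero external field is not $\mathrm{f}$-equilibrium; that is, there exists a shift-invariant Borel probability measure $\nu$ on $\{-1,+1\}^{\mathbb{F}_r}$ with $\mathrm{p}_{\mathrm{f}}(\nu)>\mathrm{p}_{\mathrm{f}}(\mu^{\mathrm{FB}})$.
   Context: Let $\mathbb{F}_r=\langle s_1,\dots,s_r\rangle$ be the free group of rank $r$; its Cayley graph (edges $\{\gamma,s_i\gamma\}$) is the $2r$-regular tree. $\mathbb{F}_r$ acts on $\{-1,+1\}^{\mathbb{F}_r}$ by the shift $(g\cdot \mathbf{x})(h)=\mathbf{x}(hg)$. Ising model with interaction strength $J>0$ and no external field: $u(\mathbf{x})=-\frac{J}{2}\sum_{i=1}^r\big(\mathbf{x}(e)\mathbf{x}(s_i)+\mathbf{x}(e)\mathbf{x}(s_i^{-1})\big)$, and $u(\mu)=\int u\,d\mu$. Low temperature means large $J$; "below the uniqueness threshold" in temperature means $J>J_{uniq}(r)$. For $t\in\mathbb{R}$ let $\alpha(t)=\frac{e^{-2J}+e^{-2t}}{2e^{-2J}+2\cosh(2t)}$ and $\beta(t)=\frac{1}{e^{2(J+t)}+1}$. Let $\mu_t$ be the tree-indexed Markov chain on $\{-1,+1\}^{\mathbb{F}_r}$, invariant under all automorphisms of the Cayley tree, with single-site marginal $\mathbb{P}\{-1\}=\alpha(t)$,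 $\mathbb{P}\{+1\}=1-\alpha(t)$, and with transition probabilities across each edge $\mathbb{P}\{-1\to+1\}=\beta(-t)$, $\mathbb{P}\{-1\to-1\}=1-\beta(-t)$, $\mathbb{P}\{+1\to-1\}=\beta(t)$, $\mathbb{P}\{+1\to+1\}=1-\beta(t)$. The free boundary state is $\mu^{\mathrm{FB}}=\mu_0$. For a finite set $V$, a map $\sigma:\mathbb{F}_r\to\operatorname{Sym}(V)$ and $\mathbf{x}\in\{-1,+1\}^V$, let $\Pi_v^\sigma\mathbf{x}(\gamma)=\mathbf{x}(\sigma(\gamma)(v))$ and $P^\sigma_{\mathbf{x}}=\frac1{|V|}\sum_{v\in V}\delta_{\Pi_v^\sigma\mathbf{x}}$. For a set $\mathcal{O}$ of Borel probability measures on $\{-1,+1\}^{\mathbb{F}_r}$ let $\Omega(\sigma,\mathcal{O})=\{\mathbf{x}: P^\sigma_{\mathbf{x}}\in\mathcal{O}\}$. The $\mathrm{f}$-entropy is $$\mathrm{f}(\mu)=\mathrm{h}_{\mathrm{f}}(\mu)=\inf_{\mathcal{O}\ni\mu}\limsup_{n\to\infty}\frac1n\log\mathbb{E}|\Omega(\sigma_n,\mathcal{O})|,$$ where $\sigma_n$ is uniformly random in $\operatorname{Hom}(\mathbb{F}_r,\operatorname{Sym}(n))$ and $\mathcal{O}$ ranges over weak*-open neighborhoods of $\mu$. For Markov chains this equals $(1-r)H_\mu(\mathbf{x}(e))+\sum_{i=1}^rH_\mu(\mathbf{x}(e)\mid\mathbf{x}(s_i))$, where $H$ is Shannon entropy.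 The $\mathrm{f}$-pressure is $\mathrm{p}_{\mathrm{f}}(\mu)=\mathrm{f}(\mu)-u(\mu)$; a shift-invariant $\mu$ is $\mathrm{f}$-equilibrium if it maximizes $\mathrm{p}_{\mathrm{f}}$ over all shift-invariant Borel probability measures on $\{-1,+1\}^{\mathbb{F}_r}$. *)

theory Defs
  imports "HOL-Probability.Probability" "HOL-Algebra.Sym_Groups"
begin

section \<open>The free group on the elements of a type\<close>

text \<open>
  A letter \<open>(i, True)\<close> stands for the generator \<open>s\<^sub>i\<close> and \<open>(i, False)\<close> for its inverse.
  The free group consists of the reduced words; its rank is the cardinality of the type \<open>'r\<close>
  of generators.
\<close>

definition inv_letter :: "'r \<times> bool \<Rightarrow> 'r \<times> bool" where
  "inv_letter a = (fst a, \<not> snd a)"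

definition reduced :: "('r \<times> bool) list \<Rightarrow> bool" where
  "reduced w \<longleftrightarrow> (\<forall>k. Suc k < length w \<longrightarrow> w ! Suc k \<noteq> inv_letter (w ! k))"

typedef 'r fword = "{w :: ('r \<times> bool) list. reduced w}"
  by (rule exI[of _ "[]"]) (simp add: reduced_def)

setup_lifting type_definition_fword

text \<open>Left multiplication of a reduced word by one letter, followed by cancellation.\<close>

fun push :: "'r \<times> bool \<Rightarrow> ('r \<times> bool) list \<Rightarrow> ('r \<times> bool) list" where
  "push a [] = [a]"
| "push a (b # w) = (if b = inv_letter a then w else a # b # w)"

lemma inv_letter_invol [simp]: "inv_letter (inv_letter a) = a"
  by (simp add: inv_letter_def)

lemma inv_letter_neq [simp]: "inv_letter a \<noteq> a"
  by (cases a) (simp add: inv_letter_def)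

lemma reduced_Nil [simp]: "reduced []"
  by (simp add: reduced_def)

lemma reduced_singleton [simp]: "reduced [a]"
  by (simp add: reduced_def)

lemma reduced_Cons2 [simp]: "reduced (a # b # w) \<longleftrightarrow> b \<noteq> inv_letter a \<and> reduced (b # w)"
  unfolding reduced_def by (auto simp: less_Suc_eq_0_disj nth_Cons split: nat.splits)

lemma reduced_tl: "reduced (a # w) \<Longrightarrow> reduced w"
  by (cases w) auto

lemma reduced_push: "reduced w \<Longrightarrow> reduced (push a w)"
  by (cases w) (auto dest: reduced_tl)

lemma reduced_foldr_push: "reduced w \<Longrightarrow> reduced (foldr push u w)"
  by (induction u) (auto intro: reduced_push)

lift_definition fmult :: "'r fword \<Rightarrow> 'r fword \<Rightarrow> 'r fword" is "\<lambda>u w. foldr push u w"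
  by (rule reduced_foldr_push)

lift_definition fone :: "'r fword" is "[]"
  by simp

lift_definition letter :: "'r \<times> bool \<Rightarrow> 'r fword" is "\<lambda>a. [a]"
  by simp

definition free_group :: "'r fword monoid" where
  "free_group = \<lparr>carrier = UNIV, mult = fmult, one = fone\<rparr>"

definition gen :: "'r \<Rightarrow> 'r fword" where
  "gen i = letter (i, True)"

definition gen_inv :: "'r \<Rightarrow> 'r fword" where
  "gen_inv i = letter (i, False)"

lemma push_cancel: "reduced w \<Longrightarrow> push a (push (inv_letter a) w) = w"
  by (cases w rule: remdups_adj.cases) auto

lemma foldr_push_push:
  "reduced w \<Longrightarrow> foldr push (push a v) w = push a (foldr push v w)"
  by (cases v) (auto simp: reduced_foldr_push push_cancel)

lemma foldr_push_assoc:
  "reduced w \<Longrightarrow> foldr push (foldr push u v) w = foldr push u (foldr push v w)"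
  by (induction u) (auto simp: foldr_push_push)

lemma foldr_push_reduced: "reduced u \<Longrightarrow> foldr push u [] = u"
proof (induction u)
  case (Cons a u)
  then show ?case by (cases u) (auto dest: reduced_tl)
qed simp

lemma foldr_push_inv: "foldr push (rev (map inv_letter u)) (foldr push u []) = []"
proof (induction u)
  case (Cons a u)
  have "push (inv_letter a) (push (inv_letter (inv_letter a)) (foldr push u [])) = foldr push u []"
    by (rule push_cancel) (simp add: reduced_foldr_push)
  with Cons show ?case by simp
qed simp

lemma group_free_group: "group (free_group :: 'r fword monoid)"
proof (rule groupI)
  fix x :: "'r fword"
  have "\<exists>y. fmult y x = fone"
  proof (transfer, intro bexI)
    fix u :: "('r \<times> bool) list"
    assume u: "reduced u"
    have "foldr push (foldr push (rev (map inv_letter u)) []) u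
        = foldr push (rev (map inv_letter u)) (foldr push u [])"
      by (simp add: foldr_push_assoc u foldr_push_reduced)
    then show "foldr push (foldr push (rev (map inv_letter u)) []) u = []"
      by (simp only: foldr_push_inv)
    show "foldr push (rev (map inv_letter u)) [] \<in> Collect reduced"
      by (simp add: reduced_foldr_push)
  qed
  then show "\<exists>y\<in>carrier free_group. y \<otimes>\<^bsub>free_group\<^esub> x = \<one>\<^bsub>free_group\<^esub>"
    by (simp add: free_group_def)
qed (simp_all add: free_group_def, (transfer, simp add: foldr_push_assoc)+)

lemma gen_inv_eq: "gen_inv i = inv\<^bsub>free_group\<^esub> (gen i)"
proof -
  interpret group "free_group :: 'a fword monoid" by (rule group_free_group)
  have "fmult (gen_inv i) (gen i) = fone"
    unfolding gen_def gen_inv_def by transfer (simp add: inv_letter_def)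
  then show ?thesis
    by (intro inv_equality[symmetric]) (simp_all add: free_group_def)
qed

instance fword :: (countable) countable
  by (rule countable_classI[of "\<lambda>w. to_nat (Rep_fword w)"]) (simp add: Rep_fword_inject)


section \<open>Spin configurations\<close>

datatype spin = Minus | Plus

fun spin_val :: "spin \<Rightarrow> real" where
  "spin_val Minus = - 1"
| "spin_val Plus = 1"

lemma UNIV_spin: "UNIV = {Minus, Plus}"
  using spin.exhaust by auto

instance spin :: finite
  by standard (simp add: UNIV_spin)

instantiation spin :: discrete_topology
begin

definition open_spin :: "spin set \<Rightarrow> bool" where
  "open_spin S \<longleftrightarrow> True"

instance by standard (simp_all add: open_spin_def)

end

instance spin :: second_countable_topology
proof
  show "\<exists>B :: spin set set. countable B \<and> open = generate_topology B"
    by (rule exI[of _ UNIV])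
      (auto simp: fun_eq_iff open_spin_def intro: generate_topology.Basis countable_finite)
qed

text \<open>
  The function type carries the product topology, so \<open>borel :: 'r config measure\<close> is the
  usual Borel sigma-algebra of the space of configurations.
\<close>

type_synonym 'r config = "'r fword \<Rightarrow> spin"

definition shift :: "'r fword \<Rightarrow> 'r config \<Rightarrow> 'r config" where
  "shift g x = (\<lambda>h. x (h \<otimes>\<^bsub>free_group\<^esub> g))"

definition borel_probs :: "'a::topological_space measure set" where
  "borel_probs = {\<mu>. prob_space \<mu> \<and> sets \<mu> = sets borel}"

definition shift_invariant :: "'r config measure \<Rightarrow> bool" where
  "shift_invariant \<mu> \<longleftrightarrow> (\<forall>g. distr \<mu> borel (shift g) = \<mu>)"

definition weak_star :: "'a::topological_space measure topology" where
  "weak_star = topology_generated_by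
     {{\<mu> \<in> borel_probs. integral\<^sup>L \<mu> f \<in> U} | (f :: 'a \<Rightarrow> real) U.
        continuous_on UNIV f \<and> bounded (range f) \<and> open U}"

lemma topspace_weak_star: "topspace weak_star = borel_probs"
proof -
  have "borel_probs = {\<mu> \<in> borel_probs. integral\<^sup>L \<mu> (\<lambda>_::'a. 0::real) \<in> UNIV}"
    by simp
  moreover have "continuous_on UNIV (\<lambda>_::'a. 0::real)" "bounded (range (\<lambda>_::'a. 0::real))"
    "open (UNIV :: real set)"
    by auto
  ultimately have "borel_probs \<in> {{\<mu> \<in> borel_probs. integral\<^sup>L \<mu> f \<in> U} | (f :: 'a \<Rightarrow> real) U.
        continuous_on UNIV f \<and> bounded (range f) \<and> open U}"
    by blast
  then show ?thesis
    unfolding weak_star_def topology_generated_by_topspace by blast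
qed


section \<open>Ising energy and tree-indexed Markov chains\<close>

definition ising_u :: "real \<Rightarrow> ('r::finite) config \<Rightarrow> real" where
  "ising_u J x = - (J / 2) * (\<Sum>i\<in>UNIV.
     spin_val (x \<one>\<^bsub>free_group\<^esub>) * spin_val (x (gen i)) +
     spin_val (x \<one>\<^bsub>free_group\<^esub>) * spin_val (x (gen_inv i)))"

definition mean_energy :: "real \<Rightarrow> ('r::finite) config measure \<Rightarrow> real" where
  "mean_energy J \<mu> = (\<integral>x. ising_u J x \<partial>\<mu>)"

definition cayley_adj :: "'r fword \<Rightarrow> 'r fword \<Rightarrow> bool" where
  "cayley_adj g h \<longleftrightarrow>
     (\<exists>i. h = gen i \<otimes>\<^bsub>free_group\<^esub> g \<or> g = gen i \<otimes>\<^bsub>free_group\<^esub> h)"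

definition cayley_aut :: "('r fword \<Rightarrow> 'r fword) \<Rightarrow> bool" where
  "cayley_aut \<phi> \<longleftrightarrow> bij \<phi> \<and> (\<forall>g h. cayley_adj (\<phi> g) (\<phi> h) \<longleftrightarrow> cayley_adj g h)"

text \<open>The component containing \<open>g\<close> of the Cayley tree with the edge \<open>{g, h}\<close> removed.\<close>

definition edge_side :: "'r fword \<Rightarrow> 'r fword \<Rightarrow> 'r fword set" where
  "edge_side g h = {k. (\<lambda>a b. cayley_adj a b \<and> {a, b} \<noteq> {g, h})\<^sup>*\<^sup>* g k}"

definition ising_alpha :: "real \<Rightarrow> real \<Rightarrow> real" where
  "ising_alpha J t = (exp (- 2 * J) + exp (- 2 * t)) / (2 * exp (- 2 * J) + 2 * cosh (2 * t))"

definition ising_beta :: "real \<Rightarrow> real \<Rightarrow> real" where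
  "ising_beta J t = 1 / (exp (2 * (J + t)) + 1)"

fun site_prob :: "real \<Rightarrow> real \<Rightarrow> spin \<Rightarrow> real" where
  "site_prob J t Minus = ising_alpha J t"
| "site_prob J t Plus = 1 - ising_alpha J t"

fun trans_prob :: "real \<Rightarrow> real \<Rightarrow> spin \<Rightarrow> spin \<Rightarrow> real" where
  "trans_prob J t Minus Plus = ising_beta J (- t)"
| "trans_prob J t Minus Minus = 1 - ising_beta J (- t)"
| "trans_prob J t Plus Minus = ising_beta J t"
| "trans_prob J t Plus Plus = 1 - ising_beta J t"

text \<open>
  The last clause is the Markov property: across every oriented edge \<open>(g, h)\<close>, conditionally on
  what is seen at \<open>g\<close> and at finitely many further sites behind \<open>g\<close>, the spin at \<open>h\<close> is
  distributed according to the transition probabilities from the spin at \<open>g\<close>.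
\<close>

definition is_ising_chain :: "real \<Rightarrow> real \<Rightarrow> 'r config measure \<Rightarrow> bool" where
  "is_ising_chain J t \<mu> \<longleftrightarrow>
     \<mu> \<in> borel_probs \<and>
     (\<forall>\<phi>. cayley_aut \<phi> \<longrightarrow> distr \<mu> borel (\<lambda>x. x \<circ> \<phi>) = \<mu>) \<and>
     (\<forall>g b. \<P>(x in \<mu>. x g = b) = site_prob J t b) \<and>
     (\<forall>g h W \<eta> b.
        cayley_adj g h \<and> finite W \<and> g \<in> W \<and> W \<subseteq> edge_side g h \<and>
        \<P>(x in \<mu>. \<forall>k\<in>W. x k = \<eta> k) > 0 \<longrightarrow>
        \<P>(x in \<mu>. x h = b \<bar> \<forall>k\<in>W. x k = \<eta> k) = trans_prob J t (\<eta> g) b)"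

definition ising_chain :: "real \<Rightarrow> real \<Rightarrow> 'r config measure" where
  "ising_chain J t = (THE \<mu>. is_ising_chain J t \<mu>)"

definition free_boundary_state :: "real \<Rightarrow> 'r config measure" where
  "free_boundary_state J = ising_chain J 0"

definition J_uniq :: "nat \<Rightarrow> real" where
  "J_uniq r = artanh (1 / (2 * real r - 1))"


section \<open>The f-entropy and the f-pressure\<close>

definition pullback_name :: "('r fword \<Rightarrow> 'v \<Rightarrow> 'v) \<Rightarrow> ('v \<Rightarrow> spin) \<Rightarrow> 'v \<Rightarrow> 'r config" where
  "pullback_name \<sigma> x v = (\<lambda>\<gamma>. x (\<sigma> \<gamma> v))"

definition empirical :: "'v set \<Rightarrow> ('r fword \<Rightarrow> 'v \<Rightarrow> 'v) \<Rightarrow> ('v \<Rightarrow> spin) \<Rightarrow> 'r config measure" where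
  "empirical V \<sigma> x = distr (uniform_count_measure V) borel (pullback_name \<sigma> x)"

lemma measure_empirical:
  assumes "finite V" "A \<in> sets borel"
  shows "measure (empirical V \<sigma> x) A =
    (1 / card V) * (\<Sum>v\<in>V. measure (return borel (pullback_name \<sigma> x v)) A)"
proof -
  have "measure (empirical V \<sigma> x) A = card {v\<in>V. pullback_name \<sigma> x v \<in> A} / card V"
    unfolding empirical_def using assms
    by (subst measure_distr)
      (auto simp: sets_uniform_count_measure_count_space space_uniform_count_measure
        measure_uniform_count_measure vimage_def Int_def measurable_def conj_commute
        sets_uniform_count_measure)
  also have "real (card {v\<in>V. pullback_name \<sigma> x v \<in> A}) =
      (\<Sum>v\<in>V. measure (return borel (pullback_name \<sigma> x v)) A)"
    using assms by (simp add: measure_return indicator_def sum.If_cases Int_def)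
  finally show ?thesis by simp
qed

definition good_models ::
    "'v set \<Rightarrow> ('r fword \<Rightarrow> 'v \<Rightarrow> 'v) \<Rightarrow> 'r config measure set \<Rightarrow> ('v \<Rightarrow> spin) set" where
  "good_models V \<sigma> \<N> = {x \<in> V \<rightarrow>\<^sub>E UNIV. empirical V \<sigma> x \<in> \<N>}"

definition expected_models :: "'r config measure set \<Rightarrow> nat \<Rightarrow> real" where
  "expected_models \<N> n = measure_pmf.expectation (pmf_of_set (hom free_group (sym_group n)))
     (\<lambda>\<sigma>. real (card (good_models {1..n} \<sigma> \<N>)))"

lemma finite_hom_sym_group:
  "finite (hom (free_group :: ('r::finite) fword monoid) (sym_group n))"
proof -
  let ?H = "hom (free_group :: 'r fword monoid) (sym_group n)"
  let ?S = "carrier (sym_group n)"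
  have fin: "finite ?S"
    unfolding sym_group_def by (simp add: finite_permutations)
  have "inj_on (\<lambda>\<sigma> a. \<sigma> (letter a)) ?H"
  proof (rule inj_onI)
    fix \<sigma> \<tau> assume hom: "\<sigma> \<in> ?H" "\<tau> \<in> ?H"
      and eq: "(\<lambda>a. \<sigma> (letter a)) = (\<lambda>a. \<tau> (letter a))"
    interpret G: group "free_group :: 'r fword monoid" by (rule group_free_group)
    interpret K: group "sym_group n" by (rule sym_group_is_group)
    have one: "\<sigma> fone = \<tau> fone"
      using hom_one[OF hom(1) G.is_group K.is_group] hom_one[OF hom(2) G.is_group K.is_group]
      by (simp add: free_group_def)
    have mult: "\<rho> (fmult u w) = \<rho> u \<otimes>\<^bsub>sym_group n\<^esub> \<rho> w" if "\<rho> \<in> ?H" for \<rho> u w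
      using that by (simp add: hom_def free_group_def)
    have "\<sigma> (Abs_fword w) = \<tau> (Abs_fword w)" if "reduced w" for w
      using that
    proof (induction w)
      case Nil
      then show ?case using one by (simp add: fone_def)
    next
      case (Cons a w)
      have "push a w = a # w"
        using Cons.prems by (cases w) auto
      then have "Abs_fword (a # w) = fmult (letter a) (Abs_fword w)"
        using Cons.prems reduced_tl[OF Cons.prems]
        by (simp add: fmult_def letter_def Abs_fword_inverse)
      then show ?case
        using Cons.IH[OF reduced_tl[OF Cons.prems]] fun_cong[OF eq, of a] mult hom by simp
    qed
    then show "\<sigma> = \<tau>"
      by (metis Abs_fword_cases ext mem_Collect_eq)
  qed
  moreover have "(\<lambda>\<sigma> a. \<sigma> (letter a)) ` ?H \<subseteq> UNIV \<rightarrow>\<^sub>E ?S"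
    by (auto simp: hom_def free_group_def)
  then have "finite ((\<lambda>\<sigma> a. \<sigma> (letter a)) ` ?H)"
    by (rule finite_subset) (intro finite_PiE fin finite)
  ultimately show ?thesis
    by (rule finite_imageD[rotated])
qed

lemma hom_sym_group_nonempty:
  "hom (free_group :: 'r fword monoid) (sym_group n) \<noteq> {}"
proof -
  have "(\<lambda>_. id) \<in> hom (free_group :: 'r fword monoid) (sym_group n)"
    by (auto simp: hom_def sym_group_def permutes_id)
  then show ?thesis by blast
qed

text \<open>The real function \<open>ln\<close> has the junk value \<open>ln 0 = 0\<close>; here \<open>log 0\<close> must be \<open>-\<infinity>\<close>.\<close>

definition elog :: "real \<Rightarrow> ereal" where
  "elog a = (if a \<le> 0 then - \<infinity> else ereal (ln a))"

definition f_entropy :: "'r config measure \<Rightarrow> ereal" where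
  "f_entropy \<mu> = (INF \<N> \<in> {\<N>. openin weak_star \<N> \<and> \<mu> \<in> \<N>}.
     limsup (\<lambda>n. ereal (1 / real n) * elog (expected_models \<N> n)))"

definition f_pressure :: "real \<Rightarrow> ('r::finite) config measure \<Rightarrow> ereal" where
  "f_pressure J \<mu> = f_entropy \<mu> - ereal (mean_energy J \<mu>)"

definition f_equilibrium :: "real \<Rightarrow> ('r::finite) config measure \<Rightarrow> bool" where
  "f_equilibrium J \<mu> \<longleftrightarrow>
     \<mu> \<in> borel_probs \<and> shift_invariant \<mu> \<and>
     (\<forall>\<nu> :: 'r config measure.
        \<nu> \<in> borel_probs \<and> shift_invariant \<nu> \<longrightarrow> f_pressure J \<nu> \<le> f_pressure J \<mu>)"

end

theory Submission
  imports Defs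
begin

text \<open>
  The proof compares two exponential growth rates of the annealed partition function
  \<open>Z n = E (\<Sum>x. exp (- n u (P x)))\<close>, where the expectation is over a uniform homomorphism from the free
  group to the symmetric group and \<open>P x\<close> is the empirical measure of the labelling \<open>x\<close> of \<open>{1..n}\<close>.

  \<^item> Labellings with magnetization near zero contribute at most at the rate
    \<open>A = (1 - r) ln 2 + r ln (2 cosh J)\<close>. The single-site marginals of the free boundary state are uniform,
    so this bounds its f-pressure (\<open>f_pressure_balanced_le\<close>).
  \<^item> All labellings together contribute at a rate larger than \<open>A\<close> (\<open>partition_fn_UNIV_growth\<close>). Among the
    labellings with a fraction \<open>a\<close> of plus spins, consider those for which each generator has a fraction \<open>d\<close>
    of sites where a plus spin is followed by a minus spin. Their contribution is explicit, because the
    generators act by independent uniform permutations. When \<open>d\<close> is half the flip probability of the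
    free boundary state, the rate as a function of \<open>a\<close> equals \<open>A\<close> and is stationary at \<open>a = 1/2\<close>, where its
    second derivative \<open>4 ((r - 1) - r exp (- 2 J))\<close> is positive above the uniqueness threshold
    (\<open>exists_pair_rate_greater\<close>).
  \<^item> Some shift-invariant measure has f-pressure at least the growth rate of \<open>Z\<close>
    (\<open>exists_shift_invariant_f_pressure_ge\<close>). The space of Borel probability measures on configurations
    is weak*-compact (\<open>compact_space_weak_star\<close>), the empirical measures are shift-invariant, and
    finitely many neighbourhoods with too slow growth could not account for all of \<open>Z\<close>. No formula for
    the f-entropy of Markov chains is needed.

  The free boundary state is defined as the unique tree-indexed Markov chain with given transition
  probabilities, so its existence and uniqueness have to be established before anything can be said about it. It
  is constructed by flipping a uniform root spin independently along the edges
  (\<open>free_chain_is_ising_chain\<close>); invariance under all automorphisms of the tree holds since the root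
  spin is uniform and independent of the flips. Uniqueness is \<open>is_ising_chain_unique\<close>.
\<close>

section \<open>Compactness of the space of measures on configurations\<close>

lemma open_config_coordinate: "open {x :: 'r config. x g = b}"
proof -
  have "{x :: 'r config. x g = b} = (\<lambda>x. x g) -` {b}" by auto
  moreover have "open ((\<lambda>x :: 'r config. x g) -` {b})"
    by (rule open_vimage) (simp_all add: open_spin_def)
  ultimately show ?thesis by simp
qed

text \<open>
  Sets that are both open and closed.
\<close>

definition clopen :: "'a::topological_space set \<Rightarrow> bool" where
  "clopen C \<longleftrightarrow> open C \<and> closed C"

lemma clopen_simps [simp]:
  "clopen {}" "clopen UNIV"
  "clopen A \<Longrightarrow> clopen (- A)"
  "clopen A \<Longrightarrow> clopen B \<Longrightarrow> clopen (A \<union> B)"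
  "clopen A \<Longrightarrow> clopen B \<Longrightarrow> clopen (A \<inter> B)"
  "clopen A \<Longrightarrow> clopen B \<Longrightarrow> clopen (A - B)"
  by (auto simp: clopen_def open_Diff closed_Diff)

lemma clopen_UN: "finite I \<Longrightarrow> (\<And>i. i \<in> I \<Longrightarrow> clopen (A i)) \<Longrightarrow> clopen (\<Union>i\<in>I. A i)"
  by (auto simp: clopen_def)

lemma clopen_INT: "finite I \<Longrightarrow> (\<And>i. i \<in> I \<Longrightarrow> clopen (A i)) \<Longrightarrow> clopen (\<Inter>i\<in>I. A i)"
  by (auto simp: clopen_def)

lemma clopen_borel [measurable]: "clopen C \<Longrightarrow> C \<in> sets borel"
  by (simp add: clopen_def)

lemma clopen_config_coordinate [simp]: "clopen {x :: 'r config. x g = b}"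
proof -
  have "- {x :: 'r config. x g = b} = (\<Union>c\<in>-{b}. {x. x g = c})" by auto
  then have "open (- {x :: 'r config. x g = b})"
    by (auto intro: open_config_coordinate)
  then show ?thesis by (simp add: clopen_def closed_def open_config_coordinate)
qed

text \<open>
  The configurations that agree with \<open>\<eta>\<close> on \<open>W\<close>.
\<close>

definition cylinder :: "'r fword set \<Rightarrow> 'r config \<Rightarrow> 'r config set" where
  "cylinder W \<eta> = {x. \<forall>k\<in>W. x k = \<eta> k}"

lemma clopen_cylinder [simp]: "finite W \<Longrightarrow> clopen (cylinder W \<eta>)"
proof -
  assume "finite W"
  moreover have "cylinder W \<eta> = (\<Inter>k\<in>W. {x. x k = \<eta> k})" by (auto simp: cylinder_def)
  ultimately show ?thesis by (simp add: clopen_INT)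
qed

lemma compact_config: "compact (UNIV :: 'r config set)"
proof -
  have "compact_space (product_topology (\<lambda>_. euclidean) UNIV :: 'r config topology)"
    unfolding compact_space_product_topology
    by (auto simp: compact_space_def intro: finite_imp_compact)
  then show ?thesis
    by (simp add: euclidean_product_topology compact_space_def)
qed

lemma open_config_contains_cylinder:
  fixes U :: "'r config set"
  assumes "open U" "x \<in> U"
  shows "\<exists>W. finite W \<and> cylinder W x \<subseteq> U"
proof -
  obtain X where X: "x \<in> Pi\<^sub>E UNIV X" "\<And>i. open (X i)" "finite {i. X i \<noteq> UNIV}" "Pi\<^sub>E UNIV X \<subseteq> U"
    using product_topology_open_contains_basis[of "\<lambda>_. euclidean" UNIV U x] assms
    by (auto simp: open_fun_def)
  have "cylinder {i. X i \<noteq> UNIV} x \<subseteq> Pi\<^sub>E UNIV X"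
    using X(1) by (auto simp: cylinder_def PiE_def Pi_def) (metis UNIV_I)
  with X show ?thesis by blast
qed

lemma countable_fword_finite_sets: "countable {W :: ('r::finite) fword set. finite W}"
  using uncountable_infinite countable_Collect_finite by blast

text \<open>
  Cylinders over a cofinal family of finite sets generate the Borel sets: an open set is the union of
  the cylinders inside it, and there are only countably many cylinders over finite sets.
\<close>

lemma sigma_sets_cylinders:
  fixes \<W> :: "('r::finite) fword set set"
  assumes fin: "\<And>W. W \<in> \<W> \<Longrightarrow> finite W"
    and cofinal: "\<And>W. finite W \<Longrightarrow> \<exists>W'\<in>\<W>. W \<subseteq> W'"
  shows "sigma_sets UNIV {cylinder W \<eta> | W \<eta>. W \<in> \<W>} = sets borel"
proof
  let ?E = "{cylinder W \<eta> | W \<eta>. W \<in> \<W>}"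
  have "?E \<subseteq> sets borel" using clopen_borel[OF clopen_cylinder[OF fin]] by blast
  then show "sigma_sets UNIV ?E \<subseteq> sets borel"
    using sets.sigma_sets_subset[of ?E borel] by (simp only: space_borel)
  have "U \<in> sigma_sets UNIV ?E" if U: "open U" for U :: "'r config set"
  proof -
    interpret sigma_algebra UNIV "sigma_sets UNIV ?E"
      by (rule sigma_algebra_sigma_sets) simp
    define \<C> where "\<C> = {cylinder W \<eta> | W \<eta>. W \<in> \<W> \<and> cylinder W \<eta> \<subseteq> U}"
    have finr: "finite (range (cylinder W))" if "finite W" for W :: "'r fword set"
    proof -
      have "cylinder W \<eta> = cylinder W (restrict \<eta> W)" for \<eta>
        by (auto simp: cylinder_def)
      then have "range (cylinder W) \<subseteq> cylinder W ` (W \<rightarrow>\<^sub>E UNIV)"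
        by (metis (no_types) PiE_UNIV_domain UNIV_I image_eqI image_subsetI restrict_PiE_iff)
      moreover have "finite (W \<rightarrow>\<^sub>E (UNIV :: spin set))" using that by (intro finite_PiE) auto
      ultimately show ?thesis using finite_surj by blast
    qed
    have "\<C> \<subseteq> (\<Union>W\<in>{W. finite W}. range (cylinder W))"
      using fin by (auto simp: \<C>_def)
    moreover have "countable (\<Union>W\<in>{W :: 'r fword set. finite W}. range (cylinder W))"
      by (intro Countable_Set.countable_UN countable_fword_finite_sets) (auto intro: finr countable_finite)
    ultimately have "countable \<C>" by (rule countable_subset)
    moreover have "U = \<Union>\<C>"
    proof
      show "U \<subseteq> \<Union>\<C>"
      proof
        fix x assume "x \<in> U"
        then obtain W where "finite W" "cylinder W x \<subseteq> U"
          using open_config_contains_cylinder[OF U] by blast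
        moreover obtain W' where "W' \<in> \<W>" "W \<subseteq> W'" using cofinal[OF \<open>finite W\<close>] by blast
        moreover from this have "cylinder W' x \<subseteq> cylinder W x" by (auto simp: cylinder_def)
        moreover have "x \<in> cylinder W' x" by (simp add: cylinder_def)
        ultimately show "x \<in> \<Union>\<C>" unfolding \<C>_def by blast
      qed
    qed (auto simp: \<C>_def)
    moreover have "\<C> \<subseteq> ?E" unfolding \<C>_def by blast
    then have "\<C> \<subseteq> sigma_sets UNIV ?E" using sigma_sets_superset_generator by (rule subset_trans)
    ultimately show ?thesis using countable_Union[of \<C>] by simp
  qed
  then show "sets borel \<subseteq> sigma_sets UNIV ?E"
    unfolding borel_def sets_measure_of[OF subset_UNIV[of "Collect open", folded Pow_UNIV]]
    by (intro sigma_sets_mono subsetI) (simp only: mem_Collect_eq)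
qed

lemma sigma_sets_clopen:
  "sigma_sets UNIV {C :: ('r::finite) config set. clopen C} = sets borel"
proof
  have "{C :: 'r config set. clopen C} \<subseteq> sets borel" by (auto intro: clopen_borel)
  then show "sigma_sets UNIV {C :: 'r config set. clopen C} \<subseteq> sets borel"
    using sets.sigma_sets_subset[of "{C :: 'r config set. clopen C}" borel] by (simp only: space_borel)
  have "{cylinder W \<eta> | W \<eta>. W \<in> {W :: 'r fword set. finite W}} \<subseteq> {C. clopen C}" by auto
  then have "sigma_sets UNIV {cylinder W \<eta> | W \<eta>. W \<in> {W :: 'r fword set. finite W}}
      \<subseteq> sigma_sets UNIV {C. clopen C}" by (rule sigma_sets_mono')
  moreover have "sigma_sets UNIV {cylinder W \<eta> | W \<eta>. W \<in> {W :: 'r fword set. finite W}} = sets borel"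
    by (rule sigma_sets_cylinders) auto
  ultimately show "sets borel \<subseteq> sigma_sets UNIV {C :: 'r config set. clopen C}"
    by (simp only:)
qed

text \<open>
  The finitely additive probabilities on the clopen sets. Values on other sets carry no information
  and are only required to lie in the unit interval; this makes the set of contents a closed subset
  of a product of unit intervals.
\<close>

definition clopen_content :: "('a::topological_space set \<Rightarrow> real) set" where
  "clopen_content = {p. (\<forall>C. 0 \<le> p C \<and> p C \<le> 1) \<and> p UNIV = 1 \<and>
     (\<forall>C D. clopen C \<longrightarrow> clopen D \<longrightarrow> C \<inter> D = {} \<longrightarrow> p (C \<union> D) = p C + p D)}"

text \<open>
  A content extends to a Borel probability measure by the Caratheodory theorem: a decreasing sequence
  of clopen sets with empty intersection is eventually empty because the configuration space is
  compact, so continuity at the empty set is automatic.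
\<close>

lemma clopen_content_extends:
  fixes p :: "('r::finite) config set \<Rightarrow> real"
  assumes p: "p \<in> clopen_content"
  shows "\<exists>\<mu>\<in>borel_probs. \<forall>C. clopen C \<longrightarrow> measure \<mu> C = p C"
proof -
  let ?M = "{C :: 'r config set. clopen C}"
  interpret algebra UNIV ?M
    by (rule algebra_iff_Un[THEN iffD2]) (auto simp: Compl_eq_Diff_UNIV[symmetric])
  have add: "p (C \<union> D) = p C + p D" if "clopen C" "clopen D" "C \<inter> D = {}" for C D
    using p that by (auto simp: clopen_content_def)
  have nonneg: "0 \<le> p C" for C using p by (auto simp: clopen_content_def)
  have p0: "p {} = 0" using add[of "{}" "{}"] by simp
  have "\<exists>\<mu> :: 'r config set \<Rightarrow> ennreal. (\<forall>s\<in>?M. \<mu> s = ennreal (p s)) \<and>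
      measure_space UNIV (sigma_sets UNIV ?M) \<mu>"
  proof (rule caratheodory_empty_continuous)
    show "positive ?M (\<lambda>C. ennreal (p C))" by (simp add: positive_def p0)
    show "additive ?M (\<lambda>C. ennreal (p C))"
      by (simp add: additive_def add nonneg flip: ennreal_plus)
    show "ennreal (p A) \<noteq> \<infinity>" for A by simp
    fix A :: "nat \<Rightarrow> 'r config set"
    assume A: "range A \<subseteq> ?M" "decseq A" "(\<Inter>i. A i) = {}"
    have "\<exists>N. A N = {}"
    proof (rule ccontr)
      assume ne: "\<not> ?thesis"
      have "UNIV \<inter> (\<Inter>i\<in>UNIV. A i) \<noteq> {}"
      proof (rule compact_imp_fip_image[OF compact_config])
        show "closed (A i)" for i using A(1) by (auto simp: clopen_def)
        fix I :: "nat set" assume "finite I"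
        then have "A (Max (insert 0 I)) \<subseteq> (\<Inter>i\<in>I. A i)"
          using A(2) by (auto simp: decseq_def) (meson Max_ge finite_insert insertCI subsetD)
        with ne show "UNIV \<inter> (\<Inter>i\<in>I. A i) \<noteq> {}" by auto
      qed
      with A(3) show False by simp
    qed
    then obtain N where "A N = {}" by blast
    then have "\<forall>\<^sub>F n in sequentially. ennreal (p (A n)) = 0"
      using A(2) unfolding eventually_sequentially decseq_def
      by (intro exI[of _ N]) (metis ennreal_0 p0 subset_empty)
    then show "(\<lambda>i. ennreal (p (A i))) \<longlonglongrightarrow> 0" by (rule tendsto_eventually)
  qed
  then obtain m :: "'r config set \<Rightarrow> ennreal" where m: "\<And>C. clopen C \<Longrightarrow> m C = ennreal (p C)"
    and ms: "measure_space UNIV (sets (borel :: 'r config measure)) m"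
    unfolding sigma_sets_clopen by blast
  define \<mu> where "\<mu> = measure_of UNIV (sets (borel :: 'r config measure)) m"
  have sets: "sets \<mu> = sets borel"
    unfolding \<mu>_def using sets.sets_measure_of_eq[of borel] by (simp add: space_borel)
  have em: "emeasure \<mu> C = ennreal (p C)" if "clopen C" for C
    using ms clopen_borel[OF that] unfolding \<mu>_def measure_space_def
    by (subst emeasure_measure_of_sigma) (simp_all add: m that)
  have "emeasure \<mu> (space \<mu>) = 1"
    using p em[of UNIV] sets_eq_imp_space_eq[OF sets] by (simp add: clopen_content_def)
  then have "prob_space \<mu>" by (rule prob_spaceI)
  with sets em show ?thesis
    by (intro bexI[of _ \<mu>]) (auto simp: borel_probs_def measure_def nonneg)
qed

lemma borel_probsD:
  assumes "\<mu> \<in> borel_probs"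
  shows "prob_space \<mu>" "sets \<mu> = sets borel" "space \<mu> = UNIV"
  using assms sets_eq_imp_space_eq[of \<mu> borel] by (auto simp: borel_probs_def)

lemma measure_clopen_content:
  assumes "\<mu> \<in> borel_probs"
  shows "measure \<mu> \<in> clopen_content"
proof -
  interpret prob_space \<mu> using borel_probsD(1)[OF assms] .
  show ?thesis
    unfolding clopen_content_def
    using prob_space by (simp add: borel_probsD[OF assms] finite_measure_Union clopen_borel)
qed

lemma borel_probs_eqI_clopen:
  fixes \<mu> \<nu> :: "('r::finite) config measure"
  assumes "\<mu> \<in> borel_probs" "\<nu> \<in> borel_probs" "\<And>C. clopen C \<Longrightarrow> measure \<mu> C = measure \<nu> C"
  shows "\<mu> = \<nu>"
proof (rule measure_eqI_generator_eq[where E = "{C. clopen C}" and \<Omega> = UNIV and A = "\<lambda>_. UNIV"])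
  interpret M: prob_space \<mu> using borel_probsD(1)[OF assms(1)] .
  interpret N: prob_space \<nu> using borel_probsD(1)[OF assms(2)] .
  show "emeasure \<mu> X = emeasure \<nu> X" if "X \<in> {C. clopen C}" for X
    using that assms(3) by (simp add: M.emeasure_eq_measure N.emeasure_eq_measure)
  show "emeasure \<mu> UNIV \<noteq> \<infinity>" by simp
qed (simp_all add: sigma_sets_clopen borel_probsD(2) assms(1,2) Int_stable_def)

lemma continuous_config_bounded:
  fixes f :: "'r config \<Rightarrow> real"
  assumes "continuous_on UNIV f"
  shows "bounded (range f)"
  using compact_continuous_image[OF assms compact_config] by (simp add: compact_imp_bounded)

text \<open>
  Continuous functions of a configuration are uniform limits of finite linear combinations of
  indicators of clopen sets.
\<close>

lemma continuous_config_approx: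
  fixes f :: "('r::finite) config \<Rightarrow> real"
  assumes f: "continuous_on UNIV f" and e: "e > 0"
  obtains m :: nat and D :: "nat \<Rightarrow> 'r config set" and a :: "nat \<Rightarrow> real"
  where "\<And>i. clopen (D i)" "\<And>x. \<bar>f x - (\<Sum>i<m. a i * indicator (D i) x)\<bar> \<le> e"
proof -
  define U where "U y = {x. \<bar>f x - f y\<bar> < e}" for y
  have "open (U y)" for y
  proof -
    show ?thesis unfolding U_def by (intro open_Collect_less continuous_intros f)
  qed
  moreover have "y \<in> U y" for y using e by (simp add: U_def)
  ultimately have "\<exists>W. finite W \<and> cylinder W y \<subseteq> U y" for y
    by (rule open_config_contains_cylinder)
  then obtain W where W: "\<And>y. finite (W y)" "\<And>y. cylinder (W y) y \<subseteq> U y" by metis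
  have "x \<in> cylinder (W x) x" for x by (simp add: cylinder_def)
  then have cov: "UNIV \<subseteq> (\<Union>y\<in>UNIV. cylinder (W y) y)" by blast
  have op: "open (cylinder (W y) y)" for y
    using clopen_cylinder[OF W(1)] by (simp add: clopen_def)
  obtain Y where Y: "finite Y" "UNIV \<subseteq> (\<Union>y\<in>Y. cylinder (W y) y)"
    by (rule compactE_image[OF compact_config op cov])
  obtain ys where ys: "set ys = Y" using Y(1) finite_list by blast
  define E where "E i = (if i < length ys then cylinder (W (ys ! i)) (ys ! i) else {})" for i
  \<comment> \<open>The cylinders of the finite subcover are made disjoint, so that each \<open>x\<close> meets exactly one term.\<close>
  define D where "D = disjointed E"
  have clE: "clopen (E i)" for i by (simp add: E_def W)
  have clD: "clopen (D i)" for i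
    unfolding D_def disjointed_def using clE by (simp add: clopen_UN)
  define a where "a i = f (ys ! i)" for i
  have disj: "disjoint_family D" unfolding D_def by (rule disjoint_family_disjointed)
  have cover: "(\<Union>i\<in>{0..<length ys}. D i) = UNIV"
  proof -
    have "(\<Union>i\<in>{0..<length ys}. D i) = (\<Union>i\<in>{0..<length ys}. E i)"
      unfolding D_def by (rule finite_UN_disjointed_eq)
    also have "\<dots> = UNIV"
    proof -
      have "\<exists>i<length ys. x \<in> E i" for x
      proof -
        obtain y where "y \<in> Y" "x \<in> cylinder (W y) y" using Y(2) by blast
        then show ?thesis unfolding ys[symmetric] in_set_conv_nth by (auto simp: E_def)
      qed
      then show ?thesis by fastforce
    qed
    finally show ?thesis .
  qed
  show ?thesis
  proof (rule that[of D, OF clD])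
    fix x
    obtain i where i: "i < length ys" "x \<in> D i" using cover by (metis UN_E UNIV_I atLeastLessThan_iff)
    have "(\<Sum>j<length ys. a j * indicator (D j) x) = (\<Sum>j<length ys. if j = i then a i else 0)"
      using disj i(2) by (intro sum.cong) (auto simp: disjoint_family_on_def indicator_def)
    also have "\<dots> = a i" using i(1) by simp
    finally have s: "(\<Sum>j<length ys. a j * indicator (D j) x) = a i" .
    have "x \<in> E i" using i(2) disjointed_subset[of E i] by (auto simp: D_def)
    then have "x \<in> U (ys ! i)" using i(1) W(2) by (auto simp: E_def)
    then show "\<bar>f x - (\<Sum>j<length ys. a j * indicator (D j) x)\<bar> \<le> e"
      unfolding s by (simp add: U_def a_def)
  qed
qed

lemma integral_clopen_approx:
  fixes f :: "('r::finite) config \<Rightarrow> real"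
  assumes \<mu>: "\<mu> \<in> borel_probs" and f: "continuous_on UNIV f" and D: "\<And>i. clopen (D i)"
    and approx: "\<And>x. \<bar>f x - (\<Sum>i<m. a i * indicator (D i) x)\<bar> \<le> e"
  shows "\<bar>integral\<^sup>L \<mu> f - (\<Sum>i<m. a i * measure \<mu> (D i))\<bar> \<le> e"
proof -
  interpret prob_space \<mu> using borel_probsD(1)[OF \<mu>] .
  let ?s = "\<lambda>x. \<Sum>i<m. a i * indicator (D i) x :: real"
  have D': "D i \<in> sets \<mu>" for i using D borel_probsD(2)[OF \<mu>] by (simp add: clopen_borel)
  have int: "integrable \<mu> (\<lambda>x. a i * indicator (D i) x)" for i
    using D' by (intro integrable_mult_right integrable_real_indicator) (simp_all add: emeasure_eq_measure)
  have ints: "integrable \<mu> ?s" using int by (intro Bochner_Integration.integrable_sum) simp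
  obtain B where B: "\<And>x. norm (f x) \<le> B"
    using continuous_config_bounded[OF f] by (auto simp: bounded_iff)
  have meas: "f \<in> borel_measurable \<mu>"
    using borel_measurable_continuous_onI[OF f] borel_probsD(2)[OF \<mu>] measurable_cong_sets by blast
  have intf: "integrable \<mu> f" by (rule integrable_const_bound[of _ B]) (use B meas in auto)
  have "integral\<^sup>L \<mu> ?s = (\<Sum>i<m. integral\<^sup>L \<mu> (\<lambda>x. a i * indicator (D i) x))"
    by (rule Bochner_Integration.integral_sum) (rule int)
  also have "\<dots> = (\<Sum>i<m. a i * measure \<mu> (D i))"
    using D' borel_probsD(3)[OF \<mu>] by (intro sum.cong) auto
  finally have "\<bar>integral\<^sup>L \<mu> f - (\<Sum>i<m. a i * measure \<mu> (D i))\<bar> = \<bar>integral\<^sup>L \<mu> (\<lambda>x. f x - ?s x)\<bar>"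
    using intf ints by simp
  also have "\<dots> \<le> integral\<^sup>L \<mu> (\<lambda>x. \<bar>f x - ?s x\<bar>)" by (rule integral_abs_bound)
  also have "\<dots> \<le> integral\<^sup>L \<mu> (\<lambda>_. e)"
    using intf ints approx by (intro integral_mono) auto
  finally show ?thesis using prob_space by simp
qed

lemma continuous_on_uniform_approx:
  fixes g :: "'a::topological_space \<Rightarrow> real"
  assumes "\<And>e. e > 0 \<Longrightarrow> \<exists>h. continuous_on K h \<and> (\<forall>p\<in>K. \<bar>g p - h p\<bar> \<le> e)"
  shows "continuous_on K g"
proof -
  have "\<forall>n. \<exists>h. continuous_on K h \<and> (\<forall>p\<in>K. \<bar>g p - h p\<bar> \<le> inverse (real (Suc n)))"
    using assms by simp
  then obtain h where h: "\<And>n. continuous_on K (h n)"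
    "\<And>n p. p \<in> K \<Longrightarrow> \<bar>g p - h n p\<bar> \<le> inverse (real (Suc n))" by metis
  have "uniform_limit K h g sequentially"
  proof (rule uniform_limitI)
    fix e :: real assume "e > 0"
    then obtain N where N: "inverse (real (Suc N)) < e" using reals_Archimedean by blast
    have "dist (h n p) (g p) < e" if "n \<ge> N" "p \<in> K" for n p
    proof -
      have "inverse (real (Suc n)) \<le> inverse (real (Suc N))" using that by (intro le_imp_inverse_le) auto
      moreover have "dist (h n p) (g p) \<le> inverse (real (Suc n))"
        using h(2)[OF that(2), of n] by (simp only: dist_real_def abs_minus_commute)
      ultimately show ?thesis using N by linarith
    qed
    then show "\<forall>\<^sub>F n in sequentially. \<forall>p\<in>K. dist (h n p) (g p) < e"
      using eventually_sequentially by blast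
  qed
  then show ?thesis
    by (rule uniform_limit_theorem[rotated]) (simp_all add: h)
qed

text \<open>
  The contents form a compact set by Tychonoff's theorem, and every Borel probability measure is the
  extension of one. The extension map is continuous because the integral of a continuous function is
  a uniform limit of functions that depend on finitely many values of the content.
\<close>

theorem compact_space_weak_star:
  "compact_space (weak_star :: ('r::finite) config measure topology)"
proof -
  let ?K = "clopen_content :: ('r config set \<Rightarrow> real) set"
  have "compact (Pi\<^sub>E UNIV (\<lambda>_ :: 'r config set. {0..1::real}))"
    using compactin_PiE[of "\<lambda>_. euclidean" UNIV "\<lambda>_ :: 'r config set. {0..1::real}"]
    by (simp add: euclidean_product_topology)
  moreover have "closed ?K"
  proof -
    have "?K = (\<Inter>C. {p. 0 \<le> p C} \<inter> {p. p C \<le> 1}) \<inter> {p. p UNIV = 1} \<inter>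
       (\<Inter>(C, D)\<in>{(C, D). clopen C \<and> clopen D \<and> C \<inter> D = {}}. {p. p (C \<union> D) = p C + p D})"
      unfolding clopen_content_def by auto
    moreover have "closed \<dots>"
      by (intro closed_Int closed_INT ballI)
        (auto intro!: closed_Collect_le closed_Collect_eq continuous_intros)
    ultimately show ?thesis by simp
  qed
  moreover have "?K \<subseteq> Pi\<^sub>E UNIV (\<lambda>_. {0..1})" by (auto simp: clopen_content_def)
  ultimately have K: "compact ?K" by (metis compact_Int_closed inf.absorb2)
  obtain \<nu> where \<nu>: "\<And>p. p \<in> ?K \<Longrightarrow> \<nu> p \<in> borel_probs"
    "\<And>p C. p \<in> ?K \<Longrightarrow> clopen C \<Longrightarrow> measure (\<nu> p) C = p C"
    using clopen_content_extends by metis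
  have cont: "continuous_on ?K (\<lambda>p. integral\<^sup>L (\<nu> p) f)"
    if f: "continuous_on UNIV f" for f :: "'r config \<Rightarrow> real"
  proof (rule continuous_on_uniform_approx)
    fix e :: real assume "e > 0"
    then obtain m D a where Da: "\<And>i::nat. clopen (D i)"
      "\<And>x. \<bar>f x - (\<Sum>i<m. a i * indicator (D i) x)\<bar> \<le> e"
      using continuous_config_approx[OF f] by metis
    have "\<bar>integral\<^sup>L (\<nu> p) f - (\<Sum>i<m. a i * p (D i))\<bar> \<le> e" if "p \<in> ?K" for p
      using integral_clopen_approx[OF \<nu>(1)[OF that] f Da] by (simp add: \<nu>(2)[OF that Da(1)])
    moreover have "continuous_on ?K (\<lambda>p. \<Sum>i<m. a i * p (D i))"
      by (intro continuous_intros continuous_on_subset[OF continuous_on_product_coordinates]) simp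
    ultimately show "\<exists>h. continuous_on ?K h \<and> (\<forall>p\<in>?K. \<bar>integral\<^sup>L (\<nu> p) f - h p\<bar> \<le> e)"
      by blast
  qed
  have "continuous_map (top_of_set ?K) weak_star \<nu>"
    unfolding weak_star_def
  proof (rule continuous_on_generated_topo)
    fix U :: "'r config measure set"
    assume "U \<in> {{\<mu> \<in> borel_probs. integral\<^sup>L \<mu> f \<in> U} | (f :: 'r config \<Rightarrow> real) U.
        continuous_on UNIV f \<and> bounded (range f) \<and> open U}"
    then obtain f :: "'r config \<Rightarrow> real" and V where U: "U = {\<mu> \<in> borel_probs. integral\<^sup>L \<mu> f \<in> V}"
      and f: "continuous_on UNIV f" and V: "open V" by blast
    have "\<nu> -` U \<inter> topspace (top_of_set ?K) = ?K \<inter> (\<lambda>p. integral\<^sup>L (\<nu> p) f) -` V"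
      using \<nu>(1) by (auto simp: U)
    then show "openin (top_of_set ?K) (\<nu> -` U \<inter> topspace (top_of_set ?K))"
      using continuous_openin_preimage_gen[OF cont[OF f] V] by simp
  next
    show "\<nu> ` topspace (top_of_set ?K) \<subseteq>
        \<Union>{{\<mu> \<in> borel_probs. integral\<^sup>L \<mu> f \<in> U} | (f :: 'r config \<Rightarrow> real) U.
          continuous_on UNIV f \<and> bounded (range f) \<and> open U}"
      using topspace_weak_star[where 'a = "'r config"] \<nu>(1)
      unfolding weak_star_def topology_generated_by_topspace by auto
  qed
  then have "compactin weak_star (\<nu> ` ?K)"
    using image_compactin[of "top_of_set ?K" ?K weak_star \<nu>] K
    by (simp add: compactin_subtopology)
  moreover have "\<nu> ` ?K = borel_probs"
  proof
    show "borel_probs \<subseteq> \<nu> ` ?K"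
    proof
      fix \<mu> :: "'r config measure" assume \<mu>: "\<mu> \<in> borel_probs"
      note c = measure_clopen_content[OF \<mu>]
      have "\<mu> = \<nu> (measure \<mu>)"
        by (rule borel_probs_eqI_clopen) (simp_all add: \<mu> c \<nu>)
      with c show "\<mu> \<in> \<nu> ` ?K" by blast
    qed
  qed (use \<nu>(1) in auto)
  ultimately show ?thesis by (simp add: compact_space_def topspace_weak_star)
qed

lemma openin_weak_star_integral:
  fixes f :: "'r config \<Rightarrow> real"
  assumes "continuous_on UNIV f" "open U"
  shows "openin weak_star {\<mu> \<in> borel_probs. integral\<^sup>L \<mu> f \<in> U}"
  unfolding weak_star_def
  by (rule topology_generated_by_Basis) (use assms continuous_config_bounded in blast)

lemma continuous_on_indicator_clopen:
  "clopen C \<Longrightarrow> continuous_on UNIV (indicator C :: 'a::topological_space \<Rightarrow> real)"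
proof -
  assume C: "clopen C"
  have "indicator C -` B = (if (1::real) \<in> B then C else {}) \<union> (if 0 \<in> B then - C else {})"
    for B by (auto simp: indicator_def of_bool_def split: if_splits)
  with C show ?thesis by (auto simp: continuous_on_open_vimage clopen_def open_Compl)
qed

lemma openin_weak_star_clopen:
  fixes C :: "'r config set"
  assumes C: "clopen C" and U: "open U"
  shows "openin weak_star {\<mu> \<in> borel_probs. measure \<mu> C \<in> U}"
proof -
  have "{\<mu> \<in> borel_probs. measure \<mu> C \<in> U} = {\<mu> \<in> borel_probs. integral\<^sup>L \<mu> (indicator C) \<in> U}"
    by (auto simp: borel_probsD(3))
  then show ?thesis
    using openin_weak_star_integral[OF continuous_on_indicator_clopen[OF C] U] by simp
qed

section \<open>Shift-invariance\<close>

lemma continuous_on_shift: "continuous_on UNIV (shift g)"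
  unfolding shift_def
  by (intro continuous_on_coordinatewise_then_product continuous_on_product_coordinates)

lemma clopen_vimage_shift:
  assumes "clopen C" shows "clopen (shift g -` C)"
  using assms continuous_on_shift[of g] unfolding clopen_def
  by (auto intro: open_vimage closed_vimage)

lemma shift_measurable [measurable]: "shift g \<in> borel \<rightarrow>\<^sub>M borel"
  by (intro borel_measurable_continuous_onI continuous_on_shift)

lemma distr_borel_probs:
  assumes "\<mu> \<in> borel_probs" "f \<in> borel \<rightarrow>\<^sub>M borel"
  shows "distr \<mu> borel f \<in> borel_probs"
proof -
  have "f \<in> \<mu> \<rightarrow>\<^sub>M borel" using assms borel_probsD(2) measurable_cong_sets by blast
  then show ?thesis
    using borel_probsD(1)[OF assms(1)] by (simp add: borel_probs_def prob_space.prob_space_distr)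
qed

lemma shift_invariant_iff_clopen:
  fixes \<mu> :: "('r::finite) config measure"
  assumes \<mu>: "\<mu> \<in> borel_probs"
  shows "shift_invariant \<mu> \<longleftrightarrow> (\<forall>g C. clopen C \<longrightarrow> measure \<mu> (shift g -` C) = measure \<mu> C)"
proof -
  have meas: "shift g \<in> \<mu> \<rightarrow>\<^sub>M borel" for g
    using shift_measurable borel_probsD(2)[OF \<mu>] measurable_cong_sets by blast
  have eq: "measure (distr \<mu> borel (shift g)) C = measure \<mu> (shift g -` C)" if "clopen C" for g C
    using measure_distr[OF meas clopen_borel[OF that]] by (simp add: borel_probsD(3)[OF \<mu>])
  show ?thesis
  proof
    assume "shift_invariant \<mu>"
    then show "\<forall>g C. clopen C \<longrightarrow> measure \<mu> (shift g -` C) = measure \<mu> C"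
      using eq unfolding shift_invariant_def by metis
  next
    assume *: "\<forall>g C. clopen C \<longrightarrow> measure \<mu> (shift g -` C) = measure \<mu> C"
    show "shift_invariant \<mu>"
      unfolding shift_invariant_def
      by (intro allI borel_probs_eqI_clopen distr_borel_probs \<mu> shift_measurable) (simp add: eq *)
  qed
qed

lemma openin_not_shift_invariant:
  "openin weak_star {\<mu> :: ('r::finite) config measure. \<mu> \<in> borel_probs \<and> \<not> shift_invariant \<mu>}"
proof -
  have "{\<mu> :: 'r config measure. \<mu> \<in> borel_probs \<and> \<not> shift_invariant \<mu>} =
    (\<Union>(g, C)\<in>{(g, C). clopen C}. {\<mu> \<in> borel_probs.
       integral\<^sup>L \<mu> (\<lambda>x. indicator (shift g -` C) x - indicator C x) \<in> - {0::real}})" (is "?L = ?R")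
  proof -
    have "integral\<^sup>L \<mu> (\<lambda>x. indicator (shift g -` C) x - indicator C x :: real)
        = measure \<mu> (shift g -` C) - measure \<mu> C"
      if "\<mu> \<in> borel_probs" "clopen C" for \<mu> :: "'r config measure" and g C
    proof -
      interpret prob_space \<mu> using borel_probsD(1)[OF that(1)] .
      have "C \<in> sets \<mu>" "shift g -` C \<in> sets \<mu>"
        using that clopen_vimage_shift[OF that(2)] by (simp_all add: borel_probsD(2) clopen_borel)
      then show ?thesis
        by (subst Bochner_Integration.integral_diff)
          (simp_all add: borel_probsD(3)[OF that(1)] emeasure_eq_measure)
    qed
    then show ?thesis
      by (simp add: shift_invariant_iff_clopen set_eq_iff Bex_def split: prod.splits cong: conj_cong) blast
  qed
  moreover have "openin weak_star ?R"
  proof (intro openin_Union ballI, clarify)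
    fix g :: "'r fword" and C :: "'r config set" assume "clopen C"
    then show "openin weak_star {\<mu> \<in> borel_probs.
       integral\<^sup>L \<mu> (\<lambda>x. indicator (shift g -` C) x - indicator C x) \<in> - {0::real}}"
      by (intro openin_weak_star_integral continuous_on_diff continuous_on_indicator_clopen
        clopen_vimage_shift open_Compl) auto
  qed
  ultimately show ?thesis by simp
qed

section \<open>The annealed partition function and the f-pressure\<close>

lemma continuous_on_spin_val: "continuous_on UNIV (\<lambda>x :: 'r config. spin_val (x g))"
proof -
  have "(\<lambda>x :: 'r config. spin_val (x g)) = (\<lambda>x. 2 * indicator {x. x g = Plus} x - 1)"
  proof
    fix x :: "'r config" show "spin_val (x g) = 2 * indicator {x. x g = Plus} x - 1"
      by (cases "x g") (auto simp: indicator_def)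
  qed
  then show ?thesis
    by (simp only:) (intro continuous_intros continuous_on_indicator_clopen clopen_config_coordinate)
qed

lemma continuous_on_ising_u: "continuous_on UNIV (ising_u J :: ('r::finite) config \<Rightarrow> real)"
  unfolding ising_u_def by (intro continuous_intros continuous_on_spin_val)

lemma pullback_name_measurable: "pullback_name \<sigma> x \<in> uniform_count_measure V \<rightarrow>\<^sub>M borel"
  by (simp add: measurable_def sets_uniform_count_measure space_uniform_count_measure)

lemma empirical_borel_probs:
  assumes "finite V" "V \<noteq> {}"
  shows "empirical V \<sigma> x \<in> borel_probs"
proof -
  interpret prob_space "uniform_count_measure V"
    by (rule prob_space_uniform_count_measure) (use assms in auto)
  show ?thesis
    using prob_space_distr[OF pullback_name_measurable]
    by (simp add: borel_probs_def empirical_def)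
qed

lemma free_group_hom_simps:
  assumes "\<sigma> \<in> hom (free_group :: 'r fword monoid) (sym_group n)"
  shows "\<sigma> g permutes {1..n}"
    and "\<sigma> (h \<otimes>\<^bsub>free_group\<^esub> g) = \<sigma> h \<circ> \<sigma> g"
    and "\<sigma> \<one>\<^bsub>free_group\<^esub> = id"
proof -
  interpret group_hom "free_group :: 'r fword monoid" "sym_group n" \<sigma>
    by (intro group_hom.intro group_hom_axioms.intro group_free_group sym_group_is_group assms)
  show "\<sigma> g permutes {1..n}" "\<sigma> (h \<otimes>\<^bsub>free_group\<^esub> g) = \<sigma> h \<circ> \<sigma> g"
    using hom_closed[of g] hom_mult[of h g] by (simp_all add: sym_group_def free_group_def)
  show "\<sigma> \<one>\<^bsub>free_group\<^esub> = id" using hom_one by (simp add: sym_group_def)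
qed

lemma measure_empirical_card:
  assumes "finite V" "A \<in> sets borel"
  shows "measure (empirical V \<sigma> x) A = card {v\<in>V. pullback_name \<sigma> x v \<in> A} / card V"
proof -
  have "(\<Sum>v\<in>V. measure (return borel (pullback_name \<sigma> x v)) A) =
      real (card {v\<in>V. pullback_name \<sigma> x v \<in> A})"
    using assms by (simp add: measure_return indicator_def sum.If_cases Int_def)
  with measure_empirical[OF assms, of \<sigma> x] show ?thesis by simp
qed

lemma shift_pullback_name:
  assumes "\<sigma> \<in> hom (free_group :: 'r fword monoid) (sym_group n)"
  shows "shift g (pullback_name \<sigma> x v) = pullback_name \<sigma> x (\<sigma> g v)"
  by (auto simp: shift_def pullback_name_def free_group_hom_simps[OF assms])

lemma empirical_shift_invariant:
  fixes \<sigma> :: "('r::finite) fword \<Rightarrow> nat \<Rightarrow> nat"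
  assumes \<sigma>: "\<sigma> \<in> hom free_group (sym_group n)" and n: "n > 0"
  shows "shift_invariant (empirical {1..n} \<sigma> x)"
proof (subst shift_invariant_iff_clopen)
  show "empirical {1..n} \<sigma> x \<in> borel_probs" using n by (intro empirical_borel_probs) auto
  show "\<forall>g C. clopen C \<longrightarrow> measure (empirical {1..n} \<sigma> x) (shift g -` C) = measure (empirical {1..n} \<sigma> x) C"
  proof (intro allI impI)
    fix g and C :: "'r config set" assume C: "clopen C"
    have p: "\<sigma> g permutes {1..n}" by (rule free_group_hom_simps[OF \<sigma>])
    have "bij_betw (\<sigma> g) {v\<in>{1..n}. pullback_name \<sigma> x (\<sigma> g v) \<in> C} {v\<in>{1..n}. pullback_name \<sigma> x v \<in> C}"
      unfolding bij_betw_def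
    proof
      show "inj_on (\<sigma> g) {v\<in>{1..n}. pullback_name \<sigma> x (\<sigma> g v) \<in> C}"
        using permutes_inj[OF p] by (rule inj_on_subset) simp
      show "\<sigma> g ` {v\<in>{1..n}. pullback_name \<sigma> x (\<sigma> g v) \<in> C} = {v\<in>{1..n}. pullback_name \<sigma> x v \<in> C}" (is "?L = ?R")
      proof
        show "?L \<subseteq> ?R" using permutes_in_image[OF p] by blast
        show "?R \<subseteq> ?L"
        proof
          fix w assume w: "w \<in> ?R"
          then have "w \<in> \<sigma> g ` {1..n}" using permutes_image[OF p] by simp
          with w show "w \<in> ?L" by blast
        qed
      qed
    qed
    then have "card {v\<in>{1..n}. pullback_name \<sigma> x (\<sigma> g v) \<in> C} = card {v\<in>{1..n}. pullback_name \<sigma> x v \<in> C}"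
      by (rule bij_betw_same_card)
    then show "measure (empirical {1..n} \<sigma> x) (shift g -` C) = measure (empirical {1..n} \<sigma> x) C"
      using clopen_vimage_shift[OF C, of g] C
      by (simp add: measure_empirical_card clopen_borel shift_pullback_name[OF \<sigma>])
  qed
qed

lemma finite_good_models: "finite V \<Longrightarrow> finite (good_models V \<sigma> S)"
  unfolding good_models_def
  by (rule finite_subset[of _ "V \<rightarrow>\<^sub>E (UNIV :: spin set)"]) (auto intro: finite_PiE)

lemma expectation_hom_sym_group:
  fixes f :: "(('r::finite) fword \<Rightarrow> nat \<Rightarrow> nat) \<Rightarrow> real"
  shows "measure_pmf.expectation (pmf_of_set (hom free_group (sym_group n))) f
    = (\<Sum>\<sigma>\<in>hom free_group (sym_group n). f \<sigma>) / card (hom (free_group :: 'r fword monoid) (sym_group n))"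
  by (rule integral_pmf_of_set) (auto simp: hom_sym_group_nonempty finite_hom_sym_group)

text \<open>
  The annealed partition function, restricted to the labellings whose empirical measure lies in \<open>S\<close>:
  the expectation over a uniform homomorphism \<open>\<sigma>\<close> of the sum of the Boltzmann weights, where the
  energy of a labelling is \<open>n\<close> times the mean energy of its empirical measure.
\<close>

definition partition_fn :: "real \<Rightarrow> ('r::finite) config measure set \<Rightarrow> nat \<Rightarrow> real" where
  "partition_fn J S n = measure_pmf.expectation (pmf_of_set (hom free_group (sym_group n)))
     (\<lambda>\<sigma>. \<Sum>x\<in>good_models {1..n} \<sigma> S. exp (- real n * mean_energy J (empirical {1..n} \<sigma> x)))"

lemma expectation_hom_mono:
  fixes f g :: "(('r::finite) fword \<Rightarrow> nat \<Rightarrow> nat) \<Rightarrow> real"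
  assumes "\<And>\<sigma>. \<sigma> \<in> hom free_group (sym_group n) \<Longrightarrow> f \<sigma> \<le> g \<sigma>"
  shows "measure_pmf.expectation (pmf_of_set (hom free_group (sym_group n))) f
    \<le> measure_pmf.expectation (pmf_of_set (hom free_group (sym_group n))) g"
  unfolding expectation_hom_sym_group by (intro divide_right_mono sum_mono assms) auto

lemma partition_fn_le_expected_models:
  fixes S T :: "('r::finite) config measure set"
  assumes "S \<subseteq> T" "\<And>\<mu>. \<mu> \<in> S \<Longrightarrow> mean_energy J \<mu> \<ge> c"
  shows "partition_fn J S n \<le> exp (- real n * c) * expected_models T n"
proof -
  have "partition_fn J S n \<le> measure_pmf.expectation (pmf_of_set (hom free_group (sym_group n)))
     (\<lambda>\<sigma> :: 'r fword \<Rightarrow> nat \<Rightarrow> nat. exp (- real n * c) * real (card (good_models {1..n} \<sigma> T)))"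
    unfolding partition_fn_def
  proof (rule expectation_hom_mono)
    fix \<sigma> :: "'r fword \<Rightarrow> nat \<Rightarrow> nat"
    have "(\<Sum>x\<in>good_models {1..n} \<sigma> S. exp (- real n * mean_energy J (empirical {1..n} \<sigma> x)))
      \<le> (\<Sum>x\<in>good_models {1..n} \<sigma> S. exp (- real n * c))"
      using assms(2) by (intro sum_mono) (auto simp: good_models_def intro: mult_left_mono)
    also have "\<dots> \<le> exp (- real n * c) * real (card (good_models {1..n} \<sigma> T))"
      using card_mono[OF finite_good_models[of "{1..n}" \<sigma> T], of "good_models {1..n} \<sigma> S"] assms(1)
      by (auto simp: good_models_def)
    finally show "(\<Sum>x\<in>good_models {1..n} \<sigma> S. exp (- real n * mean_energy J (empirical {1..n} \<sigma> x)))
      \<le> exp (- real n * c) * real (card (good_models {1..n} \<sigma> T))" .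
  qed
  also have "\<dots> = exp (- real n * c) * expected_models T n"
    unfolding expected_models_def by simp
  finally show ?thesis .
qed

lemma expected_models_le_partition_fn:
  fixes S T :: "('r::finite) config measure set"
  assumes "S \<subseteq> T" "\<And>\<mu>. \<mu> \<in> S \<Longrightarrow> mean_energy J \<mu> \<le> c"
  shows "expected_models S n \<le> exp (real n * c) * partition_fn J T n"
proof -
  have "expected_models S n \<le> measure_pmf.expectation (pmf_of_set (hom free_group (sym_group n)))
     (\<lambda>\<sigma> :: 'r fword \<Rightarrow> nat \<Rightarrow> nat. exp (real n * c) *
        (\<Sum>x\<in>good_models {1..n} \<sigma> T. exp (- real n * mean_energy J (empirical {1..n} \<sigma> x))))"
    unfolding expected_models_def
  proof (rule expectation_hom_mono)
    fix \<sigma> :: "'r fword \<Rightarrow> nat \<Rightarrow> nat"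
    have "real (card (good_models {1..n} \<sigma> S)) = (\<Sum>x\<in>good_models {1..n} \<sigma> S. exp (real n * c) * exp (- real n * c))"
      by (simp flip: exp_add)
    also have "\<dots> \<le> (\<Sum>x\<in>good_models {1..n} \<sigma> S. exp (real n * c) * exp (- real n * mean_energy J (empirical {1..n} \<sigma> x)))"
      using assms(2) by (intro sum_mono) (auto simp: good_models_def intro: mult_left_mono)
    also have "\<dots> \<le> (\<Sum>x\<in>good_models {1..n} \<sigma> T. exp (real n * c) * exp (- real n * mean_energy J (empirical {1..n} \<sigma> x)))"
      using assms(1) by (intro sum_mono2 finite_good_models) (auto simp: good_models_def)
    finally show "real (card (good_models {1..n} \<sigma> S)) \<le> exp (real n * c) *
        (\<Sum>x\<in>good_models {1..n} \<sigma> T. exp (- real n * mean_energy J (empirical {1..n} \<sigma> x)))"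
      by (simp add: sum_distrib_left)
  qed
  also have "\<dots> = exp (real n * c) * partition_fn J T n"
    unfolding partition_fn_def by simp
  finally show ?thesis .
qed

lemma elog_le_iff: "elog a \<le> ereal c \<longleftrightarrow> a \<le> exp c"
proof (cases "a > 0")
  case True
  then have "ln a \<le> c \<longleftrightarrow> a \<le> exp c" by (metis exp_ln exp_le_cancel_iff)
  with True show ?thesis by (simp add: elog_def)
next
  case False
  then have "a \<le> exp c" using exp_ge_zero[of c] by linarith
  with False show ?thesis by (simp add: elog_def)
qed

lemma scaled_elog_le_iff:
  assumes "n > 0"
  shows "ereal (1 / real n) * elog a \<le> ereal c \<longleftrightarrow> a \<le> exp (real n * c)"
proof -
  have "ereal (1 / real n) * elog a \<le> ereal c \<longleftrightarrow> elog a \<le> ereal (real n * c)"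
    using assms by (cases "elog a") (auto simp: field_simps)
  then show ?thesis by (simp add: elog_le_iff)
qed

lemma openin_energy:
  fixes U :: "real set"
  assumes "open U"
  shows "openin weak_star {\<mu> :: ('r::finite) config measure. \<mu> \<in> borel_probs \<and> mean_energy J \<mu> \<in> U}"
  unfolding mean_energy_def by (rule openin_weak_star_integral[OF continuous_on_ising_u assms])

text \<open>
  On a small neighbourhood the mean energy is nearly constant, so that the f-pressure is governed by the
  growth rate of the restricted partition function. The next two lemmas are the two directions.
\<close>

lemma f_pressure_le:
  fixes \<mu> :: "('r::finite) config measure"
  assumes N: "openin weak_star N" "\<mu> \<in> N"
    and ev: "\<forall>\<^sub>F n in sequentially. partition_fn J N n \<le> exp (real n * c)"
  shows "f_pressure J \<mu> \<le> ereal c"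
proof -
  have \<mu>: "\<mu> \<in> borel_probs" using N openin_subset topspace_weak_star by blast
  let ?u = "mean_energy J \<mu>"
  have "f_entropy \<mu> \<le> ereal (?u + c) + ereal e" if e: "e > 0" for e
  proof -
    define M where "M = N \<inter> {\<nu> \<in> borel_probs. mean_energy J \<nu> \<in> {..<?u + e}}"
    have M: "openin weak_star M"
      unfolding M_def by (intro openin_Int openin_energy N(1) open_lessThan)
    have "\<mu> \<in> M" unfolding M_def using N \<mu> e by simp
    note M = M this
    have "\<forall>\<^sub>F n in sequentially. ereal (1 / real n) * elog (expected_models M n) \<le> ereal (?u + c + e)"
      using ev eventually_gt_at_top[of 0]
    proof eventually_elim
      case (elim n)
      have "expected_models M n \<le> exp (real n * (?u + e)) * partition_fn J N n"
        by (rule expected_models_le_partition_fn) (auto simp: M_def)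
      also have "\<dots> \<le> exp (real n * (?u + e)) * exp (real n * c)"
        using elim by (intro mult_left_mono) auto
      also have "\<dots> = exp (real n * (?u + c + e))" by (simp add: algebra_simps flip: exp_add)
      finally show ?case using elim by (simp add: scaled_elog_le_iff)
    qed
    then have "limsup (\<lambda>n. ereal (1 / real n) * elog (expected_models M n)) \<le> ereal (?u + c + e)"
      by (rule Limsup_bounded)
    moreover have "f_entropy \<mu> \<le> limsup (\<lambda>n. ereal (1 / real n) * elog (expected_models M n))"
      unfolding f_entropy_def using M by (intro INF_lower) auto
    ultimately show ?thesis by simp
  qed
  then have "f_entropy \<mu> \<le> ereal (?u + c)" by (rule ereal_le_epsilon2[rule_format])
  then show ?thesis unfolding f_pressure_def by (cases "f_entropy \<mu>") auto
qed

lemma f_pressure_less_imp_partition_fn_le: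
  fixes \<nu> :: "('r::finite) config measure"
  assumes \<nu>: "\<nu> \<in> borel_probs" and less: "f_pressure J \<nu> < ereal B"
  obtains N c where "openin weak_star N" "\<nu> \<in> N" "c < B"
    "\<forall>\<^sub>F n in sequentially. partition_fn J N n \<le> exp (real n * c)"
proof -
  let ?u = "mean_energy J \<nu>"
  have "f_entropy \<nu> < ereal (B + ?u)"
    using less unfolding f_pressure_def by (cases "f_entropy \<nu>") auto
  then obtain M where M: "openin weak_star M" "\<nu> \<in> M"
    "limsup (\<lambda>n. ereal (1 / real n) * elog (expected_models M n)) < ereal (B + ?u)"
    unfolding f_entropy_def INF_less_iff by blast
  obtain c where c: "limsup (\<lambda>n. ereal (1 / real n) * elog (expected_models M n)) < ereal c" "c < B + ?u"
    using ereal_dense2[OF M(3)] by auto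
  define e where "e = (B + ?u - c) / 2"
  have e: "e > 0" using c(2) by (simp add: e_def)
  define N where "N = M \<inter> {\<mu> \<in> borel_probs. mean_energy J \<mu> \<in> {?u - e<..}}"
  have "openin weak_star N"
    unfolding N_def by (intro openin_Int openin_energy M(1) open_greaterThan)
  moreover have "\<nu> \<in> N" unfolding N_def using M \<nu> e by simp
  moreover have "c - ?u + e < B" using c(2) by (simp add: e_def field_simps)
  moreover have "\<forall>\<^sub>F n in sequentially. partition_fn J N n \<le> exp (real n * (c - ?u + e))"
    using Limsup_lessD[OF c(1)] eventually_gt_at_top[of 0]
  proof eventually_elim
    case (elim n)
    then have "expected_models M n \<le> exp (real n * c)"
      by (metis less_imp_le scaled_elog_le_iff)
    have "partition_fn J N n \<le> exp (- real n * (?u - e)) * expected_models M n"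
      by (rule partition_fn_le_expected_models) (auto simp: N_def)
    also have "\<dots> \<le> exp (- real n * (?u - e)) * exp (real n * c)"
      by (intro mult_left_mono) (fact, simp)
    also have "\<dots> = exp (real n * (c - ?u + e))" by (simp add: algebra_simps flip: exp_add)
    finally show ?case .
  qed
  ultimately show ?thesis using that by blast
qed

lemma partition_fn_UNIV_le_sum:
  fixes F :: "('r::finite) config measure set set"
  assumes F: "finite F" "borel_probs \<subseteq> \<Union>F" and n: "n > 0"
  shows "partition_fn J (UNIV :: 'r config measure set) n \<le> (\<Sum>N\<in>F. partition_fn J N n)"
proof -
  have "partition_fn J (UNIV :: 'r config measure set) n \<le> measure_pmf.expectation (pmf_of_set (hom free_group (sym_group n)))
     (\<lambda>\<sigma> :: 'r fword \<Rightarrow> nat \<Rightarrow> nat. \<Sum>N\<in>F. \<Sum>x\<in>good_models {1..n} \<sigma> N. exp (- real n * mean_energy J (empirical {1..n} \<sigma> x)))"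
    unfolding partition_fn_def
  proof (rule expectation_hom_mono)
    fix \<sigma> :: "'r fword \<Rightarrow> nat \<Rightarrow> nat"
    have "empirical {1..n} \<sigma> x \<in> \<Union>F" for x using n F(2) empirical_borel_probs[of "{1..n}" \<sigma> x] by auto
    then have "good_models {1..n} \<sigma> UNIV \<subseteq> (\<Union>N\<in>F. good_models {1..n} \<sigma> N)"
      by (auto simp: good_models_def)
    then have "(\<Sum>x\<in>good_models {1..n} \<sigma> UNIV. exp (- real n * mean_energy J (empirical {1..n} \<sigma> x)))
      \<le> (\<Sum>x\<in>(\<Union>N\<in>F. good_models {1..n} \<sigma> N). exp (- real n * mean_energy J (empirical {1..n} \<sigma> x)))"
      using F(1) by (intro sum_mono2) (auto simp: finite_good_models)
    also have "\<dots> \<le> (\<Sum>N\<in>F. \<Sum>x\<in>good_models {1..n} \<sigma> N. exp (- real n * mean_energy J (empirical {1..n} \<sigma> x)))"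
      using F(1)
    proof (induction F)
      case (insert N F)
      let ?f = "\<lambda>x. exp (- real n * mean_energy J (empirical {1..n} \<sigma> x))"
      have "sum ?f (\<Union>N\<in>insert N F. good_models {1..n} \<sigma> N)
          \<le> sum ?f (good_models {1..n} \<sigma> N) + sum ?f (\<Union>N\<in>F. good_models {1..n} \<sigma> N)"
        using insert.hyps by (subst UN_insert, subst sum_Un) (auto simp: finite_good_models sum_nonneg)
      with insert show ?case by simp
    qed simp
    finally show "(\<Sum>x\<in>good_models {1..n} \<sigma> UNIV. exp (- real n * mean_energy J (empirical {1..n} \<sigma> x)))
      \<le> (\<Sum>N\<in>F. \<Sum>x\<in>good_models {1..n} \<sigma> N. exp (- real n * mean_energy J (empirical {1..n} \<sigma> x)))" .
  qed
  also have "\<dots> = (\<Sum>N\<in>F. partition_fn J N n)"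
    unfolding partition_fn_def expectation_hom_sym_group
    by (subst sum.swap) (simp add: sum_divide_distrib)
  finally show ?thesis .
qed

text \<open>
  Some shift-invariant measure has an f-pressure at least as large as the growth rate of the annealed
  partition function. Otherwise every measure has a neighbourhood whose contribution grows more slowly
  (the empirical measures are shift-invariant, so measures that are not shift-invariant have
  neighbourhoods with no contribution), and by compactness finitely many of these cover everything.
\<close>

theorem exists_shift_invariant_f_pressure_ge:
  assumes freq: "\<exists>\<^sub>F n in sequentially. partition_fn J (UNIV :: ('r::finite) config measure set) n \<ge> exp (real n * B)"
  shows "\<exists>\<nu> :: 'r config measure. \<nu> \<in> borel_probs \<and> shift_invariant \<nu> \<and> f_pressure J \<nu> \<ge> ereal B"
proof (rule ccontr)
  assume none: "\<not> ?thesis"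
  let ?good = "\<lambda>N c. c < B \<and> (\<forall>\<^sub>F n in sequentially. partition_fn J N n \<le> exp (real n * c))"
  have "\<exists>N. openin weak_star N \<and> \<nu> \<in> N \<and> (\<exists>c. ?good N c)" if \<nu>: "\<nu> \<in> borel_probs" for \<nu> :: "'r config measure"
  proof (cases "shift_invariant \<nu>")
    case True
    then have "f_pressure J \<nu> < ereal B" using none \<nu> by (auto simp: not_le)
    then show ?thesis using f_pressure_less_imp_partition_fn_le[OF \<nu>] by metis
  next
    case False
    let ?N = "{\<mu> :: 'r config measure. \<mu> \<in> borel_probs \<and> \<not> shift_invariant \<mu>}"
    have "partition_fn J ?N n \<le> exp (real n * (B - 1))" if "n > 0" for n
    proof -
      have "good_models {1..n} \<sigma> ?N = {}" if "\<sigma> \<in> hom free_group (sym_group n)" for \<sigma> :: "'r fword \<Rightarrow> nat \<Rightarrow> nat"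
        using empirical_shift_invariant[OF that \<open>n > 0\<close>] by (auto simp: good_models_def)
      then have "partition_fn J ?N n = 0"
        unfolding partition_fn_def expectation_hom_sym_group by simp
      then show ?thesis by simp
    qed
    then have "\<forall>\<^sub>F n in sequentially. partition_fn J ?N n \<le> exp (real n * (B - 1))"
      using eventually_gt_at_top[of 0] by (rule eventually_mono[rotated])
    then have "?good ?N (B - 1)" by simp
    then show ?thesis using openin_not_shift_invariant \<nu> False by blast
  qed
  then have "borel_probs \<subseteq> \<Union>{N :: 'r config measure set. openin weak_star N \<and> (\<exists>c. ?good N c)}"
    by blast
  then obtain F where F: "finite F" "F \<subseteq> {N :: 'r config measure set. openin weak_star N \<and> (\<exists>c. ?good N c)}"
    "borel_probs \<subseteq> \<Union>F"
    using compact_space_weak_star[where 'r = 'r] unfolding compact_space_alt topspace_weak_star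
    by (metis (no_types, lifting) mem_Collect_eq)
  from F(2) have "\<forall>N\<in>F. \<exists>c. ?good N c" by blast
  then obtain c where c: "\<And>N. N \<in> F \<Longrightarrow> ?good N (c N)" by metis
  have "(\<lambda>n. \<Sum>N\<in>F. exp (real n * (c N - B))) \<longlonglongrightarrow> (\<Sum>N\<in>F. 0)"
  proof (rule tendsto_sum)
    fix N assume "N \<in> F"
    then have "c N - B < 0" using c by auto
    then have "(\<lambda>n. exp (c N - B) ^ n) \<longlonglongrightarrow> 0" by (intro LIMSEQ_realpow_zero) auto
    then show "(\<lambda>n. exp (real n * (c N - B))) \<longlonglongrightarrow> 0" by (simp add: exp_of_nat_mult)
  qed
  then have "\<forall>\<^sub>F n in sequentially. (\<Sum>N\<in>F. exp (real n * (c N - B))) < 1"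
    by (intro order_tendstoD(2)) auto
  moreover have "\<forall>\<^sub>F n in sequentially. \<forall>N\<in>F. partition_fn J N n \<le> exp (real n * c N)"
    using F(1) c by (intro eventually_ball_finite) auto
  ultimately have "\<forall>\<^sub>F n in sequentially. partition_fn J (UNIV :: 'r config measure set) n < exp (real n * B)"
    using eventually_gt_at_top[of 0]
  proof eventually_elim
    case (elim n)
    have "partition_fn J (UNIV :: 'r config measure set) n \<le> (\<Sum>N\<in>F. partition_fn J N n)"
      using F elim by (intro partition_fn_UNIV_le_sum) auto
    also have "\<dots> \<le> (\<Sum>N\<in>F. exp (real n * c N))" using elim by (intro sum_mono) auto
    also have "\<dots> = exp (real n * B) * (\<Sum>N\<in>F. exp (real n * (c N - B)))"
      by (simp add: sum_distrib_left algebra_simps flip: exp_add)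
    also have "\<dots> < exp (real n * B) * 1" using elim by (intro mult_strict_left_mono) auto
    finally show ?case by simp
  qed
  with freq show False by (simp add: frequently_def not_le)
qed

section \<open>Independent uniform permutations\<close>

text \<open>
  The permutation assigned to a letter when generator \<open>i\<close> is sent to \<open>f i\<close>, and the product of these
  permutations along a word.
\<close>

definition eval_letter :: "('r \<Rightarrow> nat \<Rightarrow> nat) \<Rightarrow> 'r \<times> bool \<Rightarrow> nat \<Rightarrow> nat" where
  "eval_letter f a = (if snd a then f (fst a) else inv_into UNIV (f (fst a)))"

definition eval_word :: "('r \<Rightarrow> nat \<Rightarrow> nat) \<Rightarrow> ('r \<times> bool) list \<Rightarrow> nat \<Rightarrow> nat" where
  "eval_word f w = foldr (\<lambda>a \<pi>. eval_letter f a \<circ> \<pi>) w id"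

lemma eval_word_simps [simp]:
  "eval_word f [] = id" "eval_word f (a # w) = eval_letter f a \<circ> eval_word f w"
  by (simp_all add: eval_word_def)

text \<open>
  The universal property of the free group: homomorphisms to the symmetric group are the same as
  arbitrary choices of permutations for the generators. Hence under a uniform homomorphism the
  generators act by independent uniform permutations.
\<close>

lemma bij_betw_homs_generators:
  "bij_betw (\<lambda>\<sigma> i. \<sigma> (gen i)) (hom (free_group :: ('r::finite) fword monoid) (sym_group n))
     (UNIV \<rightarrow>\<^sub>E {\<pi>. \<pi> permutes {1..n}})" (is "bij_betw ?gens ?H ?P")
proof -
  define extend where "extend f = (\<lambda>g :: 'r fword. eval_word f (Rep_fword g))" for f
  have "extend f \<in> ?H" "?gens (extend f) = f" if f: "f \<in> ?P" for f
  proof -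
    have p: "f i permutes {1..n}" for i using f by auto
    have letter: "eval_letter f a permutes {1..n}" for a
      using p by (simp add: eval_letter_def permutes_inv)
    have cancel: "eval_letter f a \<circ> eval_letter f (inv_letter a) = id" for a
      using permutes_inv_o[OF p] by (simp add: eval_letter_def inv_letter_def)
    have word: "eval_word f w permutes {1..n}" for w
      by (induction w) (simp_all only: eval_word_simps permutes_id permutes_compose letter)
    have push: "eval_word f (push a w) = eval_letter f a \<circ> eval_word f w" for a w
      using cancel by (induction a w rule: push.induct) (auto simp: o_assoc)
    have mult: "eval_word f (foldr push u w) = eval_word f u \<circ> eval_word f w" for u w
      by (induction u) (simp_all add: push o_assoc)
    show "extend f \<in> ?H"
      using word by (auto simp: hom_def sym_group_def free_group_def extend_def fmult.rep_eq mult)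
    show "?gens (extend f) = f"
      by (simp add: extend_def gen_def letter.rep_eq eval_letter_def)
  qed
  moreover have "?gens \<sigma> \<in> ?P" "extend (?gens \<sigma>) = \<sigma>" if \<sigma>: "\<sigma> \<in> ?H" for \<sigma>
  proof -
    show "?gens \<sigma> \<in> ?P" using free_group_hom_simps[OF \<sigma>] by auto
    interpret group_hom "free_group :: 'r fword monoid" "sym_group n" \<sigma>
      by (intro group_hom.intro group_hom_axioms.intro group_free_group sym_group_is_group \<sigma>)
    have inv: "\<sigma> (gen_inv i) = inv_into UNIV (\<sigma> (gen i))" for i
    proof -
      have "\<sigma> (gen i) \<circ> \<sigma> (gen_inv i) = id"
        using free_group_hom_simps(2)[OF \<sigma>, of "gen i" "gen_inv i"] free_group_hom_simps(3)[OF \<sigma>] G.r_inv[of "gen i"]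
        by (simp add: gen_inv_eq free_group_def)
      then show ?thesis
        using permutes_inv_o(2)[OF free_group_hom_simps(1)[OF \<sigma>, of "gen i"]]
        by (metis comp_assoc id_comp comp_id)
    qed
    have letter: "\<sigma> (letter a) = eval_letter (?gens \<sigma>) a" for a
      using inv by (cases a) (auto simp: eval_letter_def gen_def gen_inv_def)
    have "\<sigma> (Abs_fword w) = eval_word (?gens \<sigma>) w" if "reduced w" for w
      using that
    proof (induction w)
      case Nil
      then show ?case using free_group_hom_simps(3)[OF \<sigma>] by (simp add: free_group_def fone_def)
    next
      case (Cons a w)
      have "push a w = a # w" using Cons.prems by (cases w) auto
      then have "Abs_fword (a # w) = letter a \<otimes>\<^bsub>free_group\<^esub> Abs_fword w"
        using Cons.prems reduced_tl[OF Cons.prems]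
        by (simp add: fmult_def letter_def Abs_fword_inverse free_group_def)
      then show ?case
        using Cons.IH[OF reduced_tl[OF Cons.prems]] free_group_hom_simps(2)[OF \<sigma>] letter by simp
    qed
    then have "\<sigma> (Abs_fword (Rep_fword g)) = eval_word (?gens \<sigma>) (Rep_fword g)" for g
      using Rep_fword[of g] by blast
    then show "extend (?gens \<sigma>) = \<sigma>"
      unfolding extend_def Rep_fword_inverse by (rule ext[symmetric])
  qed
  ultimately show ?thesis
    by (intro bij_betw_byWitness[where f' = extend]) auto
qed

lemma expectation_hom_prod:
  fixes g :: "(nat \<Rightarrow> nat) \<Rightarrow> real"
  shows "measure_pmf.expectation (pmf_of_set (hom (free_group :: ('r::finite) fword monoid) (sym_group n)))
      (\<lambda>\<sigma>. \<Prod>i\<in>UNIV. g (\<sigma> (gen i))) = ((\<Sum>\<pi> | \<pi> permutes {1..n}. g \<pi>) / fact n) ^ CARD('r)"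
proof -
  let ?P = "UNIV \<rightarrow>\<^sub>E {\<pi>. \<pi> permutes {1..n}} :: ('r \<Rightarrow> nat \<Rightarrow> nat) set"
  note bij = bij_betw_homs_generators[where 'r = 'r, of n]
  have "(\<Sum>\<sigma>\<in>hom (free_group :: 'r fword monoid) (sym_group n). \<Prod>i\<in>UNIV. g (\<sigma> (gen i)))
      = (\<Sum>f\<in>?P. \<Prod>i\<in>UNIV. g (f i))"
    using sum.reindex_bij_betw[OF bij, of "\<lambda>f. \<Prod>i\<in>UNIV. g (f i)"] by simp
  also have "\<dots> = (\<Sum>\<pi> | \<pi> permutes {1..n}. g \<pi>) ^ CARD('r)"
    by (subst prod_sum_PiE[symmetric]) (simp_all add: finite_permutations)
  finally have 1: "(\<Sum>\<sigma>\<in>hom (free_group :: 'r fword monoid) (sym_group n). \<Prod>i\<in>UNIV. g (\<sigma> (gen i)))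
      = (\<Sum>\<pi> | \<pi> permutes {1..n}. g \<pi>) ^ CARD('r)" .
  have "card (hom (free_group :: 'r fword monoid) (sym_group n)) = card ?P"
    using bij by (rule bij_betw_same_card)
  also have "\<dots> = fact n ^ CARD('r)"
    by (simp add: card_PiE card_permutations[OF refl])
  finally show ?thesis
    unfolding expectation_hom_sym_group 1 by (simp add: power_divide)
qed

text \<open>
  The two terms of the energy belonging to a generator and its inverse contribute equally, which
  cancels the factor \<open>1/2\<close>.
\<close>

lemma scaled_mean_energy_empirical:
  fixes \<sigma> :: "('r::finite) fword \<Rightarrow> nat \<Rightarrow> nat"
  assumes \<sigma>: "\<sigma> \<in> hom free_group (sym_group n)" and n: "n > 0"
  shows "- real n * mean_energy J (empirical {1..n} \<sigma> x)
    = (\<Sum>i\<in>UNIV. J * (\<Sum>v=1..n. spin_val (x v) * spin_val (x (\<sigma> (gen i) v))))"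
proof -
  let ?c = "\<lambda>\<pi>. \<Sum>v=1..n. spin_val (x v) * spin_val (x (\<pi> v))"
  have "integral\<^sup>L (empirical {1..n} \<sigma> x) (ising_u J)
      = integral\<^sup>L (uniform_count_measure {1..n}) (\<lambda>v. ising_u J (pullback_name \<sigma> x v))"
    unfolding empirical_def
    by (rule integral_distr[OF pullback_name_measurable borel_measurable_continuous_onI[OF continuous_on_ising_u]])
  also have "\<dots> = (\<Sum>v=1..n. ising_u J (pullback_name \<sigma> x v)) / real n"
    by (simp add: integral_uniform_count_measure)
  finally have "real n * mean_energy J (empirical {1..n} \<sigma> x)
      = (\<Sum>v=1..n. ising_u J (pullback_name \<sigma> x v))"
    using n by (simp add: mean_energy_def)
  also have "\<dots> = (\<Sum>v=1..n. - (J / 2) * (\<Sum>i\<in>UNIV. spin_val (x v) * spin_val (x (\<sigma> (gen i) v))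
        + spin_val (x v) * spin_val (x (\<sigma> (gen_inv i) v))))"
    by (simp add: ising_u_def pullback_name_def free_group_hom_simps(3)[OF \<sigma>])
  also have "\<dots> = - (J / 2) * (\<Sum>i\<in>UNIV. ?c (\<sigma> (gen i)) + ?c (\<sigma> (gen_inv i)))"
    unfolding sum_distrib_left[symmetric] by (subst sum.swap) (simp add: sum.distrib)
  also have "\<dots> = - (J / 2) * (\<Sum>i\<in>UNIV. ?c (\<sigma> (gen i)) + ?c (\<sigma> (gen i)))"
  proof -
    have "?c (\<sigma> (gen_inv i)) = ?c (\<sigma> (gen i))" for i
    proof -
      interpret G: group "free_group :: 'r fword monoid" by (rule group_free_group)
      have p: "\<sigma> (gen i) permutes {1..n}" by (rule free_group_hom_simps(1)[OF \<sigma>])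
      have "\<sigma> (gen_inv i) \<circ> \<sigma> (gen i) = id"
        using free_group_hom_simps(2)[OF \<sigma>, of "gen_inv i" "gen i"] free_group_hom_simps(3)[OF \<sigma>] G.l_inv[of "gen i"]
        by (simp add: gen_inv_eq free_group_def)
      then have inv: "\<sigma> (gen_inv i) (\<sigma> (gen i) v) = v" for v by (simp add: fun_eq_iff)
      have "?c (\<sigma> (gen_inv i)) = (\<Sum>v=1..n. spin_val (x (\<sigma> (gen i) v)) * spin_val (x (\<sigma> (gen_inv i) (\<sigma> (gen i) v))))"
        by (rule sum.reindex_bij_betw[OF permutes_imp_bij[OF p], symmetric])
      then show ?thesis by (simp add: inv mult.commute)
    qed
    then show ?thesis by simp
  qed
  finally show ?thesis by (simp add: sum_distrib_left sum_negf)
qed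

text \<open>
  The mean Boltzmann weight of a labelling \<open>x\<close> of \<open>{1..n}\<close> for one generator, that is, for one uniform
  permutation.
\<close>

definition mean_weight :: "real \<Rightarrow> nat \<Rightarrow> (nat \<Rightarrow> spin) \<Rightarrow> real" where
  "mean_weight J n x = (\<Sum>\<pi> | \<pi> permutes {1..n}.
     exp (J * (\<Sum>v=1..n. spin_val (x v) * spin_val (x (\<pi> v))))) / fact n"

lemma expectation_exp_energy:
  assumes n: "n > 0"
  shows "measure_pmf.expectation (pmf_of_set (hom (free_group :: ('r::finite) fword monoid) (sym_group n)))
      (\<lambda>\<sigma>. exp (- real n * mean_energy J (empirical {1..n} \<sigma> x))) = mean_weight J n x ^ CARD('r)"
  unfolding mean_weight_def expectation_hom_prod[symmetric] expectation_hom_sym_group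
  by (intro arg_cong2[where f = "(/)"] sum.cong refl)
    (simp only: scaled_mean_energy_empirical n exp_sum finite)

lemma partition_fn_UNIV:
  assumes n: "n > 0"
  shows "partition_fn J (UNIV :: ('r::finite) config measure set) n
    = (\<Sum>x\<in>{1..n} \<rightarrow>\<^sub>E UNIV. mean_weight J n x ^ CARD('r))"
proof -
  have good: "good_models {1..n} \<sigma> (UNIV :: 'r config measure set) = {1..n} \<rightarrow>\<^sub>E UNIV" for \<sigma>
    by (auto simp: good_models_def)
  show ?thesis
    unfolding expectation_exp_energy[OF n, where 'r = 'r, symmetric] partition_fn_def good
    unfolding expectation_hom_sym_group sum_divide_distrib by (rule sum.swap)
qed

lemma partition_fn_le:
  fixes S :: "('r::finite) config measure set"
  assumes n: "n > 0" and X: "finite X" "\<And>\<sigma>. \<sigma> \<in> hom free_group (sym_group n) \<Longrightarrow> good_models {1..n} \<sigma> S \<subseteq> X"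
  shows "partition_fn J S n \<le> (\<Sum>x\<in>X. mean_weight J n x ^ CARD('r))"
proof -
  have "partition_fn J S n \<le> measure_pmf.expectation (pmf_of_set (hom free_group (sym_group n)))
     (\<lambda>\<sigma> :: 'r fword \<Rightarrow> nat \<Rightarrow> nat. \<Sum>x\<in>X. exp (- real n * mean_energy J (empirical {1..n} \<sigma> x)))"
    unfolding partition_fn_def by (rule expectation_hom_mono) (intro sum_mono2 X, auto)
  also have "\<dots> = (\<Sum>x\<in>X. mean_weight J n x ^ CARD('r))"
    unfolding expectation_exp_energy[OF n, where 'r = 'r, symmetric]
    unfolding expectation_hom_sym_group sum_divide_distrib by (rule sum.swap)
  finally show ?thesis .
qed

section \<open>The image of a set under a uniform permutation\<close>

lemma exists_permutation_image:
  assumes V: "finite V" "A \<subseteq> V" "B \<subseteq> V" "card A = card B"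
  shows "\<exists>\<pi>. \<pi> permutes V \<and> \<pi> ` A = B"
proof -
  have fin: "finite A" "finite B" using V finite_subset by auto
  obtain f where f: "bij_betw f A B" using finite_same_card_bij[OF fin V(4)] by blast
  have "card (V - A) = card (V - B)" using V fin by (simp add: card_Diff_subset)
  then obtain g where g: "bij_betw g (V - A) (V - B)"
    using finite_same_card_bij[of "V - A" "V - B"] V(1) by auto
  define \<pi> where "\<pi> v = (if v \<in> A then f v else if v \<in> V then g v else v)" for v
  have A: "bij_betw \<pi> A B" using f by (simp add: \<pi>_def cong: bij_betw_cong)
  have "bij_betw \<pi> (V - A) (V - B)"
    using g by (rule bij_betw_cong[THEN iffD1, rotated]) (auto simp: \<pi>_def)
  with A have "bij_betw \<pi> (A \<union> (V - A)) (B \<union> (V - B))" by (rule bij_betw_combine) auto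
  moreover have "A \<union> (V - A) = V" "B \<union> (V - B) = V" using V by auto
  ultimately have "\<pi> permutes V" using V(2) by (intro bij_imp_permutes) (auto simp: \<pi>_def)
  with A show ?thesis by (auto simp: bij_betw_def)
qed

text \<open>
  A uniform permutation maps a fixed set to a uniform set of the same cardinality, since composition
  with a permutation that maps \<open>B\<close> to \<open>C\<close> carries the fibre over \<open>B\<close> into the fibre over \<open>C\<close>.
\<close>

lemma card_permutations_image:
  assumes V: "finite V" "A \<subseteq> V" "B \<subseteq> V" "card A = card B"
  shows "real (card {\<pi>. \<pi> permutes V \<and> \<pi> ` A = B}) = fact (card V) / real (card V choose card A)"
proof -
  let ?N = "\<lambda>B. card {\<pi>. \<pi> permutes V \<and> \<pi> ` A = B}"
  let ?T = "{B. B \<subseteq> V \<and> card B = card A}"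
  have fin: "finite {\<pi>. \<pi> permutes V}" by (rule finite_permutations[OF V(1)])
  have le: "?N B \<le> ?N C" if BC: "B \<subseteq> V" "C \<subseteq> V" "card B = card C" for B C
  proof -
    obtain \<rho> where \<rho>: "\<rho> permutes V" "\<rho> ` B = C" using exists_permutation_image[OF V(1) BC] by blast
    show ?thesis
    proof (rule card_inj_on_le)
      show "inj_on ((\<circ>) \<rho>) {\<pi>. \<pi> permutes V \<and> \<pi> ` A = B}"
        using permutes_inj[OF \<rho>(1)] by (auto simp: inj_on_def fun_eq_iff)
      show "(\<circ>) \<rho> ` {\<pi>. \<pi> permutes V \<and> \<pi> ` A = B} \<subseteq> {\<pi>. \<pi> permutes V \<and> \<pi> ` A = C}"
        using \<rho> by (auto simp: permutes_compose image_comp[symmetric])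
      show "finite {\<pi>. \<pi> permutes V \<and> \<pi> ` A = C}" by (rule finite_subset[OF _ fin]) auto
    qed
  qed
  have "real (fact (card V)) = real (card {\<pi>. \<pi> permutes V})"
    by (simp add: card_permutations[OF refl V(1)])
  also have "\<dots> = (\<Sum>\<pi>\<in>{\<pi>. \<pi> permutes V}. 1)" by simp
  also have "\<dots> = (\<Sum>C\<in>?T. \<Sum>\<pi>\<in>{\<pi> \<in> {\<pi>. \<pi> permutes V}. \<pi> ` A = C}. 1)"
  proof (rule sum.group[symmetric, OF fin])
    show "finite ?T" using V(1) by simp
    show "(\<lambda>\<pi>. \<pi> ` A) ` {\<pi>. \<pi> permutes V} \<subseteq> ?T"
      using V(2) by (auto simp: card_image permutes_inj_on permutes_in_image)
  qed
  also have "\<dots> = (\<Sum>C\<in>?T. real (?N C))" by simp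
  also have "\<dots> = (\<Sum>C\<in>?T. real (?N B))"
    using V le by (intro sum.cong) (auto intro: antisym)
  also have "\<dots> = real (card V choose card A) * real (?N B)"
    using n_subsets[OF V(1), of "card A"] by simp
  finally show ?thesis
    using card_mono[OF V(1,2)] by (simp add: field_simps)
qed

lemma sum_permutations_image:
  fixes F :: "'a set \<Rightarrow> real"
  assumes V: "finite V" "A \<subseteq> V"
  shows "(\<Sum>\<pi> | \<pi> permutes V. F (\<pi> ` A)) / fact (card V)
    = (\<Sum>B | B \<subseteq> V \<and> card B = card A. F B) / real (card V choose card A)"
proof -
  let ?T = "{B. B \<subseteq> V \<and> card B = card A}"
  have fin: "finite {\<pi>. \<pi> permutes V}" by (rule finite_permutations[OF V(1)])
  have "(\<Sum>\<pi> | \<pi> permutes V. F (\<pi> ` A))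
    = (\<Sum>B\<in>?T. \<Sum>\<pi>\<in>{\<pi> \<in> {\<pi>. \<pi> permutes V}. \<pi> ` A = B}. F (\<pi> ` A))"
  proof (rule sum.group[symmetric, OF fin])
    show "finite ?T" using V(1) by simp
    show "(\<lambda>\<pi>. \<pi> ` A) ` {\<pi>. \<pi> permutes V} \<subseteq> ?T"
      using V(2) by (auto simp: card_image permutes_inj_on permutes_in_image)
  qed
  also have "\<dots> = (\<Sum>B\<in>?T. real (card {\<pi>. \<pi> permutes V \<and> \<pi> ` A = B}) * F B)"
    by (intro sum.cong) simp_all
  also have "\<dots> = (\<Sum>B\<in>?T. fact (card V) / real (card V choose card A) * F B)"
    using V by (intro sum.cong refl) (simp add: card_permutations_image)
  also have "\<dots> = fact (card V) / real (card V choose card A) * (\<Sum>B\<in>?T. F B)"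
    by (rule sum_distrib_left[symmetric])
  finally show ?thesis by simp
qed

text \<open>
  The sites with a plus spin.
\<close>

definition plus_set :: "nat \<Rightarrow> (nat \<Rightarrow> spin) \<Rightarrow> nat set" where
  "plus_set n x = {v \<in> {1..n}. x v = Plus}"

lemma plus_set_subset: "plus_set n x \<subseteq> {1..n}"
  by (auto simp: plus_set_def)

lemma bij_betw_plus_set: "bij_betw (plus_set n) ({1..n} \<rightarrow>\<^sub>E UNIV) (Pow {1..n})"
proof (rule bij_betwI)
  let ?g = "\<lambda>A. restrict (\<lambda>v. if v \<in> A then Plus else Minus) {1..n}"
  show "plus_set n \<in> ({1..n} \<rightarrow>\<^sub>E UNIV) \<rightarrow> Pow {1..n}"
    by (intro funcsetI PowI plus_set_subset)
  show "?g \<in> Pow {1..n} \<rightarrow> ({1..n} \<rightarrow>\<^sub>E UNIV)"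
    by (intro funcsetI restrict_PiE_iff[THEN iffD2]) blast
  show "?g (plus_set n x) = x" if x: "x \<in> {1..n} \<rightarrow>\<^sub>E UNIV" for x
  proof
    fix v show "?g (plus_set n x) v = x v"
    proof (cases "v \<in> {1..n}")
      case True
      then show ?thesis by (cases "x v") (simp_all add: plus_set_def)
    next
      case False
      then show ?thesis using PiE_arb[OF x False] by (simp only: restrict_apply if_False)
    qed
  qed
  show "plus_set n (?g A) = A" if "A \<in> Pow {1..n}" for A
    using that unfolding plus_set_def by (auto split: if_splits)
qed

lemma sum_spin_products:
  assumes "\<pi> permutes {1..n}"
  shows "(\<Sum>v=1..n. spin_val (x v) * spin_val (x (inv_into UNIV \<pi> v)))
    = real n - 2 * real (card (sym_diff (plus_set n x) (\<pi> ` plus_set n x)))"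
proof -
  let ?A = "plus_set n x"
  let ?D = "sym_diff ?A (\<pi> ` ?A)"
  have mem: "v \<in> \<pi> ` ?A \<longleftrightarrow> x (inv_into UNIV \<pi> v) = Plus" if "v \<in> {1..n}" for v
    using assms that permutes_inverses[OF assms] permutes_in_image[OF permutes_inv[OF assms], of v]
    by (auto simp: plus_set_def image_iff intro!: exI[of _ "inv_into UNIV \<pi> v"])
  have D: "?D \<subseteq> {1..n}"
    using plus_set_subset[of n x] permutes_image[OF assms] by blast
  have "spin_val (x v) * spin_val (x (inv_into UNIV \<pi> v)) = 1 - 2 * indicator ?D v"
    if v: "v \<in> {1..n}" for v
  proof -
    have "v \<in> ?A \<longleftrightarrow> x v = Plus" using v by (auto simp: plus_set_def)
    then show ?thesis using mem[OF v]
      by (cases "x v"; cases "x (inv_into UNIV \<pi> v)") (auto simp: indicator_def)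
  qed
  then have "(\<Sum>v=1..n. spin_val (x v) * spin_val (x (inv_into UNIV \<pi> v)))
      = (\<Sum>v=1..n. 1 - 2 * indicator ?D v)" by (intro sum.cong) auto
  also have "\<dots> = real n - 2 * (\<Sum>v=1..n. indicator ?D v)"
    by (simp add: sum_subtractf sum_distrib_left)
  also have "(\<Sum>v=1..n. indicator ?D v :: real) = card ?D"
  proof -
    have "(\<Sum>v=1..n. indicator ?D v :: real) = (\<Sum>v\<in>?D. indicator ?D v)"
      by (rule sum.mono_neutral_right) (use D in auto)
    also have "\<dots> = (\<Sum>v\<in>?D. 1)" by (intro sum.cong refl) simp
    finally show ?thesis by simp
  qed
  finally show ?thesis .
qed

text \<open>
  Only the image \<open>B\<close> of the set of plus spins matters: the spins at \<open>v\<close> and at its preimage differ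
  exactly when \<open>v\<close> lies in the symmetric difference of \<open>B\<close> and the set of plus spins.
\<close>

lemma mean_weight_eq:
  "mean_weight J n x = exp (J * real n) *
     (\<Sum>B | B \<subseteq> {1..n} \<and> card B = card (plus_set n x). exp (- 2 * J) ^ card (sym_diff (plus_set n x) B))
     / real (n choose card (plus_set n x))"
proof -
  let ?A = "plus_set n x"
  have "(\<Sum>\<pi> | \<pi> permutes {1..n}. exp (J * (\<Sum>v=1..n. spin_val (x v) * spin_val (x (\<pi> v)))))
    = (\<Sum>\<pi> | \<pi> permutes {1..n}. exp (J * (\<Sum>v=1..n. spin_val (x v) * spin_val (x (inv_into UNIV \<pi> v)))))"
    by (rule sum_permutations_inverse)
  also have "\<dots> = (\<Sum>\<pi> | \<pi> permutes {1..n}. exp (J * real n) * exp (- 2 * J) ^ card (sym_diff ?A (\<pi> ` ?A)))"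
    by (intro sum.cong refl, simp only: mem_Collect_eq sum_spin_products)
      (simp add: algebra_simps flip: exp_of_nat_mult exp_add)
  finally have "mean_weight J n x = (\<Sum>\<pi> | \<pi> permutes {1..n}.
      exp (J * real n) * exp (- 2 * J) ^ card (sym_diff ?A (\<pi> ` ?A))) / fact (card {1..n})"
    unfolding mean_weight_def by simp
  also have "\<dots> = (\<Sum>B | B \<subseteq> {1..n} \<and> card B = card ?A.
      exp (J * real n) * exp (- 2 * J) ^ card (sym_diff ?A B)) / real (n choose card ?A)"
    by (subst sum_permutations_image[where F = "\<lambda>B. exp (J * real n) * exp (- 2 * J) ^ card (sym_diff ?A B)"])
      (simp_all add: plus_set_subset[of n x, simplified])
  finally show ?thesis by (simp add: sum_distrib_left)
qed

lemma sum_Pow_power_card: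
  assumes "finite V"
  shows "(\<Sum>B\<in>Pow V. y ^ card B) = (1 + y :: real) ^ card V"
proof -
  have "(\<Prod>v\<in>V. y + 1) = (\<Sum>B\<in>Pow V. (\<Prod>v\<in>B. y) * (\<Prod>v\<in>V-B. 1))"
    by (rule prod_add[OF assms])
  then show ?thesis by (simp add: add.commute)
qed

lemma sum_sym_diff_le:
  fixes y :: real
  assumes V: "finite V" "A \<subseteq> V" and y: "y \<ge> 0"
  shows "(\<Sum>B | B \<subseteq> V \<and> card B = k. y ^ card (sym_diff A B)) \<le> (1 + y) ^ card V"
proof -
  have "(\<Sum>B | B \<subseteq> V \<and> card B = k. y ^ card (sym_diff A B)) \<le> (\<Sum>B\<in>Pow V. y ^ card (sym_diff A B))"
    using V y by (intro sum_mono2) auto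
  also have "\<dots> = (\<Sum>B\<in>Pow V. y ^ card B)"
    by (rule sum.reindex_bij_witness[where i = "sym_diff A" and j = "sym_diff A"]) (use V in auto)
  finally show ?thesis using sum_Pow_power_card[OF V(1), of y] by simp
qed

text \<open>
  A lower bound by the sets \<open>B\<close> that arise from \<open>A\<close> by exchanging \<open>j\<close> elements \<open>P\<close> of \<open>A\<close> for \<open>j\<close> elements
  \<open>Q\<close> of the complement.
\<close>

lemma sum_sym_diff_ge:
  fixes y :: real
  assumes V: "finite V" "A \<subseteq> V" and y: "y \<ge> 0"
  shows "real (card A choose j) * real ((card V - card A) choose j) * y ^ (2 * j)
    \<le> (\<Sum>B | B \<subseteq> V \<and> card B = card A. y ^ card (sym_diff A B))"
proof -
  have fin: "finite A" using V finite_subset by blast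
  let ?S = "{P. P \<subseteq> A \<and> card P = j} \<times> {Q. Q \<subseteq> V - A \<and> card Q = j}"
  let ?f = "\<lambda>(P, Q). (A - P) \<union> Q"
  have S: "finite ?S" using V fin by simp
  have sd: "sym_diff A (?f (P, Q)) = P \<union> Q" if "P \<subseteq> A" "Q \<subseteq> V - A" for P Q using that by auto
  have inj: "inj_on ?f ?S"
  proof (rule inj_onI, clarify)
    fix P Q P' Q' assume *: "P \<subseteq> A" "Q \<subseteq> V - A" "P' \<subseteq> A" "Q' \<subseteq> V - A" "A - P \<union> Q = A - P' \<union> Q'"
    then have "P \<union> Q = P' \<union> Q'" using sd[of P Q] sd[of P' Q'] by simp
    then have "(P \<union> Q) \<inter> A = (P' \<union> Q') \<inter> A" "(P \<union> Q) - A = (P' \<union> Q') - A" by simp_all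
    then show "P = P' \<and> Q = Q'" using * by blast
  qed
  have card_f: "?f (P, Q) \<subseteq> V \<and> card (?f (P, Q)) = card A" and card_sd: "card (sym_diff A (?f (P, Q))) = 2 * j"
    if "(P, Q) \<in> ?S" for P Q
  proof -
    from that have PQ: "P \<subseteq> A" "card P = j" "Q \<subseteq> V - A" "card Q = j" by auto
    then have f: "finite P" "finite Q" using V fin finite_subset by (blast, blast)
    have "card (A - P \<union> Q) = card (A - P) + card Q"
      using PQ f fin by (intro card_Un_disjoint) auto
    also have "\<dots> = card A" using PQ f card_mono[OF fin PQ(1)] by (simp add: card_Diff_subset)
    finally show "?f (P, Q) \<subseteq> V \<and> card (?f (P, Q)) = card A" using PQ V by auto
    have "card (P \<union> Q) = card P + card Q" using PQ f by (intro card_Un_disjoint) auto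
    then show "card (sym_diff A (?f (P, Q))) = 2 * j" unfolding sd[OF PQ(1,3)] using PQ by simp
  qed
  have "real (card A choose j) * real ((card V - card A) choose j) * y ^ (2 * j) = (\<Sum>p\<in>?S. y ^ (2 * j))"
    using V fin by (simp add: card_cartesian_product n_subsets card_Diff_subset)
  also have "\<dots> = (\<Sum>p\<in>?S. y ^ card (sym_diff A (?f p)))"
    using card_sd by (intro sum.cong refl) (simp only: split_paired_all)
  also have "\<dots> = (\<Sum>B\<in>?f ` ?S. y ^ card (sym_diff A B))"
    by (simp add: sum.reindex[OF inj])
  also have "\<dots> \<le> (\<Sum>B | B \<subseteq> V \<and> card B = card A. y ^ card (sym_diff A B))"
  proof (rule sum_mono2)
    show "finite {B. B \<subseteq> V \<and> card B = card A}" using V by simp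
    show "?f ` ?S \<subseteq> {B. B \<subseteq> V \<and> card B = card A}"
      using card_f by (intro image_subsetI) (simp only: split_paired_all mem_Collect_eq)
  qed (use y in auto)
  finally show ?thesis .
qed

lemma mean_weight_le:
  "mean_weight J n x \<le> (2 * cosh J) ^ n / real (n choose card (plus_set n x))"
proof -
  let ?S = "\<Sum>B | B \<subseteq> {1..n} \<and> card B = card (plus_set n x). exp (- 2 * J) ^ card (sym_diff (plus_set n x) B)"
  have "exp J * (1 + exp (- 2 * J)) = 2 * cosh J"
    by (simp add: cosh_def distrib_left flip: exp_add)
  then have eq: "exp (J * real n) * (1 + exp (- 2 * J)) ^ n = (2 * cosh J) ^ n"
    by (metis exp_of_nat2_mult power_mult_distrib)
  have "?S \<le> (1 + exp (- 2 * J)) ^ n"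
    using sum_sym_diff_le[of "{1..n}" "plus_set n x" "exp (- 2 * J)" "card (plus_set n x)"]
      plus_set_subset[of n x] by simp
  then have "exp (J * real n) * ?S \<le> exp (J * real n) * (1 + exp (- 2 * J)) ^ n"
    by (intro mult_left_mono) auto
  then show ?thesis
    unfolding mean_weight_eq eq by (rule divide_right_mono) simp
qed

lemma mean_weight_nonneg: "0 \<le> mean_weight J n x"
  unfolding mean_weight_def by (intro divide_nonneg_nonneg sum_nonneg) auto

lemma mean_weight_ge:
  fixes x :: "nat \<Rightarrow> spin" and k n :: nat
  defines "k \<equiv> card (plus_set n x)"
  shows "exp (J * (real n - 4 * real j)) * real (k choose j) * real ((n - k) choose j) / real (n choose k)
    \<le> mean_weight J n x"
proof -
  have "exp (J * (real n - 4 * real j)) = exp (J * real n) * exp (- 2 * J) ^ (2 * j)"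
    by (simp add: algebra_simps flip: exp_of_nat_mult exp_add)
  moreover have "real (k choose j) * real ((n - k) choose j) * exp (- 2 * J) ^ (2 * j)
      \<le> (\<Sum>B | B \<subseteq> {1..n} \<and> card B = k. exp (- 2 * J) ^ card (sym_diff (plus_set n x) B))"
    using sum_sym_diff_ge[of "{1..n}" "plus_set n x" "exp (- 2 * J)" j] plus_set_subset[of n x]
    by (simp add: k_def)
  ultimately have "exp (J * (real n - 4 * real j)) * real (k choose j) * real ((n - k) choose j)
      \<le> exp (J * real n) * (\<Sum>B | B \<subseteq> {1..n} \<and> card B = k. exp (- 2 * J) ^ card (sym_diff (plus_set n x) B))"
    by (simp add: mult_ac)
  then show ?thesis
    unfolding mean_weight_eq k_def[symmetric] by (rule divide_right_mono) simp
qed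

lemma sum_plus_sets_card:
  "(\<Sum>x\<in>{x \<in> {1..n} \<rightarrow>\<^sub>E UNIV. card (plus_set n x) \<in> K}. G (card (plus_set n x)))
    = (\<Sum>k\<in>{..n} \<inter> K. real (n choose k) * G k)"
proof -
  let ?X = "{x \<in> {1..n} \<rightarrow>\<^sub>E UNIV. card (plus_set n x) \<in> K}"
  have fin: "finite ?X" by (intro finite_subset[OF _ finite_PiE[of "{1..n}" "\<lambda>_. UNIV :: spin set"]]) auto
  have "(\<Sum>x\<in>?X. G (card (plus_set n x)))
      = (\<Sum>k\<in>{..n} \<inter> K. \<Sum>x\<in>{x\<in>?X. card (plus_set n x) = k}. G (card (plus_set n x)))"
  proof (rule sum.group[symmetric, OF fin])
    show "(\<lambda>x. card (plus_set n x)) ` ?X \<subseteq> {..n} \<inter> K"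
      using card_mono[OF _ plus_set_subset] by auto
  qed simp
  also have "\<dots> = (\<Sum>k\<in>{..n} \<inter> K. real (n choose k) * G k)"
  proof (rule sum.cong[OF refl])
    fix k assume k: "k \<in> {..n} \<inter> K"
    have eq: "{x\<in>?X. card (plus_set n x) = k} = {x \<in> {1..n} \<rightarrow>\<^sub>E UNIV. card (plus_set n x) = k}"
      using k by auto
    have "bij_betw (plus_set n) {x \<in> {1..n} \<rightarrow>\<^sub>E UNIV. card (plus_set n x) = k} {A \<in> Pow {1..n}. card A = k}"
    proof -
      have "bij_betw (plus_set n) {x \<in> {1..n} \<rightarrow>\<^sub>E UNIV. plus_set n x \<in> {A. card A = k}} (Pow {1..n} \<inter> {A. card A = k})"
        unfolding bij_betw_def
      proof
        show "inj_on (plus_set n) {x \<in> {1..n} \<rightarrow>\<^sub>E UNIV. plus_set n x \<in> {A. card A = k}}"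
          using bij_betw_imp_inj_on[OF bij_betw_plus_set] by (rule inj_on_subset) blast
        show "plus_set n ` {x \<in> {1..n} \<rightarrow>\<^sub>E UNIV. plus_set n x \<in> {A. card A = k}} = Pow {1..n} \<inter> {A. card A = k}"
          unfolding bij_betw_imp_surj_on[OF bij_betw_plus_set, of n, symmetric] by blast
      qed
      then show ?thesis by (simp add: Int_def)
    qed
    then have "card {x \<in> {1..n} \<rightarrow>\<^sub>E UNIV. card (plus_set n x) = k} = n choose k"
      using n_subsets[of "{1..n}" k] bij_betw_same_card by fastforce
    then show "(\<Sum>x\<in>{x\<in>?X. card (plus_set n x) = k}. G (card (plus_set n x))) = real (n choose k) * G k"
      unfolding eq by simp
  qed
  finally show ?thesis .
qed

text \<open>
  A lower bound by the contribution of the labellings with \<open>k\<close> plus spins for which every generator has \<open>j\<close> sites where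
  a plus spin is followed by a minus spin.
\<close>

lemma partition_fn_UNIV_ge:
  assumes n: "n > 0" and k: "k \<le> n"
  shows "real (n choose k) * (exp (J * (real n - 4 * real j)) * real (k choose j) * real ((n - k) choose j)
      / real (n choose k)) ^ CARD('r) \<le> partition_fn J (UNIV :: ('r::finite) config measure set) n"
proof -
  let ?G = "\<lambda>k. (exp (J * (real n - 4 * real j)) * real (k choose j) * real ((n - k) choose j)
      / real (n choose k)) ^ CARD('r)"
  let ?X = "{x \<in> {1..n} \<rightarrow>\<^sub>E UNIV. card (plus_set n x) \<in> {k}}"
  have "real (n choose k) * ?G k = (\<Sum>x\<in>?X. ?G (card (plus_set n x)))"
    unfolding sum_plus_sets_card[where n = n and K = "{k}" and G = ?G] using k by simp
  also have "\<dots> \<le> (\<Sum>x\<in>?X. mean_weight J n x ^ CARD('r))"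
    by (intro sum_mono power_mono mean_weight_ge) auto
  also have "\<dots> \<le> (\<Sum>x\<in>{1..n} \<rightarrow>\<^sub>E UNIV. mean_weight J n x ^ CARD('r))"
    by (intro sum_mono2 finite_PiE) (auto simp: mean_weight_nonneg)
  finally show ?thesis by (simp only: partition_fn_UNIV[OF n])
qed

text \<open>
  First moment bound for labellings whose fraction of plus spins lies in \<open>I\<close>. It uses nothing about the
  correlations across edges.
\<close>

lemma partition_fn_balanced_le:
  fixes S :: "('r::finite) config measure set"
  assumes n: "n > 0" and S: "\<And>\<mu>. \<mu> \<in> S \<Longrightarrow> measure \<mu> {x. x \<one>\<^bsub>free_group\<^esub> = Plus} \<in> I"
  shows "partition_fn J S n \<le> (\<Sum>k\<in>{k. k \<le> n \<and> real k / real n \<in> I}.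
     real (n choose k) * ((2 * cosh J) ^ n / real (n choose k)) ^ CARD('r))"
proof -
  let ?K = "{k. real k / real n \<in> I}"
  let ?X = "{x \<in> {1..n} \<rightarrow>\<^sub>E UNIV. card (plus_set n x) \<in> ?K}"
  have "partition_fn J S n \<le> (\<Sum>x\<in>?X. mean_weight J n x ^ CARD('r))"
  proof (rule partition_fn_le[OF n])
    show "finite ?X" by (intro finite_subset[OF _ finite_PiE[of "{1..n}" "\<lambda>_. UNIV :: spin set"]]) auto
    fix \<sigma> :: "'r fword \<Rightarrow> nat \<Rightarrow> nat" assume \<sigma>: "\<sigma> \<in> hom free_group (sym_group n)"
    have "measure (empirical {1..n} \<sigma> x) {x. x \<one>\<^bsub>free_group\<^esub> = Plus} = real (card (plus_set n x)) / real n" for x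
      by (simp add: measure_empirical_card clopen_borel pullback_name_def
        free_group_hom_simps(3)[OF \<sigma>] plus_set_def)
    then show "good_models {1..n} \<sigma> S \<subseteq> ?X"
      using S by (fastforce simp: good_models_def)
  qed
  also have "\<dots> \<le> (\<Sum>x\<in>?X. ((2 * cosh J) ^ n / real (n choose card (plus_set n x))) ^ CARD('r))"
    by (intro sum_mono power_mono mean_weight_le mean_weight_nonneg)
  also have "\<dots> = (\<Sum>k\<in>{..n} \<inter> ?K. real (n choose k) * ((2 * cosh J) ^ n / real (n choose k)) ^ CARD('r))"
    by (rule sum_plus_sets_card)
  also have "{..n} \<inter> ?K = {k. k \<le> n \<and> real k / real n \<in> I}" by auto
  finally show ?thesis .
qed

section \<open>Entropy estimates for binomial coefficients\<close>

text \<open>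
  The entropy function \<open>x ln x\<close>; its value at \<open>0\<close> is \<open>0\<close>, as it should be.
\<close>

definition xlnx :: "real \<Rightarrow> real" where
  "xlnx x = x * ln x"

lemma power_self_eq_exp_xlnx: "real k ^ k = exp (xlnx (real k))"
  by (cases "k = 0") (simp_all add: xlnx_def exp_of_nat_mult)

text \<open>
  The binomial distribution with success probability \<open>k / n\<close> has its mode at \<open>k\<close>, so that its weight at
  \<open>k\<close> is at least \<open>1 / (n + 1)\<close>. The weights are scaled here by \<open>n ^ n\<close>.
\<close>

lemma binomial_mode:
  fixes k n :: nat
  assumes k: "k \<le> n"
  defines "t \<equiv> \<lambda>i. real (n choose i) * real k ^ i * real (n - k) ^ (n - i)"
  assumes i: "i \<le> n"
  shows "t i \<le> t k"
proof (cases "k = n")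
  case True
  then show ?thesis using i by (cases "i = n") (auto simp: t_def power_0_left)
next
  case False
  then have pos: "real (n - k) > 0" using k by simp
  have step: "t (Suc m) * (real (Suc m) * real (n - k)) = t m * (real (n - m) * real k)" if "m < n" for m
  proof -
    have "real (Suc m) * real (n choose Suc m) = real (n - m) * real (n choose m)"
      by (metis binomial_absorb_comp binomial_absorption of_nat_mult)
    moreover have "n - m = Suc (n - Suc m)" using that by simp
    then have "real (n - k) ^ (n - m) = real (n - k) * real (n - k) ^ (n - Suc m)"
      by (metis power_Suc)
    moreover have "t (Suc m) * (real (Suc m) * real (n - k)) = (real (Suc m) * real (n choose Suc m))
        * (real k * real k ^ m * (real (n - k) * real (n - k) ^ (n - Suc m)))"
      unfolding t_def power_Suc by (simp only: mult_ac)
    ultimately show ?thesis unfolding t_def by (simp only: mult_ac)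
  qed
  have up: "t m \<le> t (Suc m)" if "m < k" for m
  proof -
    have "real (Suc m) * real (n - k) \<le> real (n - m) * real k"
      unfolding of_nat_mult[symmetric] of_nat_le_iff
      using mult_le_mono[of "Suc m" k "n - k" "n - m"] that by (simp add: mult.commute)
    then have "t m * (real (Suc m) * real (n - k)) \<le> t m * (real (n - m) * real k)"
      by (intro mult_left_mono) (auto simp: t_def)
    then have "t m * (real (Suc m) * real (n - k)) \<le> t (Suc m) * (real (Suc m) * real (n - k))"
      using step[of m] that k by simp
    then show ?thesis using pos by (simp add: mult_le_cancel_right)
  qed
  have down: "t (Suc m) \<le> t m" if "k \<le> m" "m < n" for m
  proof -
    have "real (n - m) * real k \<le> real (Suc m) * real (n - k)"
      unfolding of_nat_mult[symmetric] of_nat_le_iff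
      using mult_le_mono[of k "Suc m" "n - m" "n - k"] that by (simp add: mult.commute)
    then have "t m * (real (n - m) * real k) \<le> t m * (real (Suc m) * real (n - k))"
      by (intro mult_left_mono) (auto simp: t_def)
    then have "t (Suc m) * (real (Suc m) * real (n - k)) \<le> t m * (real (Suc m) * real (n - k))"
      using step[OF that(2)] by simp
    then show ?thesis using pos by (simp add: mult_le_cancel_right)
  qed
  show ?thesis
  proof (cases "i \<le> k")
    case True
    then show ?thesis
      by (induction rule: inc_induct) (auto intro: order_trans[OF up])
  next
    case False
    then have "k \<le> i" by simp
    then have "i \<le> n \<longrightarrow> t i \<le> t k"
      by (induction rule: dec_induct) (auto intro: order_trans[OF down])
    with i show ?thesis by simp
  qed
qed

lemma ln_binomial_bounds:
  fixes k n :: nat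
  assumes k: "k \<le> n"
  shows "ln (real (n choose k)) \<le> xlnx (real n) - xlnx (real k) - xlnx (real (n - k))"
    and "xlnx (real n) - xlnx (real k) - xlnx (real (n - k)) - ln (real n + 1) \<le> ln (real (n choose k))"
proof -
  define t where "t i = real (n choose i) * real k ^ i * real (n - k) ^ (n - i)" for i
  have sum: "(\<Sum>i\<le>n. t i) = real n ^ n"
    using binomial_ring[of "real k" "real (n - k)" n] k by (simp add: t_def)
  have tk: "t k = real (n choose k) * exp (xlnx (real k) + xlnx (real (n - k)))"
    by (simp add: t_def power_self_eq_exp_xlnx exp_add)
  have C: "real (n choose k) > 0" using k by simp
  have "t k \<le> (\<Sum>i\<le>n. t i)" using k by (intro member_le_sum) (auto simp: t_def)
  then have "real (n choose k) * exp (xlnx (real k) + xlnx (real (n - k))) \<le> exp (xlnx (real n))"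
    unfolding sum tk power_self_eq_exp_xlnx .
  then have "ln (real (n choose k) * exp (xlnx (real k) + xlnx (real (n - k)))) \<le> ln (exp (xlnx (real n)))"
    using C by (subst ln_le_cancel_iff) auto
  then show "ln (real (n choose k)) \<le> xlnx (real n) - xlnx (real k) - xlnx (real (n - k))"
    using C by (simp only: ln_mult_pos exp_gt_zero ln_exp)
  have "(\<Sum>i\<le>n. t i) \<le> (\<Sum>i\<le>n. t k)"
    unfolding t_def by (intro sum_mono binomial_mode[OF k]) simp
  then have "exp (xlnx (real n)) \<le> (real n + 1) * (real (n choose k) * exp (xlnx (real k) + xlnx (real (n - k))))"
    unfolding sum tk power_self_eq_exp_xlnx by (simp add: algebra_simps)
  then have "ln (exp (xlnx (real n))) \<le> ln ((real n + 1) * (real (n choose k) * exp (xlnx (real k) + xlnx (real (n - k)))))"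
    using C by (subst ln_le_cancel_iff) auto
  also have "\<dots> = ln (real n + 1) + (ln (real (n choose k)) + (xlnx (real k) + xlnx (real (n - k))))"
    using C by (simp add: ln_mult_pos add_pos_nonneg del: of_nat_diff)
  finally show "xlnx (real n) - xlnx (real k) - xlnx (real (n - k)) - ln (real n + 1) \<le> ln (real (n choose k))"
    by (simp only: ln_exp)
qed

lemma xlnx_scale:
  assumes "n > 0" "x \<ge> 0"
  shows "xlnx (n * x) = n * xlnx x + n * x * ln n"
  using assms by (cases "x = 0") (simp_all add: xlnx_def ln_mult algebra_simps)

lemma isCont_xlnx: "x > 0 \<Longrightarrow> isCont xlnx x"
  unfolding xlnx_def[abs_def] by (intro continuous_intros) auto

lemma DERIV_xlnx: "x > 0 \<Longrightarrow> (xlnx has_real_derivative ln x + 1) (at x)"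
  unfolding xlnx_def[abs_def] by (auto intro!: derivative_eq_intros)

lemma ln_over_n_tendsto: "(\<lambda>n. c * ln (real n + 1) / real n) \<longlonglongrightarrow> 0"
proof -
  have "(\<lambda>n. ln (real n + 1) / real n) \<longlonglongrightarrow> 0" by real_asymp
  then have "(\<lambda>n. c * (ln (real n + 1) / real n)) \<longlonglongrightarrow> c * 0" by (rule tendsto_mult_left)
  then show ?thesis by simp
qed

section \<open>The annealed pressure at zero magnetization\<close>

text \<open>
  The growth rate of the part of the annealed partition function that comes from labellings with zero
  magnetization.
\<close>

definition balanced_pressure :: "nat \<Rightarrow> real \<Rightarrow> real" where
  "balanced_pressure r J = (1 - real r) * ln 2 + real r * ln (2 * cosh J)"

text \<open>
  With \<open>r + 1\<close> generators, each term is \<open>(2 cosh J) ^ (n (r + 1))\<close> divided by the \<open>r\<close>-th power of a binomial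
  coefficient, which for \<open>k\<close> near \<open>n / 2\<close> is nearly \<open>2 ^ n\<close>.
\<close>

lemma balanced_sum_le:
  fixes e :: real
  assumes e: "e > 0"
  shows "\<exists>d>0. \<forall>\<^sub>F n in sequentially.
    (\<Sum>k\<in>{k. k \<le> n \<and> real k / real n \<in> ball (1 / 2) d}. real (n choose k) * ((2 * cosh J) ^ n / real (n choose k)) ^ Suc r)
      \<le> exp (real n * (balanced_pressure (Suc r) J + e))"
proof -
  let ?h = "\<lambda>p. - xlnx p - xlnx (1 - p)"
  let ?L = "ln (2 * cosh J)"
  \<comment> \<open>Half of \<open>e\<close> pays for the \<open>r\<close> binomial coefficients, the other half for the polynomial factors.\<close>
  define e' where "e' = e / (2 * (real r + 1))"
  have e': "e' > 0" "real r * e' \<le> e / 2"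
    using e by (auto simp: e'_def field_simps)
  have half: "?h (1 / 2) = ln 2" by (simp add: xlnx_def ln_div)
  have "isCont ?h (1 / 2)"
    by (intro continuous_intros isCont_xlnx isCont_o2[where g = xlnx and f = "\<lambda>p. 1 - p"]) auto
  then obtain d where d: "d > 0" "\<And>p. dist p (1 / 2) < d \<Longrightarrow> dist (?h p) (?h (1 / 2)) < e'"
    unfolding continuous_at_eps_delta using e'(1) by metis
  have ev: "\<forall>\<^sub>F n in sequentially. real (Suc r) * ln (real n + 1) / real n < e / 2"
    using order_tendstoD(2)[OF ln_over_n_tendsto[of "real (Suc r)"], of "e / 2"] e by simp
  show ?thesis
  proof (intro exI conjI)
    show "\<forall>\<^sub>F n in sequentially.
      (\<Sum>k\<in>{k. k \<le> n \<and> real k / real n \<in> ball (1 / 2) d}. real (n choose k) * ((2 * cosh J) ^ n / real (n choose k)) ^ Suc r)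
        \<le> exp (real n * (balanced_pressure (Suc r) J + e))"
      using ev eventually_gt_at_top[of 0]
    proof eventually_elim
      case (elim n)
      let ?K = "{k. k \<le> n \<and> real k / real n \<in> ball (1 / 2) d}"
      let ?b = "exp (real n * (real (Suc r) * ?L - real r * (ln 2 - e')) + real r * ln (real n + 1))"
      have term_le: "real (n choose k) * ((2 * cosh J) ^ n / real (n choose k)) ^ Suc r \<le> ?b" if "k \<in> ?K" for k
      proof -
        have k: "k \<le> n" "dist (real k / real n) (1 / 2) < d" using that by (auto simp: dist_commute)
        define p where "p = real k / real n"
        have p: "0 \<le> p" "p \<le> 1" "real k = real n * p" "real (n - k) = real n * (1 - p)"
          using k elim by (auto simp: p_def field_simps of_nat_diff)
        have C: "real (n choose k) > 0" using k by simp
        have hp: "?h p \<ge> ln 2 - e'" using d(2)[OF k(2)] half by (simp add: p_def dist_real_def abs_less_iff)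
        have "xlnx (real n) - xlnx (real k) - xlnx (real (n - k)) = real n * ?h p"
          unfolding p(3,4) using p(1,2) elim
          by (subst (1 2) xlnx_scale) (auto simp: xlnx_def algebra_simps)
        then have lnC: "real n * (ln 2 - e') - ln (real n + 1) \<le> ln (real (n choose k))"
          using ln_binomial_bounds(2)[OF k(1)] mult_left_mono[OF hp, of "real n"] k(1) by (simp add: of_nat_diff)
        have "real (n choose k) * ((2 * cosh J) ^ n / real (n choose k)) ^ Suc r
          = exp (ln (real (n choose k)) + real (Suc r) * (real n * ?L - ln (real (n choose k))))"
          using C by (simp add: exp_add exp_diff exp_of_nat_mult cosh_real_pos del: power_Suc of_nat_Suc)
        also have "\<dots> \<le> ?b"
          using mult_left_mono[OF lnC, of "real r"] by (simp add: algebra_simps)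
        finally show ?thesis .
      qed
      have "finite ?K" by (rule finite_subset[of _ "{..n}"]) auto
      have "card ?K \<le> card {..n}" by (rule card_mono) auto
      then have card: "real (card ?K) \<le> real n + 1" by simp
      have "(\<Sum>k\<in>?K. real (n choose k) * ((2 * cosh J) ^ n / real (n choose k)) ^ Suc r) \<le> (\<Sum>k\<in>?K. ?b)"
        by (intro sum_mono term_le)
      also have "\<dots> \<le> (real n + 1) * ?b"
        using card by (simp add: mult_right_mono)
      also have "\<dots> = exp (ln (real n + 1)) * ?b" by simp
      also have "\<dots> = exp (real n * (real (Suc r) * ?L - real r * (ln 2 - e')) + real (Suc r) * ln (real n + 1))"
        by (simp only: exp_add[symmetric]) (simp add: algebra_simps)
      also have "\<dots> \<le> exp (real n * (balanced_pressure (Suc r) J + e))"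
      proof -
        have "real (Suc r) * ln (real n + 1) \<le> real n * (e / 2)"
          using elim by (simp add: field_simps)
        moreover have "real n * (real r * e') \<le> real n * (e / 2)"
          using e'(2) by (intro mult_left_mono) auto
        ultimately show ?thesis by (simp add: balanced_pressure_def algebra_simps)
      qed
      finally show ?case .
    qed
  qed (fact d(1))
qed

section \<open>The annealed pressure at small nonzero magnetization\<close>

text \<open>
  The exponential rate of the contribution of the configurations with a fraction \<open>a\<close> of plus spins
  and, for each generator, a fraction \<open>d\<close> of sites where a plus spin maps to a minus spin.
\<close>

definition pair_rate :: "nat \<Rightarrow> real \<Rightarrow> real \<Rightarrow> real \<Rightarrow> real" where
  "pair_rate r J a d = (2 * real r - 1) * (xlnx a + xlnx (1 - a))
     - real r * (2 * xlnx d + xlnx (a - d) + xlnx (1 - a - d)) + real r * J * (1 - 4 * d)"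

lemma pair_term_ge:
  fixes j k n r :: nat
  assumes r: "r \<ge> 1" and n: "n > 0" and j: "j \<le> k" "j \<le> n - k" and k: "k \<le> n"
  shows "exp (real n * pair_rate r J (real k / real n) (real j / real n) - 2 * real r * ln (real n + 1))
    \<le> real (n choose k) * (exp (J * (real n - 4 * real j)) * real (k choose j) * real ((n - k) choose j)
      / real (n choose k)) ^ r"
proof -
  define a d where "a = real k / real n" and "d = real j / real n"
  have ad: "0 \<le> a" "0 \<le> d" "0 \<le> 1 - a" "0 \<le> a - d" "0 \<le> 1 - a - d"
  proof -
    have "real j + real k \<le> real n" using assms by linarith
    then have "(real j + real k) / real n \<le> 1" using n by simp
    then show "0 \<le> 1 - a - d" by (simp add: a_def d_def add_divide_distrib)
  qed (use assms in \<open>auto simp: a_def d_def field_simps of_nat_diff\<close>)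
  have eqs: "real k = real n * a" "real j = real n * d" "real (n - k) = real n * (1 - a)"
    "real (k - j) = real n * (a - d)" "real (n - k - j) = real n * (1 - a - d)" "real n = real n * 1"
    using assms by (auto simp: a_def d_def field_simps of_nat_diff)
  have C: "real (n choose k) > 0" "real (k choose j) > 0" "real ((n - k) choose j) > 0"
    using assms by auto
  let ?x = "\<lambda>m :: nat. xlnx (real m)"
  \<comment> \<open>The multiples of \<open>ln n\<close> that appear when \<open>xlnx\<close> is rescaled cancel.\<close>
  have rate: "real n * pair_rate r J a d = (1 - real r) * ?x n + (2 * real r - 1) * (?x k + ?x (n - k))
     - real r * (2 * ?x j + ?x (k - j) + ?x (n - k - j)) + real r * J * (real n - 4 * real j)"
    using n ad unfolding eqs(1-5)
    by (simp only: xlnx_scale of_nat_0_less_iff) (simp add: pair_rate_def xlnx_def algebra_simps)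
  have "real (n choose k) * (exp (J * (real n - 4 * real j)) * real (k choose j) * real ((n - k) choose j)
      / real (n choose k)) ^ r
    = exp (ln (real (n choose k)) + real r * (J * (real n - 4 * real j) + ln (real (k choose j))
        + ln (real ((n - k) choose j)) - ln (real (n choose k))))"
    using C by (simp add: exp_add exp_diff exp_of_nat_mult)
  moreover have "real n * pair_rate r J a d - 2 * real r * ln (real n + 1)
    \<le> ln (real (n choose k)) + real r * (J * (real n - 4 * real j) + ln (real (k choose j))
        + ln (real ((n - k) choose j)) - ln (real (n choose k)))"
  proof -
    let ?l = "ln (real n + 1)"
    have 1: "(real r - 1) * ln (real (n choose k)) \<le> (real r - 1) * (?x n - ?x k - ?x (n - k))"
      using ln_binomial_bounds(1)[OF k] r by (intro mult_left_mono) auto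
    have "ln (real k + 1) \<le> ?l" "ln (real (n - k) + 1) \<le> ?l" using k by auto
    then have "?x k - ?x j - ?x (k - j) - ?l \<le> ln (real (k choose j))"
      "?x (n - k) - ?x j - ?x (n - k - j) - ?l \<le> ln (real ((n - k) choose j))"
      using ln_binomial_bounds(2)[OF j(1)] ln_binomial_bounds(2)[OF j(2)] by linarith+
    then have "real r * (?x k - ?x j - ?x (k - j) - ?l + (?x (n - k) - ?x j - ?x (n - k - j) - ?l))
      \<le> real r * (ln (real (k choose j)) + ln (real ((n - k) choose j)))"
      by (intro mult_left_mono add_mono) auto
    with 1 show ?thesis unfolding rate by (simp add: algebra_simps)
  qed
  ultimately show ?thesis by (simp add: a_def d_def)
qed

lemma exp_J_uniq:
  assumes r: "r \<ge> 2" and J: "J > J_uniq r"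
  shows "real r < (real r - 1) * exp (2 * J)"
proof -
  have "(1 + 1 / (2 * real r - 1)) / (1 - 1 / (2 * real r - 1)) = real r / (real r - 1)"
  proof -
    define x where "x = 2 * real r - 1"
    have x: "x > 1" using r by (simp add: x_def)
    have "(1 + 1 / x) / (1 - 1 / x) = (x + 1) / (x - 1)" using x by (simp add: field_simps)
    also have "\<dots> = real r / (real r - 1)" using r by (simp add: x_def field_simps)
    finally show ?thesis by (simp add: x_def)
  qed
  then have "J_uniq r = ln (real r / (real r - 1)) / 2"
    by (simp add: J_uniq_def artanh_def)
  then have "ln (real r / (real r - 1)) < 2 * J" using J by simp
  then have "exp (ln (real r / (real r - 1))) < exp (2 * J)" by simp
  then show ?thesis using r by (simp add: field_simps)
qed

lemma pair_rate_half:
  fixes J :: real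
  defines "d \<equiv> ising_beta J 0 / 2"
  shows "pair_rate r J (1 / 2) d = balanced_pressure r J"
proof -
  define E where "E = exp (2 * J)"
  have E: "E > 0" "ln E = 2 * J" by (simp_all add: E_def)
  have d: "d = 1 / (2 * (E + 1))" by (simp add: d_def ising_beta_def E_def)
  have d': "1 / 2 - d = E / (2 * (E + 1))" "1 - 1 / 2 - d = E / (2 * (E + 1))"
    using E by (auto simp: d field_simps)
  have cosh: "ln (2 * cosh J) = ln (E + 1) - J"
  proof -
    have "2 * cosh J = (E + 1) * exp (- J)"
      by (simp add: cosh_def E_def algebra_simps flip: exp_add)
    then show ?thesis using E by (simp add: ln_mult_pos add_pos_pos)
  qed
  have ln2E: "ln (2 * (E + 1)) = ln 2 + ln (E + 1)" using E by (intro ln_mult_pos) auto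
  have "ln d = - ln (2 * (E + 1))" unfolding d using E by (simp only: ln_div) simp
  then have x1: "xlnx d = d * (- ln 2 - ln (E + 1))" unfolding xlnx_def ln2E by simp
  have x2: "xlnx (1 / 2 - d) = (1 / 2 - d) * (2 * J - ln 2 - ln (E + 1))"
  proof -
    have "ln (E / (2 * (E + 1))) = ln E - ln (2 * (E + 1))" using E by (intro ln_divide_pos) auto
    then show ?thesis unfolding xlnx_def d'(1) ln2E by (simp add: E)
  qed
  have x3: "xlnx (1 - 1 / 2 - d) = (1 / 2 - d) * (2 * J - ln 2 - ln (E + 1))"
    using x2 by simp
  have x4: "xlnx (1 / 2) = - (1 / 2) * ln 2" "xlnx (1 - 1 / 2) = - (1 / 2) * ln 2"
    by (simp_all add: xlnx_def ln_div)
  show ?thesis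
    unfolding pair_rate_def x1 x2 x3 x4 balanced_pressure_def cosh by (simp add: field_simps)
qed

text \<open>
  Take for \<open>d\<close> half the flip probability \<open>1 / (exp (2 J) + 1)\<close> of the free boundary state. At \<open>a = 1/2\<close>
  the rate is the balanced pressure. As a function of \<open>a\<close> it is stationary there, by symmetry, and its
  second derivative is \<open>4 ((r - 1) - r exp (- 2 J))\<close>, which is positive exactly when
  \<open>tanh J > 1 / (2 r - 1)\<close>. Hence the rate is larger for \<open>a\<close> slightly above \<open>1/2\<close>.
\<close>

lemma exists_pair_rate_greater:
  assumes r: "r \<ge> 2" and J: "J > J_uniq r"
  shows "\<exists>a d. 0 < d \<and> d < a \<and> d < 1 - a \<and> balanced_pressure r J < pair_rate r J a d"
proof -
  define E where "E = exp (2 * J)"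
  define d where "d = ising_beta J 0 / 2"
  have E: "E > 0" by (simp add: E_def)
  have d_eq: "d = 1 / (2 * (E + 1))" by (simp add: d_def ising_beta_def E_def)
  have d: "0 < d" "d < 1 / 2" using E by (auto simp: d_eq field_simps)
  define D where "D a = (2 * real r - 1) * (ln a - ln (1 - a)) - real r * (ln (a - d) - ln (1 - a - d))" for a
  have D_half: "D (1 / 2) = 0" by (simp add: D_def)
  have deriv: "((\<lambda>a. pair_rate r J a d) has_real_derivative D a) (at a)" if "d < a" "a < 1 - d" for a
    unfolding pair_rate_def D_def
    by (rule derivative_eq_intros DERIV_chain2[OF DERIV_xlnx] refl | use that d in \<open>simp add: algebra_simps\<close>)+
  let ?D2 = "(2 * real r - 1) * (1 / (1 / 2) + 1 / (1 / 2)) - real r * (1 / (1 / 2 - d) + 1 / (1 / 2 - d))"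
  have "(D has_real_derivative ?D2) (at (1 / 2))"
    unfolding D_def[abs_def] by (rule derivative_eq_intros refl | use d in \<open>simp add: algebra_simps\<close>)+
  moreover have "?D2 > 0"
  proof -
    have "1 / 2 - d = E / (2 * (E + 1))" using E by (simp add: d_eq field_simps)
    then have "?D2 = (2 * real r - 1) * 4 - real r * (4 * (E + 1) / E)" by simp
    also have "\<dots> = 4 * ((real r - 1) * E - real r) / E" using E by (simp add: field_simps)
    also have "\<dots> > 0" using E exp_J_uniq[OF r J] by (simp add: E_def)
    finally show ?thesis .
  qed
  ultimately obtain s where s: "s > 0" "\<And>h. 0 < h \<Longrightarrow> h < s \<Longrightarrow> D (1 / 2) < D (1 / 2 + h)"
    using DERIV_pos_inc_right by blast
  define h where "h = min s (1 / 2 - d) / 2"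
  have h: "0 < h" "h < s" "h < 1 / 2 - d" using s(1) d by (auto simp: h_def)
  have "pair_rate r J (1 / 2) d < pair_rate r J (1 / 2 + h) d"
  proof (rule DERIV_pos_imp_increasing_open[where f = "\<lambda>a. pair_rate r J a d"])
    show "1 / 2 < 1 / 2 + h" using h by simp
    fix a :: real assume a: "1 / 2 < a" "a < 1 / 2 + h"
    have "D (1 / 2) < D (1 / 2 + (a - 1 / 2))" by (rule s(2)) (use a h in auto)
    then have "D a > 0" by (simp add: D_half)
    then show "\<exists>y. ((\<lambda>a. pair_rate r J a d) has_real_derivative y) (at a) \<and> 0 < y"
      using deriv[of a] a d h by (intro exI[of _ "D a"]) auto
  next
    show "continuous_on {1 / 2..1 / 2 + h} (\<lambda>a. pair_rate r J a d)"
    proof (rule continuous_at_imp_continuous_on, rule ballI)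
      fix a assume "a \<in> {1 / 2..1 / 2 + h}"
      then show "isCont (\<lambda>a. pair_rate r J a d) a"
        using d h by (intro DERIV_isCont[OF deriv]) auto
    qed
  qed
  then show ?thesis
    using d h pair_rate_half[of r J] by (intro exI[of _ "1 / 2 + h"] exI[of _ d]) (auto simp: d_def)
qed

lemma pair_sum_ge:
  assumes r: "r \<ge> 1" and ad: "0 < d" "d < a" "d < 1 - a" and B: "B < pair_rate r J a d"
  shows "\<forall>\<^sub>F n in sequentially. \<exists>k j. k \<le> n \<and> exp (real n * B)
    \<le> real (n choose k) * (exp (J * (real n - 4 * real j)) * real (k choose j) * real ((n - k) choose j)
      / real (n choose k)) ^ r"
proof -
  define k where "k n = nat \<lfloor>a * real n\<rfloor>" for n
  define j where "j n = nat \<lfloor>d * real n\<rfloor>" for n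
  have a: "a < 1" "a > 0" using ad by auto
  have k_lim: "(\<lambda>n. real (k n) / real n) \<longlonglongrightarrow> a" and j_lim: "(\<lambda>n. real (j n) / real n) \<longlonglongrightarrow> d"
    using ad unfolding k_def j_def by real_asymp+
  have "(\<lambda>n. pair_rate r J (real (k n) / real n) (real (j n) / real n)) \<longlonglongrightarrow> pair_rate r J a d"
    unfolding pair_rate_def
    by (intro tendsto_intros isCont_tendsto_compose[OF isCont_xlnx] k_lim j_lim) (use ad in auto)
  then have "(\<lambda>n. pair_rate r J (real (k n) / real n) (real (j n) / real n)
      - 2 * real r * ln (real n + 1) / real n) \<longlonglongrightarrow> pair_rate r J a d - 0"
    by (intro tendsto_diff ln_over_n_tendsto)
  then have "\<forall>\<^sub>F n in sequentially. B < pair_rate r J (real (k n) / real n) (real (j n) / real n)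
      - 2 * real r * ln (real n + 1) / real n"
    by (rule order_tendstoD(1)) (use B in simp)
  moreover have "\<forall>\<^sub>F n in sequentially. 0 < real (k n) / real n - real (j n) / real n"
    by (rule order_tendstoD(1)[OF tendsto_diff[OF k_lim j_lim]]) (use ad in simp)
  moreover have "\<forall>\<^sub>F n in sequentially. 0 < 1 - real (k n) / real n - real (j n) / real n"
    by (rule order_tendstoD(1)[OF tendsto_diff[OF tendsto_diff[OF tendsto_const k_lim] j_lim]])
      (use ad in simp)
  ultimately show ?thesis
    using eventually_gt_at_top[of 0]
  proof eventually_elim
    case (elim n)
    have "real (j n) / real n < real (k n) / real n" "(real (j n) + real (k n)) / real n < 1"
      unfolding add_divide_distrib using elim by linarith+
    then have jk: "j n \<le> k n" "real (j n) + real (k n) < real n"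
      using elim(4) by (simp_all add: divide_less_cancel divide_less_eq)
    then have kn: "k n \<le> n" "j n \<le> n - k n" by linarith+
    have "real n * B \<le> real n * (pair_rate r J (real (k n) / real n) (real (j n) / real n)
        - 2 * real r * ln (real n + 1) / real n)"
      using elim by (intro mult_left_mono) auto
    also have "\<dots> = real n * pair_rate r J (real (k n) / real n) (real (j n) / real n)
        - 2 * real r * ln (real n + 1)"
      using elim by (simp add: field_simps)
    finally have "exp (real n * B) \<le> exp \<dots>" by simp
    also note pair_term_ge[OF r elim(4) jk(1) kn(2,1)]
    finally show ?case using kn by blast
  qed
qed

section \<open>The Cayley tree as a rooted tree\<close>

text \<open>
  The Cayley tree is rooted at the identity. The parent of a reduced word is obtained by deleting its
  first letter; the root is its own parent.
\<close>

definition parent :: "'r fword \<Rightarrow> 'r fword" where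
  "parent g = Abs_fword (tl (Rep_fword g))"

text \<open>
  The distance from the root.
\<close>

definition depth :: "'r fword \<Rightarrow> nat" where
  "depth g = length (Rep_fword g)"

lemma reduced_Rep [simp]: "reduced (Rep_fword g)"
  using Rep_fword by auto

lemma Rep_parent: "Rep_fword (parent g) = tl (Rep_fword g)"
proof -
  have "reduced (tl (Rep_fword g))"
    using reduced_Rep[of g] by (cases "Rep_fword g") (auto dest: reduced_tl)
  then show ?thesis by (simp add: parent_def Abs_fword_inverse)
qed

lemma Rep_fone: "Rep_fword fone = []"
  by (rule fone.rep_eq)

lemma Rep_eq_Nil_iff: "Rep_fword g = [] \<longleftrightarrow> g = fone"
  by (metis Rep_fone Rep_fword_inject)

lemma depth_parent: "g \<noteq> fone \<Longrightarrow> depth g = Suc (depth (parent g))"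
  using Rep_eq_Nil_iff[of g] by (cases "Rep_fword g") (auto simp: depth_def Rep_parent)

lemma parent_induct [case_names one parent]:
  assumes "P fone" "\<And>g. g \<noteq> fone \<Longrightarrow> P (parent g) \<Longrightarrow> P g"
  shows "P g"
proof (induction "depth g" arbitrary: g)
  case 0
  then have "g = fone" using depth_parent by force
  then show ?case using assms by simp
next
  case (Suc n)
  then have "g \<noteq> fone" by (auto simp: depth_def Rep_fone)
  with Suc(1)[of "parent g"] Suc(2) depth_parent[of g] show ?case by (auto intro: assms(2))
qed

lemma Rep_letter_mult: "Rep_fword (fmult (letter a) g) = push a (Rep_fword g)"
  by (simp add: fmult.rep_eq letter.rep_eq)

lemma cayley_adj_iff_letter: "cayley_adj g h \<longleftrightarrow> (\<exists>a. h = fmult (letter a) g)"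
proof -
  interpret group "free_group :: 'a fword monoid" by (rule group_free_group)
  have "g = gen i \<otimes>\<^bsub>free_group\<^esub> h \<longleftrightarrow> h = gen_inv i \<otimes>\<^bsub>free_group\<^esub> g" for i
    unfolding gen_inv_eq using inv_solve_left'[of "gen i" h g] inv_solve_left[of h "gen i" g]
    by (auto simp: free_group_def)
  then have "cayley_adj g h \<longleftrightarrow> (\<exists>i. h = fmult (gen i) g \<or> h = fmult (gen_inv i) g)"
    by (simp add: cayley_adj_def free_group_def)
  also have "\<dots> \<longleftrightarrow> (\<exists>a. h = fmult (letter a) g)"
    unfolding gen_def gen_inv_def by (metis (full_types) prod.exhaust)
  finally show ?thesis .
qed

lemma cayley_adj_iff_parent:
  "cayley_adj g h \<longleftrightarrow> (h \<noteq> fone \<and> parent h = g) \<or> (g \<noteq> fone \<and> parent g = h)"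
proof
  assume "cayley_adj g h"
  then obtain a where "h = fmult (letter a) g" by (auto simp: cayley_adj_iff_letter)
  then have a: "Rep_fword h = push a (Rep_fword g)" by (simp add: Rep_letter_mult)
  show "(h \<noteq> fone \<and> parent h = g) \<or> (g \<noteq> fone \<and> parent g = h)"
  proof (cases "Rep_fword h = a # Rep_fword g")
    case True
    then have "h \<noteq> fone" "Rep_fword (parent h) = Rep_fword g" by (auto simp: Rep_fone Rep_parent)
    then show ?thesis by (simp add: Rep_fword_inject)
  next
    case False
    then obtain w where w: "Rep_fword g = inv_letter a # w" "Rep_fword h = w"
      using a by (cases "Rep_fword g") (auto split: if_splits)
    then have "g \<noteq> fone" "Rep_fword (parent g) = Rep_fword h" by (auto simp: Rep_fone Rep_parent)
    then show ?thesis by (simp add: Rep_fword_inject)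
  qed
next
  have up: "\<exists>a. g = fmult (letter a) (parent g) \<and> parent g = fmult (letter (inv_letter a)) g"
    if "g \<noteq> fone" for g :: "'a fword"
  proof -
    obtain a w where w: "Rep_fword g = a # w" using \<open>g \<noteq> fone\<close> Rep_eq_Nil_iff[of g] by (cases "Rep_fword g") auto
    then have "reduced (a # w)" using reduced_Rep[of g] by simp
    then have "push a w = a # w" by (cases w) auto
    then have "Rep_fword g = Rep_fword (fmult (letter a) (parent g))"
      "Rep_fword (parent g) = Rep_fword (fmult (letter (inv_letter a)) g)"
      by (simp_all add: Rep_letter_mult Rep_parent w)
    then show ?thesis unfolding Rep_fword_inject by blast
  qed
  assume "(h \<noteq> fone \<and> parent h = g) \<or> (g \<noteq> fone \<and> parent g = h)"
  then show "cayley_adj g h"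
    unfolding cayley_adj_iff_letter using up by metis
qed

lemma cayley_adj_sym: "cayley_adj g h \<longleftrightarrow> cayley_adj h g"
  by (auto simp: cayley_adj_iff_parent)

text \<open>
  The subtree below \<open>h\<close>, including \<open>h\<close> itself.
\<close>

definition descendants :: "'r fword \<Rightarrow> 'r fword set" where
  "descendants h = {k. \<exists>u. Rep_fword k = u @ Rep_fword h}"

lemma descendants_parent:
  assumes "h \<noteq> fone"
  shows "k \<in> descendants h \<longleftrightarrow> k = h \<or> (k \<noteq> fone \<and> parent k \<in> descendants h)"
proof
  assume "k \<in> descendants h"
  then obtain u where u: "Rep_fword k = u @ Rep_fword h" by (auto simp: descendants_def)
  show "k = h \<or> (k \<noteq> fone \<and> parent k \<in> descendants h)"
  proof (cases u)
    case Nil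
    with u show ?thesis by (simp add: Rep_fword_inject)
  next
    case (Cons a v)
    with u show ?thesis by (auto simp: descendants_def Rep_parent Rep_fone)
  qed
next
  assume "k = h \<or> (k \<noteq> fone \<and> parent k \<in> descendants h)"
  then show "k \<in> descendants h"
  proof
    assume "k \<noteq> fone \<and> parent k \<in> descendants h"
    then obtain u where u: "tl (Rep_fword k) = u @ Rep_fword h" "Rep_fword k \<noteq> []"
      by (auto simp: descendants_def Rep_parent Rep_eq_Nil_iff)
    then have "Rep_fword k = (hd (Rep_fword k) # u) @ Rep_fword h"
      by (metis append_Cons list.collapse)
    then show ?thesis unfolding descendants_def by blast
  qed (auto simp: descendants_def)
qed

lemma edge_side_disjoint_descendants:
  assumes h: "h \<noteq> fone"
  shows "edge_side (parent h) h \<inter> descendants h = {}"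
proof -
  let ?R = "\<lambda>a b. cayley_adj a b \<and> {a, b} \<noteq> {parent h, h}"
  have "k \<notin> descendants h" if "?R\<^sup>*\<^sup>* (parent h) k" for k
    using that
  proof (induction rule: rtranclp_induct)
    case base
    show ?case
    proof
      assume "parent h \<in> descendants h"
      then have "depth h \<le> depth (parent h)" by (auto simp: descendants_def depth_def)
      with depth_parent[OF h] show False by simp
    qed
  next
    case (step a b)
    show ?case
    proof
      assume b: "b \<in> descendants h"
      from step(2) consider "b \<noteq> fone" "parent b = a" | "a \<noteq> fone" "parent a = b"
        by (auto simp: cayley_adj_iff_parent)
      then show False
      proof cases
        case 1
        with b step(3) have "b = h" using descendants_parent[OF h, of b] by auto
        with 1 step(2) show False by auto
      next
        case 2
        with b step(3) show False using descendants_parent[OF h, of a] by auto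
      qed
    qed
  qed
  then show ?thesis by (auto simp: edge_side_def)
qed

text \<open>The finite subtrees that contain the root are the finite sets that contain it and are closed under parents.\<close>

definition rooted_subtrees :: "'r fword set set" where
  "rooted_subtrees = {W. finite W \<and> fone \<in> W \<and> parent ` W \<subseteq> W}"

lemma parent_fone [simp]: "parent fone = fone"
  unfolding Rep_eq_Nil_iff[symmetric] by (simp add: Rep_parent Rep_fone)

lemma rooted_subtrees_Un: "W \<in> rooted_subtrees \<Longrightarrow> W' \<in> rooted_subtrees \<Longrightarrow> W \<union> W' \<in> rooted_subtrees"
  by (auto simp: rooted_subtrees_def)

lemma rooted_subtrees_cofinal:
  assumes "finite W"
  shows "\<exists>W'\<in>rooted_subtrees. W \<subseteq> W'"
  using assms
proof (induction W rule: finite_induct)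
  case empty
  have "{fone} \<in> rooted_subtrees" by (simp add: rooted_subtrees_def)
  then show ?case by blast
next
  case (insert g W)
  have "\<exists>T\<in>rooted_subtrees. g \<in> T" for g :: "'a fword"
  proof (induction g rule: parent_induct)
    case one
    have "{fone} \<in> rooted_subtrees" by (simp add: rooted_subtrees_def)
    then show ?case by blast
  next
    case (parent g)
    then obtain T where "T \<in> rooted_subtrees" "parent g \<in> T" by blast
    then have "insert g T \<in> rooted_subtrees" by (auto simp: rooted_subtrees_def)
    then show ?case by blast
  qed
  then obtain T where "T \<in> rooted_subtrees" "g \<in> T" by blast
  moreover obtain W' where "W' \<in> rooted_subtrees" "W \<subseteq> W'" using insert by blast
  ultimately show ?case by (intro bexI[of _ "T \<union> W'"] rooted_subtrees_Un) auto
qed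

lemma rooted_subtree_subset_edge_side:
  assumes W: "W \<in> rooted_subtrees" and h: "h \<notin> W" "parent h \<in> W"
  shows "W \<subseteq> edge_side (parent h) h"
proof -
  let ?R = "\<lambda>a b. cayley_adj a b \<and> {a, b} \<noteq> {parent h, h}"
  have sym: "?R\<^sup>*\<^sup>* a b \<Longrightarrow> ?R\<^sup>*\<^sup>* b a" for a b
    by (rule sympD[OF symp_rtranclp]) (auto simp: symp_def cayley_adj_sym insert_commute)
  have root: "k \<in> W \<longrightarrow> ?R\<^sup>*\<^sup>* fone k" for k
  proof (induction k rule: parent_induct)
    case (parent k)
    show ?case
    proof
      assume k: "k \<in> W"
      then have pk: "parent k \<in> W" using W by (auto simp: rooted_subtrees_def)
      have "?R (parent k) k" using k pk h parent(1) by (auto simp: cayley_adj_iff_parent doubleton_eq_iff)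
      with parent(2) pk show "?R\<^sup>*\<^sup>* fone k"
        using rtranclp.rtrancl_into_rtrancl[of ?R fone "parent k" k] by blast
    qed
  qed simp
  show ?thesis
    using sym root h(2) unfolding edge_side_def by (blast intro: rtranclp_trans)
qed

section \<open>Uniqueness of the tree-indexed Markov chain\<close>

lemma cylinder_inter:
  "cylinder W \<eta> \<inter> cylinder W' \<eta>' = {} \<or> (\<exists>\<zeta>. cylinder W \<eta> \<inter> cylinder W' \<eta>' = cylinder (W \<union> W') \<zeta>)"
proof (rule disjCI)
  assume "\<nexists>\<zeta>. cylinder W \<eta> \<inter> cylinder W' \<eta>' = cylinder (W \<union> W') \<zeta>"
  show "cylinder W \<eta> \<inter> cylinder W' \<eta>' = {}"
  proof (rule ccontr)
    assume "\<not> ?thesis"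
    then obtain z where "z \<in> cylinder W \<eta>" "z \<in> cylinder W' \<eta>'" by blast
    then have "cylinder W \<eta> \<inter> cylinder W' \<eta>' = cylinder (W \<union> W') z"
      by (auto simp: cylinder_def)
    then show False using \<open>\<nexists>\<zeta>. _ = cylinder _ \<zeta>\<close> by blast
  qed
qed

lemma is_ising_chain_cylinder_insert:
  assumes \<mu>: "is_ising_chain J t \<mu>" and W: "W \<in> rooted_subtrees" and h: "h \<notin> W" "parent h \<in> W"
  shows "measure \<mu> (cylinder (insert h W) \<eta>)
    = trans_prob J t (\<eta> (parent h)) (\<eta> h) * measure \<mu> (cylinder W \<eta>)"
proof -
  have bp: "\<mu> \<in> borel_probs" using \<mu> by (simp add: is_ising_chain_def)
  interpret prob_space \<mu> using borel_probsD(1)[OF bp] .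
  have h1: "h \<noteq> fone" and fin: "finite W" using W h by (auto simp: rooted_subtrees_def)
  have cyl: "cylinder V \<eta> \<in> sets \<mu>" if "finite V" for V
    using clopen_borel[OF clopen_cylinder[OF that]] borel_probsD(2)[OF bp] by blast
  show ?thesis
  proof (cases "measure \<mu> (cylinder W \<eta>) = 0")
    case True
    have "measure \<mu> (cylinder (insert h W) \<eta>) \<le> measure \<mu> (cylinder W \<eta>)"
      using fin by (intro finite_measure_mono cyl) (auto simp: cylinder_def)
    with True show ?thesis by (simp add: measure_le_0_iff)
  next
    case False
    have eq: "{x \<in> space \<mu>. \<forall>k\<in>W. x k = \<eta> k} = cylinder W \<eta>"
      "{x \<in> space \<mu>. x h = \<eta> h \<and> (\<forall>k\<in>W. x k = \<eta> k)} = cylinder (insert h W) \<eta>"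
      by (auto simp: cylinder_def borel_probsD(3)[OF bp])
    have "cayley_adj (parent h) h" using h1 by (simp add: cayley_adj_iff_parent)
    moreover have "\<P>(x in \<mu>. \<forall>k\<in>W. x k = \<eta> k) > 0"
      unfolding eq using False by (simp add: zero_less_measure_iff)
    ultimately have "\<P>(x in \<mu>. x h = \<eta> h \<bar> \<forall>k\<in>W. x k = \<eta> k) = trans_prob J t (\<eta> (parent h)) (\<eta> h)"
      using \<mu> fin h rooted_subtree_subset_edge_side[OF W h] unfolding is_ising_chain_def by blast
    then show ?thesis
      unfolding cond_prob_def eq using False by (simp add: field_simps)
  qed
qed

lemma rooted_subtrees_induct [consumes 1, case_names root insert]:
  assumes "W \<in> rooted_subtrees"
    and root: "P {fone}"
    and ins: "\<And>h W. W \<in> rooted_subtrees \<Longrightarrow> h \<notin> W \<Longrightarrow> parent h \<in> W \<Longrightarrow> P W \<Longrightarrow> P (insert h W)"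
  shows "P W"
  using assms(1)
proof (induction "card W" arbitrary: W)
  case 0
  then show ?case by (auto simp: rooted_subtrees_def)
next
  case (Suc n)
  then have W: "finite W" "fone \<in> W" "\<And>k. k \<in> W \<Longrightarrow> parent k \<in> W" by (auto simp: rooted_subtrees_def)
  obtain h where h: "h \<in> W" "\<And>k. k \<in> W \<Longrightarrow> depth k \<le> depth h"
    using finite_imageI[OF W(1), of depth] W(2) Max_in[of "depth ` W"] Max_ge[of "depth ` W"]
    by (metis empty_iff image_iff imageI)
  show ?case
  proof (cases "h = fone")
    case True
    then have "k = fone" if "k \<in> W" for k
      using h(2)[OF that] depth_parent[of k] by (auto simp: depth_def Rep_fone)
    then have "W = {fone}" using W(2) by blast
    then show ?thesis using root by simp
  next
    case False
    let ?V = "W - {h}"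
    have pk: "parent k \<noteq> h" if "k \<in> W" for k
      using h(2)[OF that] depth_parent[of k] False by (cases "k = fone") auto
    then have V: "?V \<in> rooted_subtrees" using W False by (auto simp: rooted_subtrees_def)
    moreover have "parent h \<in> ?V" using W(3)[OF h(1)] pk[OF h(1)] by simp
    moreover have "n = card ?V" using Suc(2) h(1) W(1) by simp
    ultimately have "P (insert h ?V)" using Suc(1) ins[of ?V h] by blast
    then show ?thesis using h(1) by (simp add: insert_absorb)
  qed
qed

text \<open>
  The Markov property determines the probability of a cylinder over a finite rooted subtree, one leaf at
  a time, and these cylinders generate the Borel sets.
\<close>

lemma is_ising_chain_unique:
  fixes \<mu> \<nu> :: "('r::finite) config measure"
  assumes \<mu>: "is_ising_chain J t \<mu>" and \<nu>: "is_ising_chain J t \<nu>"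
  shows "\<mu> = \<nu>"
proof -
  have bp: "\<mu> \<in> borel_probs" "\<nu> \<in> borel_probs" using \<mu> \<nu> by (auto simp: is_ising_chain_def)
  interpret M: prob_space \<mu> using borel_probsD(1)[OF bp(1)] .
  interpret N: prob_space \<nu> using borel_probsD(1)[OF bp(2)] .
  have site: "measure \<rho> (cylinder {fone} \<eta>) = site_prob J t (\<eta> fone)"
    if \<rho>: "is_ising_chain J t \<rho>" for \<rho> :: "'r config measure" and \<eta>
  proof -
    have "\<rho> \<in> borel_probs" using \<rho> by (simp add: is_ising_chain_def)
    then have "cylinder {fone} \<eta> = {x \<in> space \<rho>. x fone = \<eta> fone}"
      by (auto simp: cylinder_def borel_probsD(3))
    then show ?thesis using \<rho> by (simp add: is_ising_chain_def)
  qed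
  have eq: "measure \<mu> (cylinder W \<eta>) = measure \<nu> (cylinder W \<eta>)" if "W \<in> rooted_subtrees" for W \<eta>
    using that
  proof (induction W rule: rooted_subtrees_induct)
    case root
    show ?case by (simp add: site \<mu> \<nu>)
  next
    case (insert h W)
    then show ?case
      by (simp add: is_ising_chain_cylinder_insert[OF \<mu>] is_ising_chain_cylinder_insert[OF \<nu>])
  qed
  let ?C = "{cylinder W \<eta> | W \<eta>. W \<in> (rooted_subtrees :: 'r fword set set)}"
  have fin: "finite W" if "W \<in> rooted_subtrees" for W :: "'r fword set"
    using that by (simp add: rooted_subtrees_def)
  have "sigma_sets UNIV ?C = sets borel"
    by (rule sigma_sets_cylinders[OF fin rooted_subtrees_cofinal])
  moreover have "sigma_sets UNIV (insert {} ?C) = sigma_sets UNIV ?C"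
  proof
    show "sigma_sets UNIV (insert {} ?C) \<subseteq> sigma_sets UNIV ?C"
      by (rule sigma_sets_mono) (intro insert_subsetI sigma_sets.Empty sigma_sets_superset_generator)
  qed (rule sigma_sets_mono', blast)
  ultimately have gen: "sigma_sets UNIV (insert {} ?C) = sets borel" by simp
  have root: "{fone :: 'r fword} \<in> rooted_subtrees" by (simp add: rooted_subtrees_def)
  show ?thesis
  proof (rule measure_eqI_generator_eq_countable[where E = "insert {} ?C" and \<Omega> = UNIV
        and A = "{cylinder {fone} (\<lambda>_. Plus), cylinder {fone} (\<lambda>_. Minus)}"])
    show "Int_stable (insert {} ?C)"
    proof (rule Int_stableI)
      fix a b assume "a \<in> insert {} ?C" "b \<in> insert {} ?C"
      then consider "a \<inter> b = {}" | W \<eta> W' \<eta>' where "a = cylinder W \<eta>" "b = cylinder W' \<eta>'"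
        "W \<in> rooted_subtrees" "W' \<in> rooted_subtrees" by blast
      then show "a \<inter> b \<in> insert {} ?C"
      proof cases
        case 2
        then show ?thesis using cylinder_inter[of W \<eta> W' \<eta>'] rooted_subtrees_Un[of W W'] by blast
      qed simp
    qed
    show "emeasure \<mu> X = emeasure \<nu> X" if "X \<in> insert {} ?C" for X
      using that eq by (auto simp: M.emeasure_eq_measure N.emeasure_eq_measure)
    show "{cylinder {fone} (\<lambda>_. Plus), cylinder {fone} (\<lambda>_. Minus)} \<subseteq> insert {} ?C"
      using root by blast
    show "\<Union>{cylinder {fone} (\<lambda>_. Plus), cylinder {fone} (\<lambda>_. Minus)} = (UNIV :: 'r config set)"
      using UNIV_spin by (auto simp: cylinder_def)
    show "sets \<mu> = sigma_sets UNIV (insert {} ?C)" "sets \<nu> = sigma_sets UNIV (insert {} ?C)"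
      unfolding gen by (simp_all add: borel_probsD(2) bp)
  qed (simp_all add: M.emeasure_eq_measure)
qed

section \<open>Existence of the free boundary state\<close>

text \<open>
  Independent random bits. The bit at the root tells whether the root has a plus spin, with probability
  \<open>1/2\<close>; the bit at any other vertex tells whether the spin flips along the edge to its parent, with
  probability \<open>\<beta>\<close>.
\<close>

definition flip_law :: "real \<Rightarrow> ('r fword \<Rightarrow> bool) measure" where
  "flip_law \<beta> = PiM UNIV (\<lambda>g. measure_pmf (bernoulli_pmf (if g = fone then 1 / 2 else \<beta>)))"

text \<open>
  The parity of the number of set bits on the path from the root to a vertex, and the configuration in
  which odd parity is a plus spin.
\<close>

primrec word_parity :: "('r fword \<Rightarrow> bool) \<Rightarrow> ('r \<times> bool) list \<Rightarrow> bool" where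
  "word_parity E [] = E fone"
| "word_parity E (a # w) = (word_parity E w \<noteq> E (Abs_fword (a # w)))"

definition parity :: "('r fword \<Rightarrow> bool) \<Rightarrow> 'r fword \<Rightarrow> bool" where
  "parity E g = word_parity E (Rep_fword g)"

definition spins :: "('r fword \<Rightarrow> bool) \<Rightarrow> 'r config" where
  "spins E g = (if parity E g then Plus else Minus)"

lemma parity_fone [simp]: "parity E fone = E fone"
  by (simp add: parity_def Rep_fone)

lemma parity_parent: "g \<noteq> fone \<Longrightarrow> parity E g = (parity E (parent g) \<noteq> E g)"
  unfolding parity_def Rep_parent using Rep_fword_inverse[of g]
  by (cases "Rep_fword g") (auto simp: Rep_eq_Nil_iff)

lemma space_flip_law [simp]: "space (flip_law \<beta>) = UNIV"
  by (simp add: flip_law_def space_PiM PiE_UNIV_domain)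

lemma prob_space_flip_law: "prob_space (flip_law \<beta>)"
  unfolding flip_law_def by (intro prob_space_PiM) (rule measure_pmf.prob_space_axioms)

lemma measurable_flip [measurable]: "(\<lambda>E. E g) \<in> flip_law \<beta> \<rightarrow>\<^sub>M count_space UNIV"
proof -
  have "(\<lambda>E. E g) \<in> flip_law \<beta> \<rightarrow>\<^sub>M measure_pmf (bernoulli_pmf (if g = fone then 1 / 2 else \<beta>))"
    unfolding flip_law_def by (rule measurable_component_singleton) simp
  then show ?thesis by simp
qed

lemma measurable_into_flip_law:
  assumes "\<And>g. (\<lambda>x. f x g) \<in> M \<rightarrow>\<^sub>M count_space UNIV"
  shows "f \<in> M \<rightarrow>\<^sub>M flip_law \<beta>"
  unfolding flip_law_def by (rule measurable_PiM_single') (use assms in auto)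

lemma measurable_parity [measurable]: "(\<lambda>E. parity E g) \<in> flip_law \<beta> \<rightarrow>\<^sub>M count_space UNIV"
proof (induction g rule: parent_induct)
  case one
  show ?case by simp
next
  case (parent g)
  have "(\<lambda>E. \<not> (parity E (parent g) \<longleftrightarrow> E g)) \<in> flip_law \<beta> \<rightarrow>\<^sub>M count_space UNIV"
    using parent(2) by measurable
  then show ?case using parent(1) by (simp add: parity_parent)
qed

lemma measurable_spins [measurable]: "spins \<in> flip_law \<beta> \<rightarrow>\<^sub>M (borel :: ('r::finite) config measure)"
proof -
  have "(\<lambda>E. spins E g) \<in> flip_law \<beta> \<rightarrow>\<^sub>M (borel :: spin measure)" for g :: "'r fword"
  proof -
    have "(\<lambda>E. if parity E g then Plus else Minus) \<in> flip_law \<beta> \<rightarrow>\<^sub>M (borel :: spin measure)"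
      by measurable
    then show ?thesis by (simp add: spins_def)
  qed
  then have "spins \<in> flip_law \<beta> \<rightarrow>\<^sub>M (PiM UNIV (\<lambda>_. borel) :: 'r config measure)"
    by (intro measurable_PiM_single') auto
  then show ?thesis
    using measurable_cong_sets[OF refl sets_PiM_equal_borel] by blast
qed

text \<open>The bit at \<open>h\<close> is independent of the others, so it may be drawn again.\<close>

lemma measure_flip_law_resample:
  fixes h :: "'r fword"
  assumes A: "A \<in> sets (flip_law \<beta>)"
  defines "p \<equiv> \<lambda>b. pmf (bernoulli_pmf (if h = fone then 1 / 2 else \<beta>)) b"
  shows "measure (flip_law \<beta>) A = p True * measure (flip_law \<beta>) {E. E(h := True) \<in> A}
    + p False * measure (flip_law \<beta>) {E. E(h := False) \<in> A}"
proof -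
  let ?M = "\<lambda>g :: 'r fword. measure_pmf (bernoulli_pmf (if g = fone then 1 / 2 else \<beta>))"
  let ?F = "flip_law \<beta> :: ('r fword \<Rightarrow> bool) measure"
  let ?u = "\<lambda>(x, E). E(h := x)"
  interpret F: prob_space ?F by (rule prob_space_flip_law)
  interpret P: pair_prob_space "?M h" ?F
    by (intro pair_prob_space.intro pair_sigma_finite.intro F.prob_space_axioms
      measure_pmf.prob_space_axioms measure_pmf.sigma_finite_measure_axioms F.sigma_finite_measure_axioms)
  have law: "distr (?M h \<Otimes>\<^sub>M ?F) ?F ?u = ?F"
    unfolding flip_law_def
    using distr_pair_PiM_eq_PiM[of UNIV ?M h] by (simp add: measure_pmf.prob_space_axioms)
  have upd: "(\<lambda>E. E(h := x)) \<in> ?F \<rightarrow>\<^sub>M ?F" for x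
  proof (rule measurable_into_flip_law)
    show "(\<lambda>E. (E(h := x)) g) \<in> ?F \<rightarrow>\<^sub>M count_space UNIV" for g by (cases "g = h") simp_all
  qed
  have u: "?u \<in> ?M h \<Otimes>\<^sub>M ?F \<rightarrow>\<^sub>M ?F"
    unfolding flip_law_def using measurable_fun_upd[of UNIV UNIV h] by measurable
  have S: "{E. E(h := x) \<in> A} \<in> sets ?F" for x
    using measurable_sets[OF upd A, of x] by (simp add: vimage_def)
  let ?B = "\<lambda>x. {x} \<times> {E. E(h := x) \<in> A}"
  have pre: "?u -` A \<inter> space (?M h \<Otimes>\<^sub>M ?F) = ?B True \<union> ?B False"
    by (auto simp: space_pair_measure) (metis (full_types))+
  have "measure ?F A = measure (distr (?M h \<Otimes>\<^sub>M ?F) ?F ?u) A" by (simp only: law)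
  also have "\<dots> = measure (?M h \<Otimes>\<^sub>M ?F) (?B True \<union> ?B False)"
    using measure_distr[OF u A] pre by simp
  also have "\<dots> = measure (?M h \<Otimes>\<^sub>M ?F) (?B True) + measure (?M h \<Otimes>\<^sub>M ?F) (?B False)"
    by (intro P.finite_measure_Union pair_measureI S) auto
  also have "\<dots> = p True * measure ?F {E. E(h := True) \<in> A} + p False * measure ?F {E. E(h := False) \<in> A}"
    using S by (simp add: measure_def F.emeasure_pair_measure_Times enn2real_mult p_def pmf.rep_eq)
  finally show ?thesis .
qed

lemma parity_update_off_descendants:
  assumes h: "h \<noteq> fone"
  shows "k \<notin> descendants h \<Longrightarrow> parity (E(h := x)) k = parity E k"
proof (induction k rule: parent_induct)
  case one
  then show ?case using h by simp
next
  case (parent k)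
  then have "parent k \<notin> descendants h" "k \<noteq> h" using descendants_parent[OF h, of k] by auto
  with parent show ?case by (simp add: parity_parent)
qed

lemma parity_update_root: "parity (E(fone := x)) k = (parity E k \<noteq> (E fone \<noteq> x))"
proof (induction k rule: parent_induct)
  case (parent k)
  then show ?case by (auto simp: parity_parent)
qed auto

text \<open>
  An automorphism of the tree maps the edge from \<open>h\<close> to its parent to another edge, which is
  labelled by its endpoint further from the root.
\<close>

definition edge_image :: "('r fword \<Rightarrow> 'r fword) \<Rightarrow> 'r fword \<Rightarrow> 'r fword" where
  "edge_image \<phi> h = (if h = fone then fone
     else if \<phi> h \<noteq> fone \<and> parent (\<phi> h) = \<phi> (parent h) then \<phi> h else \<phi> (parent h))"

context
  fixes \<phi> :: "'r fword \<Rightarrow> 'r fword"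
  assumes aut: "cayley_aut \<phi>"
begin

lemma edge_image_cases:
  assumes h: "h \<noteq> fone"
  obtains "\<phi> h \<noteq> fone" "parent (\<phi> h) = \<phi> (parent h)" "edge_image \<phi> h = \<phi> h"
  | "\<phi> (parent h) \<noteq> fone" "parent (\<phi> (parent h)) = \<phi> h" "edge_image \<phi> h = \<phi> (parent h)"
proof -
  have "cayley_adj (parent h) h" using h by (simp add: cayley_adj_iff_parent)
  then have "cayley_adj (\<phi> (parent h)) (\<phi> h)" using aut by (simp add: cayley_aut_def)
  then have alt: "\<phi> h \<noteq> fone \<and> parent (\<phi> h) = \<phi> (parent h)
      \<or> \<phi> (parent h) \<noteq> fone \<and> parent (\<phi> (parent h)) = \<phi> h"
    by (simp only: cayley_adj_iff_parent)
  show ?thesis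
  proof (cases "\<phi> h \<noteq> fone \<and> parent (\<phi> h) = \<phi> (parent h)")
    case True
    then show ?thesis by (intro that(1)) (simp_all add: edge_image_def h)
  next
    case False
    with alt have "\<phi> (parent h) \<noteq> fone" "parent (\<phi> (parent h)) = \<phi> h" by blast+
    moreover have "edge_image \<phi> h = \<phi> (parent h)" using False h by (simp only: edge_image_def if_False)
    ultimately show ?thesis by (rule that(2))
  qed
qed

lemma edge_image_eq_fone_iff: "edge_image \<phi> h = fone \<longleftrightarrow> h = fone"
  by (cases "h = fone") (simp add: edge_image_def, metis edge_image_cases)

lemma edge_image_endpoints:
  assumes "h \<noteq> fone"
  shows "{edge_image \<phi> h, parent (edge_image \<phi> h)} = {\<phi> h, \<phi> (parent h)}"
  by (rule edge_image_cases[OF assms]) auto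

lemma inj_edge_image: "inj (edge_image \<phi>)"
proof (rule injI)
  fix h k assume eq: "edge_image \<phi> h = edge_image \<phi> k"
  show "h = k"
  proof (cases "h = fone")
    case True
    with eq show ?thesis by (metis edge_image_eq_fone_iff)
  next
    case False
    then have k: "k \<noteq> fone" using eq by (metis edge_image_eq_fone_iff)
    have inj: "inj \<phi>" using aut by (simp add: cayley_aut_def bij_is_inj)
    have "\<phi> ` {h, parent h} = \<phi> ` {k, parent k}"
      using edge_image_endpoints[OF False] edge_image_endpoints[OF k] eq by simp
    then have "{h, parent h} = {k, parent k}" using inj by (simp only: inj_image_eq_iff)
    then show ?thesis
      using depth_parent[OF False] depth_parent[OF k] by (auto simp: doubleton_eq_iff)
  qed
qed

lemma parity_automorphism:
  "parity E (\<phi> g) = parity ((E \<circ> edge_image \<phi>)(fone := parity E (\<phi> fone))) g"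
proof (induction g rule: parent_induct)
  case (parent g)
  have "parity E (\<phi> g) = (parity E (\<phi> (parent g)) \<noteq> E (edge_image \<phi> g))"
    by (rule edge_image_cases[OF parent(1)]) (auto simp: parity_parent)
  then show ?case using parent by (simp add: parity_parent[OF parent(1)])
qed simp

lemma measurable_edge_reindex: "(\<lambda>E. E \<circ> edge_image \<phi>) \<in> flip_law \<beta> \<rightarrow>\<^sub>M flip_law \<beta>"
  by (rule measurable_into_flip_law) simp

lemma distr_flip_law_reindex: "distr (flip_law \<beta>) (flip_law \<beta>) (\<lambda>E. E \<circ> edge_image \<phi>) = flip_law \<beta>"
proof -
  let ?M = "\<lambda>g :: 'r fword. measure_pmf (bernoulli_pmf (if g = fone then 1 / 2 else \<beta>))"
  have "distr (PiM UNIV ?M) (PiM UNIV (\<lambda>g. ?M (edge_image \<phi> g))) (\<lambda>E. \<lambda>g\<in>UNIV. E (edge_image \<phi> g))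
      = PiM UNIV (\<lambda>g. ?M (edge_image \<phi> g))"
    by (rule distr_PiM_reindex) (auto intro: measure_pmf.prob_space_axioms inj_edge_image)
  then show ?thesis by (simp add: edge_image_eq_fone_iff flip_law_def o_def restrict_UNIV)
qed

text \<open>
  The root spin is uniform and independent of the flips, so re-rooting the tree does not change the
  law of the bits.
\<close>

lemma distr_flip_law_automorphism:
  "distr (flip_law \<beta>) (flip_law \<beta>) (\<lambda>E. (E \<circ> edge_image \<phi>)(fone := parity E (\<phi> fone))) = flip_law \<beta>"
proof -
  let ?F = "flip_law \<beta> :: ('r fword \<Rightarrow> bool) measure"
  let ?T = "\<lambda>E. (E \<circ> edge_image \<phi>)(fone := parity E (\<phi> fone))"
  interpret F: prob_space ?F by (rule prob_space_flip_law)
  define c where "c E = (parity E (\<phi> fone) \<noteq> E fone)" for E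
  have c_upd: "c (E(fone := x)) = c E" for E x by (auto simp: c_def parity_update_root)
  have upd: "E(fone := x) \<circ> edge_image \<phi> = (E \<circ> edge_image \<phi>)(fone := x)" for E x
    by (rule ext) (auto simp: edge_image_eq_fone_iff)
  have T_upd: "?T (E(fone := x)) = (E \<circ> edge_image \<phi>)(fone := (x \<noteq> c E))" for E x
    using c_upd[of E x] by (auto simp: upd c_def)
  have meas_T: "?T \<in> ?F \<rightarrow>\<^sub>M ?F"
  proof (rule measurable_into_flip_law)
    show "(\<lambda>E. ?T E g) \<in> ?F \<rightarrow>\<^sub>M count_space UNIV" for g by (cases "g = fone") simp_all
  qed
  have meas_x: "(\<lambda>E. (E \<circ> edge_image \<phi>)(fone := x)) \<in> ?F \<rightarrow>\<^sub>M ?F" for x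
  proof (rule measurable_into_flip_law)
    show "(\<lambda>E. ((E \<circ> edge_image \<phi>)(fone := x)) g) \<in> ?F \<rightarrow>\<^sub>M count_space UNIV" for g
      by (cases "g = fone") simp_all
  qed
  have "measure ?F {E. ?T E \<in> B} = measure ?F B" if B: "B \<in> sets ?F" for B
  proof -
    define B' where "B' x = {E. (E \<circ> edge_image \<phi>)(fone := x) \<in> B}" for x
    define C where "C = {E. c E}"
    have B': "B' x \<in> sets ?F" for x
      using measurable_sets[OF meas_x B, of x] by (simp add: B'_def vimage_def)
    have C: "C \<in> sets ?F"
    proof -
      have "(\<lambda>E. \<not> (parity E (\<phi> fone) \<longleftrightarrow> E fone)) \<in> ?F \<rightarrow>\<^sub>M count_space UNIV" by measurable
      then have "(\<lambda>E. \<not> (parity E (\<phi> fone) \<longleftrightarrow> E fone)) -` {True} \<inter> space ?F \<in> sets ?F"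
        by (rule measurable_sets) simp
      then show ?thesis by (simp add: C_def c_def vimage_def)
    qed
    have split: "measure ?F (B' x) = measure ?F (B' x \<inter> C) + measure ?F (B' x - C)" for x
      by (subst F.finite_measure_Union[symmetric]) (use B' C in \<open>auto intro!: arg_cong[where f = "measure ?F"]\<close>)
    have joint: "measure ?F {E. (E \<circ> edge_image \<phi>)(fone := (x \<noteq> c E)) \<in> B}
        = measure ?F (B' (\<not> x) \<inter> C) + measure ?F (B' x - C)" for x
    proof -
      have "{E. (E \<circ> edge_image \<phi>)(fone := (x \<noteq> c E)) \<in> B} = (B' (\<not> x) \<inter> C) \<union> (B' x - C)"
        (is "?L = ?R")
      proof (rule Set.set_eqI)
        fix E show "E \<in> ?L \<longleftrightarrow> E \<in> ?R"
          by (cases "c E"; cases x) (simp_all add: B'_def C_def)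
      qed
      then show ?thesis using B' C by (simp add: F.finite_measure_Union disjoint_iff)
    qed
    have "{E. ?T E \<in> B} \<in> sets ?F" using measurable_sets[OF meas_T B] by (simp add: vimage_def)
    then have "measure ?F {E. ?T E \<in> B}
      = 1 / 2 * measure ?F {E. (E \<circ> edge_image \<phi>)(fone := (True \<noteq> c E)) \<in> B}
      + 1 / 2 * measure ?F {E. (E \<circ> edge_image \<phi>)(fone := (False \<noteq> c E)) \<in> B}"
      by (subst measure_flip_law_resample[where h = fone]) (simp_all only: mem_Collect_eq T_upd, simp)
    also have "\<dots> = 1 / 2 * measure ?F (B' True) + 1 / 2 * measure ?F (B' False)"
      unfolding joint split[of True] split[of False] by (simp add: field_simps)
    also have "\<dots> = measure ?F {E. E \<circ> edge_image \<phi> \<in> B}"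
    proof -
      have "{E. E \<circ> edge_image \<phi> \<in> B} \<in> sets ?F"
        using measurable_sets[OF measurable_edge_reindex B] by (simp add: vimage_def)
      then show ?thesis
        by (subst measure_flip_law_resample[where h = fone]) (simp_all only: mem_Collect_eq upd B'_def, simp)
    qed
    also have "\<dots> = measure (distr ?F ?F (\<lambda>E. E \<circ> edge_image \<phi>)) B"
      using measure_distr[OF measurable_edge_reindex B] by (simp add: vimage_def)
    finally show ?thesis by (simp only: distr_flip_law_reindex)
  qed
  then show ?thesis
    by (intro measure_eqI) (simp_all add: emeasure_distr[OF meas_T] F.emeasure_eq_measure vimage_def)
qed

end

text \<open>
  The law of the configuration: a uniform spin at the root, flipped along each edge independently with
  probability \<open>\<beta>\<close>.
\<close>

definition free_chain :: "real \<Rightarrow> ('r::finite) config measure" where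
  "free_chain \<beta> = distr (flip_law \<beta>) borel spins"

lemma free_chain_borel_probs: "free_chain \<beta> \<in> borel_probs"
  using prob_space.prob_space_distr[OF prob_space_flip_law measurable_spins]
  by (simp add: borel_probs_def free_chain_def)

lemma measure_free_chain:
  "A \<in> sets borel \<Longrightarrow> measure (free_chain \<beta>) A = measure (flip_law \<beta>) {E. spins E \<in> A}"
  unfolding free_chain_def by (subst measure_distr[OF measurable_spins]) (simp_all add: vimage_def)

lemma measurable_relabel: "(\<lambda>x :: 'r config. x \<circ> \<phi>) \<in> borel \<rightarrow>\<^sub>M (borel :: ('r::finite) config measure)"
  by (intro borel_measurable_continuous_onI continuous_on_coordinatewise_then_product)
    (simp add: continuous_on_product_coordinates)

lemma free_chain_automorphism:
  fixes \<phi> :: "('r::finite) fword \<Rightarrow> 'r fword"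
  assumes aut: "cayley_aut \<phi>"
  shows "distr (free_chain \<beta>) borel (\<lambda>x. x \<circ> \<phi>) = free_chain \<beta>"
proof -
  let ?T = "\<lambda>E. (E \<circ> edge_image \<phi>)(fone := parity E (\<phi> fone))"
  have meas_T: "?T \<in> flip_law \<beta> \<rightarrow>\<^sub>M flip_law \<beta>"
  proof (rule measurable_into_flip_law)
    show "(\<lambda>E. ?T E g) \<in> flip_law \<beta> \<rightarrow>\<^sub>M count_space UNIV" for g by (cases "g = fone") simp_all
  qed
  have eq: "(\<lambda>x. x \<circ> \<phi>) \<circ> spins = spins \<circ> ?T"
    by (intro ext) (simp only: o_apply spins_def parity_automorphism[OF aut, symmetric])
  have "distr (free_chain \<beta>) borel (\<lambda>x. x \<circ> \<phi>) = distr (flip_law \<beta>) borel ((\<lambda>x. x \<circ> \<phi>) \<circ> spins)"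
    unfolding free_chain_def by (rule distr_distr[OF measurable_relabel measurable_spins])
  also have "\<dots> = distr (distr (flip_law \<beta>) (flip_law \<beta>) ?T) borel spins"
    unfolding eq by (rule distr_distr[OF measurable_spins meas_T, symmetric])
  finally show ?thesis unfolding distr_flip_law_automorphism[OF aut] free_chain_def .
qed

text \<open>
  What is seen off the descendants of \<open>h\<close> does not depend on the bit at \<open>h\<close>, which decides whether \<open>h\<close> has
  the spin of its parent.
\<close>

lemma free_chain_child:
  fixes h :: "('r::finite) fword"
  assumes h: "h \<noteq> fone" and W: "finite W" "parent h \<in> W" "W \<inter> descendants h = {}" and \<beta>: "0 \<le> \<beta>" "\<beta> \<le> 1"
  shows "measure (free_chain \<beta>) {x. x h = b \<and> (\<forall>k\<in>W. x k = \<eta> k)}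
    = (if b = \<eta> (parent h) then 1 - \<beta> else \<beta>) * measure (free_chain \<beta>) {x. \<forall>k\<in>W. x k = \<eta> k}"
proof -
  let ?F = "flip_law \<beta> :: ('r fword \<Rightarrow> bool) measure"
  let ?C = "{E. \<forall>k\<in>W. spins E k = \<eta> k}"
  have cyl: "{x. \<forall>k\<in>W. x k = \<eta> k} = cylinder W \<eta>"
    "{x. x h = b \<and> (\<forall>k\<in>W. x k = \<eta> k)} = {x. x h = b} \<inter> cylinder W \<eta>" by (auto simp: cylinder_def)
  have sets: "{x. \<forall>k\<in>W. x k = \<eta> k} \<in> sets borel" "{x. x h = b \<and> (\<forall>k\<in>W. x k = \<eta> k)} \<in> sets borel"
    unfolding cyl using W(1) by (auto intro!: clopen_borel)
  let ?A = "{E. spins E \<in> {x. x h = b \<and> (\<forall>k\<in>W. x k = \<eta> k)}}"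
  have A: "?A \<in> sets ?F"
    using measurable_sets[OF measurable_spins sets(2), of \<beta>] by (simp add: vimage_def)
  have off: "spins (E(h := x)) k = spins E k" if "k \<in> W" for E x k
    using parity_update_off_descendants[OF h, of k] that W(3) by (auto simp: spins_def)
  have at_h: "spins (E(h := x)) h = (if x then (if spins E (parent h) = Plus then Minus else Plus) else spins E (parent h))" for E x
  proof -
    have "parent h \<notin> descendants h" using W by blast
    from parity_update_off_descendants[OF h this] show ?thesis
      by (cases "parity E (parent h)"; cases x) (simp_all add: spins_def parity_parent[OF h])
  qed
  have "{E. E(h := x) \<in> ?A} = (if x = (b \<noteq> \<eta> (parent h)) then ?C else {})" for x
  proof -
    have "spins (E(h := x)) h = b \<longleftrightarrow> x = (b \<noteq> \<eta> (parent h))" if "E \<in> ?C" for E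
      using that W(2) unfolding at_h by (cases b; cases "\<eta> (parent h)") auto
    then show ?thesis by (auto simp: off)
  qed
  then have "measure ?F ?A = (if b = \<eta> (parent h) then 1 - \<beta> else \<beta>) * measure ?F ?C"
    using measure_flip_law_resample[OF A, of h] h \<beta> by simp
  then show ?thesis using measure_free_chain[OF sets(1)] measure_free_chain[OF sets(2)] by simp
qed

lemma cayley_aut_right_mult:
  "cayley_aut (\<lambda>k. k \<otimes>\<^bsub>free_group\<^esub> g)"
proof -
  interpret G: group "free_group :: 'a fword monoid" by (rule group_free_group)
  have c: "x \<in> carrier free_group" for x :: "'a fword" by (simp add: free_group_def)
  have "bij (\<lambda>k. k \<otimes>\<^bsub>free_group\<^esub> g)"
    by (rule bij_betw_byWitness[where f' = "\<lambda>k. k \<otimes>\<^bsub>free_group\<^esub> inv\<^bsub>free_group\<^esub> g"]) (auto simp: G.m_assoc c)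
  moreover have "cayley_adj (h \<otimes>\<^bsub>free_group\<^esub> g) (k \<otimes>\<^bsub>free_group\<^esub> g) \<longleftrightarrow> cayley_adj h k" for h k
    by (simp add: cayley_adj_def G.m_assoc[symmetric] c)
  ultimately show ?thesis by (simp add: cayley_aut_def)
qed

lemma edge_side_automorphism:
  assumes aut: "cayley_aut \<phi>"
  shows "\<phi> ` edge_side g h \<subseteq> edge_side (\<phi> g) (\<phi> h)"
proof -
  let ?R = "\<lambda>g h a b. cayley_adj a b \<and> {a, b} \<noteq> {g, h}"
  have inj: "inj \<phi>" and adj: "\<And>a b. cayley_adj (\<phi> a) (\<phi> b) \<longleftrightarrow> cayley_adj a b"
    using aut by (auto simp: cayley_aut_def bij_is_inj)
  have "(?R (\<phi> g) (\<phi> h))\<^sup>*\<^sup>* (\<phi> g) (\<phi> k)" if "(?R g h)\<^sup>*\<^sup>* g k" for k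
    using that
  proof (induction rule: rtranclp_induct)
    case (step a b)
    have "\<phi> ` {a, b} \<noteq> \<phi> ` {g, h}"
      using step(2) inj_image_eq_iff[OF inj, of "{a, b}" "{g, h}"] by blast
    then have "?R (\<phi> g) (\<phi> h) (\<phi> a) (\<phi> b)" using step(2) adj by simp
    with step(3) show ?case by (rule rtranclp.rtrancl_into_rtrancl)
  qed simp
  then show ?thesis by (auto simp: edge_side_def)
qed

lemma measure_free_chain_automorphism:
  fixes \<phi> :: "('r::finite) fword \<Rightarrow> 'r fword"
  assumes aut: "cayley_aut \<phi>" and A: "A \<in> sets borel"
  shows "measure (free_chain \<beta>) {x. x \<circ> \<phi> \<in> A} = measure (free_chain \<beta>) A"
proof -
  have m: "(\<lambda>x. x \<circ> \<phi>) \<in> free_chain \<beta> \<rightarrow>\<^sub>M borel"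
    using measurable_relabel by (simp add: free_chain_def)
  have "space (free_chain \<beta> :: 'r config measure) = UNIV"
    by (rule borel_probsD(3)[OF free_chain_borel_probs])
  then show ?thesis
    using measure_distr[OF m A] by (simp add: free_chain_automorphism[OF aut] vimage_def)
qed

lemma free_chain_site: "measure (free_chain \<beta>) {x :: ('r::finite) config. x g = b} = 1 / 2"
proof -
  interpret G: group "free_group :: 'r fword monoid" by (rule group_free_group)
  have "{x :: 'r config. x g = b} = {x. x \<circ> (\<lambda>k. k \<otimes>\<^bsub>free_group\<^esub> g) \<in> {x. x fone = b}}"
    using G.l_one[of g] by (simp add: free_group_def)
  then have "measure (free_chain \<beta>) {x :: 'r config. x g = b} = measure (free_chain \<beta>) {x :: 'r config. x fone = b}"
    using measure_free_chain_automorphism[OF cayley_aut_right_mult, of "{x. x fone = b}" \<beta> g] by (simp add: clopen_borel)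
  also have "\<dots> = measure (flip_law \<beta>) {E :: 'r fword \<Rightarrow> bool. spins E fone = b}"
    by (subst measure_free_chain) (simp_all add: clopen_borel)
  also have "\<dots> = 1 / 2"
  proof -
    interpret F: prob_space "flip_law \<beta> :: ('r fword \<Rightarrow> bool) measure" by (rule prob_space_flip_law)
    have sp: "spins E fone = b \<longleftrightarrow> E fone = (b = Plus)" for E :: "'r fword \<Rightarrow> bool"
      by (cases b) (auto simp: spins_def)
    have "(\<lambda>E. E fone) -` {b = Plus} \<inter> space (flip_law \<beta>) \<in> sets (flip_law \<beta> :: ('r fword \<Rightarrow> bool) measure)"
      by (rule measurable_sets[OF measurable_flip]) simp
    then have "{E :: 'r fword \<Rightarrow> bool. spins E fone = b} \<in> sets (flip_law \<beta>)" by (simp add: sp vimage_def)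
    from measure_flip_law_resample[OF this, of fone] show ?thesis
      using F.prob_space by (cases b) (simp_all add: spins_def)
  qed
  finally show ?thesis .
qed

lemma ising_beta_bounds: "0 \<le> ising_beta J t" "ising_beta J t \<le> 1"
  by (auto simp: ising_beta_def divide_le_eq add_pos_pos)

lemma trans_prob_free: "trans_prob J 0 a b = (if b = a then 1 - ising_beta J 0 else ising_beta J 0)"
  by (cases a; cases b) simp_all

lemma site_prob_free: "site_prob J 0 b = 1 / 2"
proof -
  have "exp (- 2 * J) + 1 > 0" by (simp add: add_pos_pos)
  then have "(exp (- 2 * J) + 1) / (2 * (exp (- 2 * J) + 1)) = 1 / 2"
    by (metis less_irrefl mult.right_neutral nonzero_mult_divide_mult_cancel_right2 mult.commute)
  then have "ising_alpha J 0 = 1 / 2" by (simp add: ising_alpha_def distrib_left)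
  then show ?thesis by (cases b) simp_all
qed

lemma free_chain_is_ising_chain: "is_ising_chain J 0 (free_chain (ising_beta J 0) :: ('r::finite) config measure)"
proof -
  let ?\<mu> = "free_chain (ising_beta J 0) :: 'r config measure"
  interpret P: prob_space ?\<mu> using borel_probsD(1)[OF free_chain_borel_probs] .
  have space: "space ?\<mu> = UNIV" by (rule borel_probsD(3)[OF free_chain_borel_probs])
  have "\<P>(x in ?\<mu>. x h = b \<bar> \<forall>k\<in>W. x k = \<eta> k) = trans_prob J 0 (\<eta> g) b"
    if gh: "cayley_adj g h" and W: "finite W" "g \<in> W" "W \<subseteq> edge_side g h"
      and pos: "\<P>(x in ?\<mu>. \<forall>k\<in>W. x k = \<eta> k) > 0" for g h W \<eta> b
  proof -
    interpret G: group "free_group :: 'r fword monoid" by (rule group_free_group)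
    have c: "x \<in> carrier free_group" for x :: "'r fword" by (simp add: free_group_def)
    \<comment> \<open>Translate \<open>g\<close> to the root, where \<open>h\<close> becomes a child.\<close>
    let ?\<phi> = "\<lambda>k. k \<otimes>\<^bsub>free_group\<^esub> inv\<^bsub>free_group\<^esub> g"
    let ?\<psi> = "\<lambda>k. k \<otimes>\<^bsub>free_group\<^esub> g"
    have aut: "cayley_aut ?\<phi>" by (rule cayley_aut_right_mult)
    have inv: "?\<psi> (?\<phi> k) = k" for k by (simp add: G.m_assoc c)
    have g: "?\<phi> g = fone" using G.r_inv[of g] by (simp add: free_group_def)
    have adj: "cayley_adj fone (?\<phi> h)" using aut gh g by (metis cayley_aut_def)
    then have h: "?\<phi> h \<noteq> fone" "parent (?\<phi> h) = fone" by (auto simp: cayley_adj_iff_parent)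
    let ?W = "?\<phi> ` W" and ?\<eta> = "\<eta> \<circ> ?\<psi>"
    have "?W \<subseteq> edge_side fone (?\<phi> h)"
      using edge_side_automorphism[OF aut, of g h] W(3) unfolding g by blast
    then have disj: "?W \<inter> descendants (?\<phi> h) = {}"
      using edge_side_disjoint_descendants[OF h(1)] unfolding h(2) by blast
    have root: "parent (?\<phi> h) \<in> ?W" unfolding h(2) g[symmetric] using W(2) by blast
    have "{x. \<forall>k\<in>W. x k = \<eta> k} = cylinder W \<eta>" by (simp add: cylinder_def)
    then have sets: "{x. \<forall>k\<in>W. x k = \<eta> k} \<in> sets borel" using clopen_borel[OF clopen_cylinder[OF W(1)]] by simp
    have "{x. x h = b \<and> (\<forall>k\<in>W. x k = \<eta> k)} = {x. x h = b} \<inter> {x. \<forall>k\<in>W. x k = \<eta> k}" by blast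
    then have sets': "{x. x h = b \<and> (\<forall>k\<in>W. x k = \<eta> k)} \<in> sets borel"
      using sets.Int[OF clopen_borel[OF clopen_config_coordinate] sets, of h b] by (simp only:)
    have moved: "measure ?\<mu> {x. \<forall>k\<in>W. x k = \<eta> k} = measure ?\<mu> {x. \<forall>k\<in>?W. x k = ?\<eta> k}"
      using measure_free_chain_automorphism[OF aut sets, of "ising_beta J 0"] by (simp add: inv)
    have moved': "measure ?\<mu> {x. x h = b \<and> (\<forall>k\<in>W. x k = \<eta> k)}
        = measure ?\<mu> {x. x (?\<phi> h) = b \<and> (\<forall>k\<in>?W. x k = ?\<eta> k)}"
      using measure_free_chain_automorphism[OF aut sets', of "ising_beta J 0"] by (simp add: inv)
    have \<eta>g: "?\<eta> (parent (?\<phi> h)) = \<eta> g" unfolding h(2) using G.l_one[of g] by (simp add: free_group_def)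
    have "measure ?\<mu> {x. x h = b \<and> (\<forall>k\<in>W. x k = \<eta> k)}
      = trans_prob J 0 (\<eta> g) b * measure ?\<mu> {x. \<forall>k\<in>W. x k = \<eta> k}"
      unfolding moved moved' trans_prob_free \<eta>g[symmetric]
      by (rule free_chain_child[OF h(1) finite_imageI[OF W(1)] root disj ising_beta_bounds])
    then show ?thesis using pos by (simp add: cond_prob_def space)
  qed
  moreover have "\<P>(x in ?\<mu>. x g = b) = site_prob J 0 b" for g b
    using free_chain_site[of "ising_beta J 0" g b] by (simp only: site_prob_free space UNIV_I simp_thms)
  ultimately show ?thesis
    unfolding is_ising_chain_def
    by (intro conjI allI impI free_chain_borel_probs free_chain_automorphism; (elim conjE)?; assumption?) blast+
qed

lemma free_boundary_state_eq: "free_boundary_state J = (free_chain (ising_beta J 0) :: ('r::finite) config measure)"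
  unfolding free_boundary_state_def ising_chain_def
  by (rule the_equality) (auto intro: free_chain_is_ising_chain is_ising_chain_unique)

section \<open>The free boundary state does not maximize the f-pressure\<close>

lemma f_pressure_balanced_le:
  fixes \<mu> :: "('r::finite) config measure"
  assumes \<mu>: "\<mu> \<in> borel_probs" "measure \<mu> {x. x \<one>\<^bsub>free_group\<^esub> = Plus} = 1 / 2" and e: "e > 0"
  shows "f_pressure J \<mu> \<le> ereal (balanced_pressure CARD('r) J + e)"
proof -
  obtain r where r: "CARD('r) = Suc r" using zero_less_card_finite[where 'a = 'r] gr0_conv_Suc by blast
  obtain d where d: "d > 0" and ev: "\<forall>\<^sub>F n in sequentially.
    (\<Sum>k\<in>{k. k \<le> n \<and> real k / real n \<in> ball (1 / 2) d}. real (n choose k) * ((2 * cosh J) ^ n / real (n choose k)) ^ CARD('r))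
      \<le> exp (real n * (balanced_pressure CARD('r) J + e))"
    using balanced_sum_le[OF e, of J r] unfolding r by blast
  let ?N = "{\<nu> :: 'r config measure. \<nu> \<in> borel_probs \<and> measure \<nu> {x. x \<one>\<^bsub>free_group\<^esub> = Plus} \<in> ball (1 / 2) d}"
  show ?thesis
  proof (rule f_pressure_le)
    show "openin weak_star ?N" by (rule openin_weak_star_clopen) simp_all
    show "\<mu> \<in> ?N" unfolding mem_Collect_eq \<mu>(2) using \<mu>(1) d by simp
    show "\<forall>\<^sub>F n in sequentially. partition_fn J ?N n \<le> exp (real n * (balanced_pressure CARD('r) J + e))"
      using ev eventually_gt_at_top[of 0]
    proof eventually_elim
      case (elim n)
      have "partition_fn J ?N n \<le> (\<Sum>k\<in>{k. k \<le> n \<and> real k / real n \<in> ball (1 / 2) d}.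
          real (n choose k) * ((2 * cosh J) ^ n / real (n choose k)) ^ CARD('r))"
        by (rule partition_fn_balanced_le) (use elim in auto)
      with elim show ?case by linarith
    qed
  qed
qed

lemma partition_fn_UNIV_growth:
  assumes r: "CARD('r::finite) \<ge> 2" and J: "J > J_uniq CARD('r)"
  shows "\<exists>B > balanced_pressure CARD('r) J. \<forall>\<^sub>F n in sequentially.
    exp (real n * B) \<le> partition_fn J (UNIV :: 'r config measure set) n"
proof -
  obtain a d where ad: "0 < d" "d < a" "d < 1 - a"
    and rate: "balanced_pressure CARD('r) J < pair_rate CARD('r) J a d"
    using exists_pair_rate_greater[OF r J] by blast
  obtain B where B: "balanced_pressure CARD('r) J < B" "B < pair_rate CARD('r) J a d"
    using dense[OF rate] by blast
  have r1: "CARD('r) \<ge> 1" using r by simp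
  have "\<forall>\<^sub>F n in sequentially. exp (real n * B) \<le> partition_fn J (UNIV :: 'r config measure set) n"
    using pair_sum_ge[OF r1 ad B(2)] eventually_gt_at_top[of 0]
  proof eventually_elim
    case (elim n)
    then obtain k j where "k \<le> n" and le: "exp (real n * B)
      \<le> real (n choose k) * (exp (J * (real n - 4 * real j)) * real (k choose j) * real ((n - k) choose j)
        / real (n choose k)) ^ CARD('r)" by blast
    note le
    also note partition_fn_UNIV_ge[OF elim(2) \<open>k \<le> n\<close>]
    finally show ?case .
  qed
  with B(1) show ?thesis by blast
qed

theorem proposition1p1:
  fixes J :: real
  assumes "CARD('r::finite) \<ge> 2"
    and "J > J_uniq CARD('r)"
  shows "\<not> f_equilibrium J (free_boundary_state J :: 'r config measure) \<and>
    (\<exists>\<nu> :: 'r config measure.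
       \<nu> \<in> borel_probs \<and> shift_invariant \<nu> \<and>
       f_pressure J \<nu> > f_pressure J (free_boundary_state J :: 'r config measure))"
proof -
  let ?\<mu> = "free_boundary_state J :: 'r config measure"
  obtain B where B: "balanced_pressure CARD('r) J < B"
    and growth: "\<forall>\<^sub>F n in sequentially. exp (real n * B) \<le> partition_fn J (UNIV :: 'r config measure set) n"
    using partition_fn_UNIV_growth[OF assms] by blast
  obtain \<nu> :: "'r config measure" where \<nu>: "\<nu> \<in> borel_probs" "shift_invariant \<nu>" "ereal B \<le> f_pressure J \<nu>"
    using exists_shift_invariant_f_pressure_ge[OF eventually_frequently[OF _ growth]] by auto
  have "f_pressure J ?\<mu> \<le> ereal (balanced_pressure CARD('r) J + (B - balanced_pressure CARD('r) J) / 2)"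
    by (rule f_pressure_balanced_le)
      (use B in \<open>simp_all add: free_boundary_state_eq free_chain_borel_probs free_chain_site\<close>)
  also have "\<dots> < ereal B" using B by (simp add: field_simps)
  also note \<nu>(3)
  finally have less: "f_pressure J ?\<mu> < f_pressure J \<nu>" .
  then have "\<not> f_equilibrium J ?\<mu>" using \<nu>(1,2) unfolding f_equilibrium_def by (metis not_le)
  with \<nu> less show ?thesis by blast
qed

end
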